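(* Suppose the following three conditions hold. (A) $E(w(1)+w(2))=1$. (B) $\sum_{i\in S}P(w(i)=1)<1$. (C) The random variables $w(1),w(2),w(3)$ are independent and, for every $p\in(0,1)$, there exists a constant $\varepsilon>0$ such that $P(w(i)\leq x\varepsilon\mid w(i)\leq x)\leq p$ for all $x\in(0,1]$ and $i\in S$ (equivalently, $P(w(i)\leq \varepsilon x)\leq p\,P(w(i)\leq x)$ for all $x\in(0,1]$, $i\in S$). Then, $P$-a.s., the Hausdorff dimension of the random metric space $(T,R)$ satisfies $\dim_H(T)=\alpha$, where $\alpha$ is the unique positive solution of $E\left(\sum_{i\in S}w(i)^\alpha\right)=1$.
   Context: Addresses: $S:=\{1,2,3\}$; $\Sigma_n:=S^n$ (with $\Sigma_0:=\{\emptyset\}$), $\Sigma_*:=\bigcup_{n\ge0}\Sigma_n$; $ij$ denotes concatenation, $|i|$ the length of $i\in\Sigma_*$, and $i|m$ the truncation of $i$ to its first $m$ letters. Fractal: fix $c\in(0,1/2)$ and maps on $\mathbb{R}^2$: $\psi_1(x,y)=\frac12(1-x,y)$, $\psi_2(x,y)=\frac12(1+x,-y)$, $\psi_3(x,y)=(\frac12+cy,cx)$. $T$ is the unique non-empty compact subset of $\mathbb{R}^2$ with $T=\bigcup_{i\in S}\psi_i(T)$. For $i\in\Sigma_n$, $\psi_i:=\psi_{i_1}\circ\dots\circ\psi_{i_n}$ ($\psi_\emptyset$ is the identity). $V^0:=\{(0,0),(1,0)\}$, $V^n:=\bigcup_{i\in\Sigma_n}\psi_i(V^0)$, $V^*:=\bigcup_{n\ge0}V^n$.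 $T$ is the Euclidean closure of $V^*$. Cascade: $(w(i))_{i\in\Sigma_*\setminus\{\emptyset\}}$ are random variables on a probability space with measure $P$ (expectation $E$), with values in $[0,1]$ and non-zero $P$-a.s., such that the triples $(w(ij))_{j\in S}$, $i\in\Sigma_*$, are independent copies of $(w(j))_{j\in S}$ (no independence is assumed within a triple unless stated). $l(\emptyset):=1$, $l(i):=w(i|1)w(i|2)\cdots w(i)$. Under the condition $E(w(1)+w(2))=1$, the limits $R_i:=\lim_{n\to\infty}\sum_{j\in\{1,2\}^n}l(ij)/l(i)$, $i\in\Sigma_*$, exist in $(0,\infty)$ $P$-a.s. Random metric: for $f:V^n\to\mathbb{R}$ let $\mathcal{E}^n(f,f):=\sum_{i\in\Sigma_n}\frac{1}{l(i)R_i}\left(f(\psi_i(0,0))-f(\psi_i(1,0))\right)^2$. For $f:V^*\to\mathbb{R}$ let $\mathcal{E}^*(f,f):=\lim_{n\to\infty}\mathcal{E}^n(f|_{V^n},f|_{V^n})$, with domain $\mathcal{F}^*$ the set of $f$ for which this limit exists finitely. Define $R^*(x,x)=0$ and, for $x\ne y$ in $V^*$, $R^*(x,y)^{-1}:=\inf\{\mathcal{E}^*(f,f): f\in\mathcal{F}^*, f(x)=0, f(y)=1\}$; this is $P$-a.s. a metric on $V^*$. Under the conditions $E(w(1)+w(2))=1$ and $\sum_{i\in S}P(w(i)=1)<1$, $P$-a.s. $R(x,y):=\lim_{n\to\infty}R^*(x_n,y_n)$, for any $x_n,y_n\in V^*$ converging in Euclidean distance to $x,y\in T$, is a well-defined metric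 on $T$ inducing the Euclidean topology; the Hausdorff dimension $\dim_H(T)$ is taken with respect to $R$. These two conditions also guarantee that the equation $E(\sum_{i\in S}w(i)^\theta)=1$ has a unique positive solution $\theta=\alpha$, and $\alpha\in(1,\infty)$. *)

theory Defs
  imports "HOL-Probability.Probability"
begin

section \<open>Hausdorff dimension of a metric space\<close>

definition ediam :: "('a \<Rightarrow> 'a \<Rightarrow> real) \<Rightarrow> 'a set \<Rightarrow> ennreal" where
  "ediam d U = (SUP x\<in>U. SUP y\<in>U. ennreal (d x y))"

text \<open>
  Only used for \<open>s > 0\<close> and \<open>\<delta> < \<infinity>\<close>: the covering sets then have finite diameter, so
  \<^const>\<open>enn2real\<close> loses nothing, and \<open>0 powr s = 0\<close> is the correct weight of a point and of
  the empty set (which lets finite covers be padded to sequences).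
\<close>

definition hausdorff_premeasure ::
  "'a set \<Rightarrow> ('a \<Rightarrow> 'a \<Rightarrow> real) \<Rightarrow> real \<Rightarrow> real \<Rightarrow> 'a set \<Rightarrow> ennreal" where
  "hausdorff_premeasure X d s \<delta> A =
     Inf {(\<Sum>n. ennreal (enn2real (ediam d (U n)) powr s)) | U :: nat \<Rightarrow> 'a set.
            A \<subseteq> (\<Union>n. U n) \<and> (\<forall>n. U n \<subseteq> X \<and> ediam d (U n) \<le> ennreal \<delta>)}"

definition hausdorff_measure ::
  "'a set \<Rightarrow> ('a \<Rightarrow> 'a \<Rightarrow> real) \<Rightarrow> real \<Rightarrow> 'a set \<Rightarrow> ennreal" where
  "hausdorff_measure X d s A = (SUP \<delta>\<in>{0<..}. hausdorff_premeasure X d s \<delta> A)"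

definition hausdorff_dim :: "'a set \<Rightarrow> ('a \<Rightarrow> 'a \<Rightarrow> real) \<Rightarrow> ereal" where
  "hausdorff_dim X d = Inf {ereal s | s. 0 < s \<and> hausdorff_measure X d s X = 0}"


section \<open>Addresses and the fractal\<close>

text \<open>
  Addresses are lists of letters; \<^term>\<open>lists letters\<close> is the set of all of them, \<open>i @ j\<close> is
  concatenation and \<^term>\<open>take m i\<close> is truncation to the first \<open>m\<close> letters.
\<close>

definition letters :: "nat set" where
  "letters = {1, 2, 3}"

definition words :: "nat set \<Rightarrow> nat \<Rightarrow> nat list set" where
  "words A n = {i \<in> lists A. length i = n}"

definition psi :: "real \<Rightarrow> nat \<Rightarrow> real \<times> real \<Rightarrow> real \<times> real" where
  "psi c j = (\<lambda>(x, y).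
     if j = 1 then ((1 - x) / 2, y / 2)
     else if j = 2 then ((1 + x) / 2, - y / 2)
     else (1 / 2 + c * y, c * x))"

primrec psi_word :: "real \<Rightarrow> nat list \<Rightarrow> real \<times> real \<Rightarrow> real \<times> real" where
  "psi_word c [] = id"
| "psi_word c (j # i) = psi c j \<circ> psi_word c i"

definition fractal :: "real \<Rightarrow> (real \<times> real) set" where
  "fractal c = (THE K. K \<noteq> {} \<and> compact K \<and> K = (\<Union>j\<in>letters. psi c j ` K))"

definition vertices :: "real \<Rightarrow> nat \<Rightarrow> (real \<times> real) set" where
  "vertices c n = (\<Union>i\<in>words letters n. psi_word c i ` {(0, 0), (1, 0)})"

definition all_vertices :: "real \<Rightarrow> (real \<times> real) set" where
  "all_vertices c = (\<Union>n. vertices c n)"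


section \<open>The multiplicative cascade\<close>

text \<open>
  The value of \<open>w\<close> at the empty address, and at lists that are not addresses, is never used.
\<close>

definition cascade :: "'a measure \<Rightarrow> (nat list \<Rightarrow> 'a \<Rightarrow> real) \<Rightarrow> bool" where
  "cascade M w \<longleftrightarrow>
     prob_space M \<and>
     (\<forall>i \<in> lists letters - {[]}. w i \<in> borel_measurable M \<and>
        (\<forall>\<omega>\<in>space M. w i \<omega> \<in> {0..1}) \<and> (AE \<omega> in M. w i \<omega> \<noteq> 0)) \<and>
     prob_space.indep_vars M (\<lambda>_. Pi\<^sub>M letters (\<lambda>_. borel))
       (\<lambda>i \<omega>. \<lambda>j\<in>letters. w (i @ [j]) \<omega>) (lists letters) \<and>
     (\<forall>i \<in> lists letters.
        distr M (Pi\<^sub>M letters (\<lambda>_. borel)) (\<lambda>\<omega>. \<lambda>j\<in>letters. w (i @ [j]) \<omega>) =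
        distr M (Pi\<^sub>M letters (\<lambda>_. borel)) (\<lambda>\<omega>. \<lambda>j\<in>letters. w [j] \<omega>))"

text \<open>
  From here on \<open>v = (\<lambda>i. w i \<omega>)\<close> is a single realisation of the cascade.
\<close>

definition cascade_prod :: "(nat list \<Rightarrow> real) \<Rightarrow> nat list \<Rightarrow> real" where
  "cascade_prod v i = (\<Prod>m = 1..length i. v (take m i))"

definition limit_factor :: "(nat list \<Rightarrow> real) \<Rightarrow> nat list \<Rightarrow> real" where
  "limit_factor v i =
     lim (\<lambda>n. \<Sum>j\<in>words {1, 2} n. cascade_prod v (i @ j) / cascade_prod v i)"


section \<open>The resistance metric\<close>

text \<open>
  Functions on \<^term>\<open>all_vertices c\<close> are represented by total functions on the plane; no
  definition below depends on their values elsewhere.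
\<close>

definition energy_n ::
  "real \<Rightarrow> (nat list \<Rightarrow> real) \<Rightarrow> nat \<Rightarrow> (real \<times> real \<Rightarrow> real) \<Rightarrow> real" where
  "energy_n c v n f =
     (\<Sum>i\<in>words letters n. 1 / (cascade_prod v i * limit_factor v i) *
        (f (psi_word c i (0, 0)) - f (psi_word c i (1, 0)))\<^sup>2)"

definition energy_dom :: "real \<Rightarrow> (nat list \<Rightarrow> real) \<Rightarrow> (real \<times> real \<Rightarrow> real) set" where
  "energy_dom c v = {f. convergent (\<lambda>n. energy_n c v n f)}"

definition energy :: "real \<Rightarrow> (nat list \<Rightarrow> real) \<Rightarrow> (real \<times> real \<Rightarrow> real) \<Rightarrow> real" where
  "energy c v f = lim (\<lambda>n. energy_n c v n f)"

definition vertex_resistance ::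
  "real \<Rightarrow> (nat list \<Rightarrow> real) \<Rightarrow> real \<times> real \<Rightarrow> real \<times> real \<Rightarrow> real" where
  "vertex_resistance c v x y =
     (if x = y then 0
      else inverse (Inf {energy c v f | f. f \<in> energy_dom c v \<and> f x = 0 \<and> f y = 1}))"

text \<open>
  The common limit along all approximating sequences of vertices. Off the fractal the value is
  set to 0 because the locale \<^locale>\<open>Metric_space\<close> asks for symmetry and nonnegativity at all
  points of the type, not only in the carrier.
\<close>

definition resistance ::
  "real \<Rightarrow> (nat list \<Rightarrow> real) \<Rightarrow> real \<times> real \<Rightarrow> real \<times> real \<Rightarrow> real" where
  "resistance c v x y =
     (if x \<in> fractal c \<and> y \<in> fractal c
      then THE r. \<forall>xs ys. range xs \<subseteq> all_vertices c \<longrightarrow> range ys \<subseteq> all_vertices c \<longrightarrow>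
             xs \<longlonglongrightarrow> x \<longrightarrow> ys \<longlonglongrightarrow> y \<longrightarrow>
             (\<lambda>n. vertex_resistance c v (xs n) (ys n)) \<longlonglongrightarrow> r
      else 0)"

end

(*
  A realisation is governed by the edge lengths a(i) = l(i) R_i, which satisfy
  a(i) = a(i1) + a(i2): the graph on V^n is a tree, and E^n is the energy of a resistor network on
  it.  Cutting the tree at the edge of a cell k of level n splits V^n into two sides, so the tree
  metric on V^n is a sum of a(k) over the cells that separate two vertices.  By the Cauchy-Schwarz
  inequality, and equality for a Gromov product, it equals the resistance R^*.  Since the lengths
  of the cells of level n are summable over n, it extends to T.

  Upper bound: cells of level n cover T, and E (sum_{|i| = n} a(i)^s) decays geometrically for
  s > alpha, because R has moments of all orders.

  Lower bound: let M_i be the limit of the martingale sum_j (l(ij) / l(i))^alpha, and give the cell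
  i the mass l(i)^alpha M_i.  A point in the cell i that avoids its two extremal subcells i2^k and
  i12^k is separated from all other cells of the level by the length of one of these subcells.  The
  size-biased expectation of the mass lost by discarding these subcells, and all cells where
  lengths or masses are untypical by a factor exponential in the level, decays geometrically; this
  only needs a small negative moment of w and R, which is what the condition on small values of w
  gives.  What remains has positive mass, and every small set meets it in a single cell of
  comparable size.  Instead of constructing a mass distribution on T, one follows a path of words
  along which the mass exceeds the total mass of covering and discarded cells.
*)
theory Submission
  imports Defs
begin


text \<open>Cells of one level may touch, so they have no uniform separation; only points away from
  both ends of their cell can be separated from the other cells. Discarding the end subcells costs
  mass: the subcell 2^k carries an expected share (E w(2)^\<alpha>)^k, which is summable in k
  because E w(2)^\<alpha> < 1. The cells themselves sit at depth L * k. Everything untypical is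
  tolerated up to a factor d^k, where d depends on negative moments only and not on L. Given s <
  \<alpha>, L is chosen last, so large that the decay of l over L letters beats all accumulated
  deviations: (\<eta>^L)^(\<alpha> - s) \<le> d^(2 \<alpha> + 1). All expectations are computed on
  the product space whose points assign to each word the triple of the weights of its children.
  There passing to the subtree at a word preserves the measure, and the root triple is independent
  of the three subtrees, so sums over a level factorise. Both martingales converge because the
  second moments of their increments decay geometrically.\<close>

declare in_lists_conv_set [simp del] in_listsD [rule del] in_listsI [rule del]

section \<open>Words of a given length and sums over them\<close>

lemma finite_letters [simp]: "finite letters"
  by (simp add: letters_def)

lemma letters_subset: "{1, 2} \<subseteq> letters"
  by (simp add: letters_def)

lemma words_0 [simp]: "words A 0 = {[]}"
  by (auto simp: words_def)

lemma words_Suc: "words A (Suc n) = (\<lambda>(j, i). j # i) ` (A \<times> words A n)"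
  by (auto simp: words_def image_iff length_Suc_conv in_lists_conv_set)

lemma finite_words [simp]: "finite A \<Longrightarrow> finite (words A n)"
  by (induction n) (auto simp: words_Suc)

lemma sum_words_Suc:
  "(\<Sum>i\<in>words A (Suc n). f i) = (\<Sum>j\<in>A. \<Sum>i\<in>words A n. f (j # i))"
proof -
  have "(\<Sum>i\<in>words A (Suc n). f i) = (\<Sum>(j, i)\<in>A \<times> words A n. f (j # i))"
    unfolding words_Suc by (subst sum.reindex) (auto simp: inj_on_def case_prod_beta)
  then show ?thesis by (simp add: sum.cartesian_product)
qed

lemma sum_words_add:
  "(\<Sum>i\<in>words A (m + n). f i) = (\<Sum>i\<in>words A m. \<Sum>u\<in>words A n. f (i @ u))"
  by (induction m arbitrary: f) (simp_all add: sum_words_Suc)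

lemma sum_words_1: "(\<Sum>i\<in>words A (Suc 0). f i) = (\<Sum>j\<in>A. f [j])"
  by (simp add: sum_words_Suc)

lemma sum_words_snoc:
  "(\<Sum>i\<in>words A (Suc n). f i) = (\<Sum>i\<in>words A n. \<Sum>j\<in>A. f (i @ [j]))"
  using sum_words_add[of f A n 1] by (simp add: sum_words_1)

lemma sum_letters: "(\<Sum>j\<in>letters. f j) = f 1 + f 2 + (f 3 :: 'a :: comm_monoid_add)"
  by (simp add: letters_def add.assoc)

lemma wordsD: "i \<in> words A n \<Longrightarrow> length i = n" "i \<in> words A n \<Longrightarrow> i \<in> lists A"
  by (auto simp: words_def)

lemma words_append: "i \<in> words A m \<Longrightarrow> u \<in> words A n \<Longrightarrow> i @ u \<in> words A (m + n)"
  by (auto simp: words_def)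

lemma lists_words: "i \<in> lists A \<longleftrightarrow> i \<in> words A (length i)"
  by (auto simp: words_def)

lemma mono_words: "A \<subseteq> B \<Longrightarrow> words A n \<subseteq> words B n"
  using lists_mono[of A B] by (auto simp: words_def)


section \<open>Geometry of the fractal\<close>

locale fractal_scale =
  fixes c :: real
  assumes c_pos: "0 < c" and c_less: "c < 1 / 2"
begin

text \<open>The first two maps are similarities of ratio 1/2 and the third one of ratio
  \<open>c\<close>, which is less than 1/2.\<close>

lemma dist_psi: "j \<in> letters \<Longrightarrow> dist (psi c j p) (psi c j q) \<le> dist p q / 2"
proof -
  assume "j \<in> letters"
  obtain x y x' y' where pq: "p = (x, y)" "q = (x', y')" by (metis surj_pair)
  have "c\<^sup>2 \<le> (1/2)\<^sup>2"
    using c_pos c_less by (intro power_mono) auto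
  then have c2: "c\<^sup>2 * s \<le> s / 4" if "0 \<le> s" for s
    using mult_right_mono[OF _ that, of "c\<^sup>2" "1/4"] by (simp add: power2_eq_square)
  have "(dist (psi c j p) (psi c j q))\<^sup>2 \<le> ((x - x')\<^sup>2 + (y - y')\<^sup>2) / 4"
  proof -
    have e: "((1 - x) / 2 - (1 - x') / 2)\<^sup>2 = (x - x')\<^sup>2 / 4" "((1 + x) / 2 - (1 + x') / 2)\<^sup>2 = (x - x')\<^sup>2 / 4"
      "(y / 2 - y' / 2)\<^sup>2 = (y - y')\<^sup>2 / 4" "(y' / 2 - y / 2)\<^sup>2 = (y - y')\<^sup>2 / 4"
      "(c * y - c * y')\<^sup>2 = c\<^sup>2 * (y - y')\<^sup>2" "(x / 2 - x' / 2)\<^sup>2 = (x - x')\<^sup>2 / 4" "(c * x - c * x')\<^sup>2 = c\<^sup>2 * (x - x')\<^sup>2"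
      by (simp_all add: power2_eq_square field_simps)
    from \<open>j \<in> letters\<close> consider "j = 1" | "j = 2" | "j = 3" by (auto simp: letters_def)
    then show ?thesis
      using c2[of "(x - x')\<^sup>2 + (y - y')\<^sup>2"]
      by cases (simp_all add: pq psi_def dist_Pair_Pair dist_real_def e distrib_left add_divide_distrib del: minus_divide_left)
  qed
  also have "\<dots> = (dist p q / 2)\<^sup>2"
    by (simp add: pq dist_Pair_Pair dist_real_def power_divide)
  finally show ?thesis
    by (rule power2_le_imp_le) simp
qed

lemma continuous_psi: "j \<in> letters \<Longrightarrow> continuous_on S (psi c j)"
  by (rule lipschitz_on_continuous_on[of "1/2"], rule lipschitz_onI)
     (use dist_psi in \<open>auto simp: mult.commute\<close>)

lemma dist_psi_word:
  "i \<in> lists letters \<Longrightarrow> dist (psi_word c i p) (psi_word c i q) \<le> dist p q / 2 ^ length i"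
proof (induction i rule: list.induct)
  case (Cons j i)
  then have "dist (psi_word c (j # i) p) (psi_word c (j # i) q)
      \<le> dist (psi_word c i p) (psi_word c i q) / 2"
    using dist_psi by simp
  also have "\<dots> \<le> dist p q / 2 ^ length i / 2"
    using Cons by (intro divide_right_mono) auto
  finally show ?case by simp
qed simp

lemma continuous_psi_word: "i \<in> lists letters \<Longrightarrow> continuous_on S (psi_word c i)"
proof (induction i arbitrary: S rule: list.induct)
  case (Cons j i)
  then show ?case
    using continuous_psi continuous_on_compose[of S "psi_word c i" "psi c j"] by simp
qed (simp add: id_def)

lemma psi_word_append: "psi_word c (i @ u) = psi_word c i \<circ> psi_word c u"
  by (induction i) (auto simp: o_assoc)

text \<open>Its corners are (0, 0), (1, 0), (1/2, \<open>c\<close>) and (1/2, \<open>- c\<close>).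
  All three maps send this compact set into itself, so it confines the vertices and the
  fractal.\<close>

definition rhombus :: "(real \<times> real) set" where
  "rhombus = {(x, y). 0 \<le> x \<and> x \<le> 1 \<and> \<bar>y\<bar> \<le> 2 * c * x \<and> \<bar>y\<bar> \<le> 2 * c * (1 - x)}"

lemma rhombusD:
  assumes "(x, y) \<in> rhombus"
  shows "0 \<le> x" "x \<le> 1" "\<bar>y\<bar> \<le> 2 * c * x" "\<bar>y\<bar> \<le> 2 * c * (1 - x)" "2 * c * \<bar>y\<bar> \<le> 1 - x" "\<bar>y\<bar> \<le> c"
proof -
  show *: "0 \<le> x" "x \<le> 1" "\<bar>y\<bar> \<le> 2 * c * x" "\<bar>y\<bar> \<le> 2 * c * (1 - x)"
    using assms by (auto simp: rhombus_def)
  show "\<bar>y\<bar> \<le> c" using *(3,4) by (simp add: algebra_simps)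
  have "2 * c * \<bar>y\<bar> \<le> 2 * c * (2 * c * (1 - x))"
    using * c_pos by (intro mult_left_mono) auto
  also have "\<dots> \<le> 1 * (1 * (1 - x))"
    using * c_pos c_less by (intro mult_mono) auto
  finally show "2 * c * \<bar>y\<bar> \<le> 1 - x" by simp
qed

lemma rhombus_O [simp]: "(0, 0) \<in> rhombus" "(1, 0) \<in> rhombus"
  using c_pos by (auto simp: rhombus_def)

lemma compact_rhombus: "compact rhombus"
proof (rule compact_eq_bounded_closed[THEN iffD2], intro conjI)
  have "rhombus \<subseteq> {0..1} \<times> {- c..c}"
  proof
    fix p assume "p \<in> rhombus"
    moreover obtain x y where "p = (x, y)" by (metis surj_pair)
    ultimately show "p \<in> {0..1} \<times> {- c..c}" using rhombusD[of x y] by auto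
  qed
  then show "bounded rhombus"
    by (rule bounded_subset[rotated]) (intro bounded_Times bounded_closed_interval)
  have "rhombus = {p. 0 \<le> fst p} \<inter> {p. fst p \<le> 1} \<inter> {p. \<bar>snd p\<bar> \<le> 2 * c * fst p}
      \<inter> {p. \<bar>snd p\<bar> \<le> 2 * c * (1 - fst p)}"
    by (auto simp: rhombus_def)
  then show "closed rhombus"
    by (auto intro!: closed_Int closed_Collect_le continuous_intros)
qed

lemma psi_rhombus: "j \<in> letters \<Longrightarrow> p \<in> rhombus \<Longrightarrow> psi c j p \<in> rhombus"
proof -
  assume j: "j \<in> letters" and p: "p \<in> rhombus"
  obtain x y where [simp]: "p = (x, y)" by (metis surj_pair)
  note * = rhombusD[OF p[simplified]]
  have cx: "0 \<le> c * x" "c * x \<le> c" using * c_pos mult_left_mono[of x 1 c] by auto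
  have cy: "\<bar>c * y\<bar> \<le> 1/4"
    using *(6) c_pos c_less mult_mono[of c "1/2" "\<bar>y\<bar>" "1/2"] by (simp add: abs_mult)
  have y: "2 * \<bar>c * y\<bar> \<le> 1 - x" using *(5) c_pos by (simp add: abs_mult)
  \<comment> \<open>Divided by \<open>c\<close> this is the inequality
    \<open>2 * c * \<bar>y\<bar> \<le> 1 - x\<close> of \<open>rhombusD\<close>; it makes the image
    under the third map fit into the rhombus.\<close>
  have "c * x \<le> c * (1 - 2 * \<bar>c * y\<bar>)"
    using y c_pos by (intro mult_left_mono) auto
  then have "\<bar>c * x\<bar> \<le> 2 * c * (1/2 + c * y)" "\<bar>c * x\<bar> \<le> 2 * c * (1 - (1/2 + c * y))"
  proof -
    have a: "c * (- \<bar>c * y\<bar>) \<le> c * (c * y)" "c * (- \<bar>c * y\<bar>) \<le> c * (- (c * y))"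
      using c_pos by (intro mult_left_mono; auto)+
    assume "c * x \<le> c * (1 - 2 * \<bar>c * y\<bar>)"
    with a cx show "\<bar>c * x\<bar> \<le> 2 * c * (1/2 + c * y)" "\<bar>c * x\<bar> \<le> 2 * c * (1 - (1/2 + c * y))"
      by (simp_all add: algebra_simps)
  qed
  moreover have "psi c 1 p \<in> rhombus"
  proof -
    have "c * (1 - x) \<le> 2 * c * (1 - (1 - x) / 2)" using cx by (simp add: field_simps)
    moreover have "\<bar>y / 2\<bar> \<le> c * x" "\<bar>y / 2\<bar> \<le> c * (1 - x)" using * by simp_all
    ultimately show ?thesis using * by (auto simp: psi_def rhombus_def field_simps)
  qed
  moreover have "psi c 2 p \<in> rhombus"
  proof -
    have "c * (1 - x) \<le> 2 * c * ((1 + x) / 2)" using cx by (simp add: field_simps)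
    moreover have "\<bar>y / 2\<bar> \<le> c * x" "\<bar>y / 2\<bar> \<le> c * (1 - x)" using * by simp_all
    ultimately show ?thesis using * by (auto simp: psi_def rhombus_def field_simps)
  qed
  moreover have "psi c 3 p \<in> rhombus"
    if "\<bar>c * x\<bar> \<le> 2 * c * (1/2 + c * y)" "\<bar>c * x\<bar> \<le> 2 * c * (1 - (1/2 + c * y))"
    using that cy by (auto simp: psi_def rhombus_def)
  ultimately show ?thesis
    using j by (auto simp: letters_def)
qed

lemma psi_word_rhombus: "i \<in> lists letters \<Longrightarrow> p \<in> rhombus \<Longrightarrow> psi_word c i p \<in> rhombus"
  by (induction i) (auto simp: psi_rhombus)

lemma psi_ends [simp]:
  "psi c 1 (0, 0) = (1 / 2, 0)" "psi c 2 (0, 0) = (1 / 2, 0)" "psi c 3 (0, 0) = (1 / 2, 0)"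
  "psi c (Suc 0) (0, 0) = (1 / 2, 0)" "psi c (Suc 0) (1, 0) = (0, 0)"
  "psi c 1 (1, 0) = (0, 0)" "psi c 2 (1, 0) = (1, 0)" "psi c 3 (1, 0) = (1 / 2, c)"
  by (simp_all add: psi_def)

lemma psi_O: "j \<in> letters \<Longrightarrow> psi c j (0, 0) = (1 / 2, 0)"
  by (auto simp: letters_def)

lemma inj_psi: "j \<in> letters \<Longrightarrow> psi c j p = psi c j q \<Longrightarrow> p = q"
  using c_pos by (cases p; cases q) (auto simp: letters_def psi_def)

lemma psi_1_region: "p \<in> rhombus \<Longrightarrow> fst (psi c 1 p) \<le> 1/2 \<and> \<bar>snd (psi c 1 p)\<bar> \<le> 2 * c * \<bar>fst (psi c 1 p) - 1/2\<bar>"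
  by (auto simp: psi_def rhombus_def case_prod_beta diff_divide_distrib)

lemma psi_2_region: "p \<in> rhombus \<Longrightarrow> 1/2 \<le> fst (psi c 2 p) \<and> \<bar>snd (psi c 2 p)\<bar> \<le> 2 * c * \<bar>fst (psi c 2 p) - 1/2\<bar>"
  by (auto simp: psi_def rhombus_def case_prod_beta add_divide_distrib)

text \<open>The third image lies in the upward cone at (1/2, 0). The bounds 1/4 and 3/4 keep it away
  from (0, 0) and (1, 0), as \<open>end_in_cell\<close> needs.\<close>

lemma psi_3_region: "p \<in> rhombus \<Longrightarrow> \<bar>fst (psi c 3 p) - 1/2\<bar> \<le> 2 * c * snd (psi c 3 p) \<and> 1/4 < fst (psi c 3 p)
   \<and> fst (psi c 3 p) < 3/4"
proof -
  assume p: "p \<in> rhombus"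
  obtain x y where [simp]: "p = (x, y)" by (metis surj_pair)
  note * = rhombusD[OF p[simplified]]
  have "c * \<bar>y\<bar> \<le> c * (2 * c * x)" using * c_pos by (intro mult_left_mono) auto
  moreover have "c * \<bar>y\<bar> \<le> c * c" using * c_pos by (intro mult_left_mono) auto
  moreover have "c * c < 1/2 * (1/2)" using c_pos c_less by (intro mult_strict_mono) auto
  ultimately have "\<bar>c * y\<bar> \<le> c * (2 * c * x)" "\<bar>c * y\<bar> < 1/4" using c_pos unfolding abs_mult by linarith+
  then show ?thesis
    by (auto simp: psi_def algebra_simps)
qed

text \<open>The images of the rhombus under the three maps lie in cones with common apex and
  disjoint interiors: this is where \<open>c < 1 / 2\<close> is used.\<close>

lemma psi_inter:
  assumes "j \<in> letters" "k \<in> letters" "j \<noteq> k" "p \<in> rhombus" "q \<in> rhombus" "psi c j p = psi c k q"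
  shows "psi c j p = (1 / 2, 0)"
proof -
  have cone12: "z = (1/2, 0)" if "fst z \<le> 1/2" "1/2 \<le> fst z" "\<bar>snd z\<bar> \<le> 2 * c * \<bar>fst z - 1/2\<bar>" for z :: "real \<times> real"
  proof -
    have "fst z = 1/2" using that by linarith
    then have "\<bar>snd z\<bar> \<le> 2 * c * 0" using that(3) unfolding \<open>fst z = 1/2\<close> by simp
    then have "snd z = 0" by simp
    with \<open>fst z = 1/2\<close> show ?thesis by (metis prod.collapse)
  qed
  have cone3: "z = (1/2, 0)" if z: "\<bar>snd z\<bar> \<le> 2 * c * \<bar>fst z - 1/2\<bar>" "\<bar>fst z - 1/2\<bar> \<le> 2 * c * snd z" for z :: "real \<times> real"
  proof -
    define s t where "s = snd z" and "t = \<bar>fst z - 1/2\<bar>"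
    have st: "\<bar>s\<bar> \<le> 2 * c * t" "t \<le> 2 * c * s" "0 \<le> t" using z by (auto simp: s_def t_def)
    have "0 \<le> 2 * c * s" using st by linarith
    then have "0 \<le> s" using c_pos by (simp add: zero_le_mult_iff)
    have "2 * c * t \<le> 2 * c * (2 * c * s)" using st c_pos by (intro mult_left_mono) auto
    then have "s * (1 - 2 * c * (2 * c)) \<le> 0" using st \<open>0 \<le> s\<close> by (simp add: algebra_simps)
    moreover have "2 * c * (2 * c) < 1 * 1" using c_pos c_less by (intro mult_strict_mono) auto
    ultimately have "s \<le> 0" by (simp add: mult_le_0_iff)
    with \<open>0 \<le> s\<close> have "s = 0" by simp
    with st have "t = 0" by simp
    with \<open>s = 0\<close> show ?thesis by (cases z) (auto simp: s_def t_def)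
  qed
  note r = psi_1_region psi_2_region psi_3_region
  from assms(1-3) consider "j = 1 \<and> k = 2" | "j = 2 \<and> k = 1" | "j = 3 \<and> k \<in> {1,2}" | "j \<in> {1,2} \<and> k = 3"
    by (auto simp: letters_def)
  then show ?thesis
  proof cases
    case 1
    then have e: "psi c 1 p = psi c j p" "psi c 2 q = psi c j p" using assms(6) by auto
    show ?thesis using r(1)[OF assms(4)] r(2)[OF assms(5)] unfolding e by (intro cone12) blast+
  next
    case 2
    then have e: "psi c 2 p = psi c j p" "psi c 1 q = psi c j p" using assms(6) by auto
    show ?thesis using r(2)[OF assms(4)] r(1)[OF assms(5)] unfolding e by (intro cone12) blast+
  next
    case 3
    then have "psi c 1 q = psi c j p \<or> psi c 2 q = psi c j p" "psi c 3 p = psi c j p"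
      using assms(6) by auto
    then show ?thesis
      using r(3)[OF assms(4)] r(1)[OF assms(5)] r(2)[OF assms(5)] by (metis cone3)
  next
    case 4
    then have "psi c 1 p = psi c j p \<or> psi c 2 p = psi c j p" "psi c 3 q = psi c j p"
      using assms(6) by auto
    then show ?thesis
      using r(3)[OF assms(5)] r(1)[OF assms(4)] r(2)[OF assms(4)] by (metis cone3)
  qed
qed

definition ends :: "(real \<times> real) set" where
  "ends = {(0, 0), (1, 0)}"

lemma ends_rhombus: "ends \<subseteq> rhombus"
  by (auto simp: ends_def)

text \<open>The point (0, 0) is reached only by the first map and (1, 0) only by the second one,
  each from (1, 0), and the third image avoids both. So preimages of ends are ends, letter by
  letter.\<close>

lemma end_in_cell:
  assumes "u \<in> lists letters" "p \<in> rhombus" "psi_word c u p \<in> ends"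
  shows "p \<in> ends"
  using assms
proof (induction u rule: list.induct)
  case (Cons j u)
  define q where "q = psi_word c u p"
  have q: "q \<in> rhombus" using Cons psi_word_rhombus by (auto simp: q_def)
  have "psi c j q \<in> ends" using Cons by (simp add: q_def)
  have "q = (1, 0)"
  proof -
    have "j \<in> letters" using Cons.prems by simp
    then consider "j = 1" | "j = 2" | "j = 3" by (auto simp: letters_def)
    then show ?thesis
    proof cases
      case 1
      then have "psi c 1 q = psi c 1 (1, 0)"
        using \<open>psi c j q \<in> ends\<close> psi_1_region[OF q] unfolding ends_def by auto
      then show ?thesis by (rule inj_psi[rotated]) (simp add: letters_def)
    next
      case 2
      then have "psi c 2 q = psi c 2 (1, 0)"
        using \<open>psi c j q \<in> ends\<close> psi_2_region[OF q] unfolding ends_def by auto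
      then show ?thesis by (rule inj_psi[rotated]) (simp add: letters_def)
    next
      case 3
      then show ?thesis
        using \<open>psi c j q \<in> ends\<close> psi_3_region[OF q] unfolding ends_def by auto
    qed
  qed
  then have "q \<in> ends" by (simp add: ends_def)
  then show ?case using Cons by (simp add: q_def)
qed auto

text \<open>At the first letter where the words differ, both points are sent to the centre (1/2, 0).
  So the remaining words send them to (0, 0), and \<open>end_in_cell\<close> applies to
  each.\<close>

lemma cells_inter:
  assumes "i \<in> lists letters" "j \<in> lists letters" "length i = length j" "i \<noteq> j"
    "p \<in> rhombus" "q \<in> rhombus" "psi_word c i p = psi_word c j q"
  shows "p \<in> ends \<and> q \<in> ends"
  using assms
proof (induction i arbitrary: j rule: list.induct)
  case (Cons a i)
  then obtain b u where j: "j = b # u" by (cases j) auto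
  show ?case
  proof (cases "a = b")
    case True
    then have "psi_word c i p = psi_word c u q"
      using Cons.prems j True inj_psi[of a "psi_word c i p" "psi_word c u q"] by simp
    then show ?thesis using Cons.IH[of u] Cons.prems j True by auto
  next
    case False
    have ab: "a \<in> letters" "b \<in> letters" and eq: "psi c a (psi_word c i p) = psi c b (psi_word c u q)"
      using Cons.prems j by simp_all
    have A: "psi c a (psi_word c i p) = (1/2, 0)"
      using Cons.prems j by (intro psi_inter[OF ab False _ _ eq] psi_word_rhombus) auto
    with eq have B: "psi c b (psi_word c u q) = (1/2, 0)" by simp
    have "psi_word c i p = (0, 0)" "psi_word c u q = (0, 0)"
      using inj_psi[OF ab(1)] inj_psi[OF ab(2)] A B psi_O[OF ab(1)] psi_O[OF ab(2)] by metis+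
    then have "psi_word c i p \<in> ends" "psi_word c u q \<in> ends" by (simp_all add: ends_def)
    then show ?thesis using end_in_cell[of i p] end_in_cell[of u q] Cons.prems j by simp
  qed
qed auto

section \<open>The vertices, and the fractal as their closure\<close>

lemma vertices_0 [simp]: "vertices c 0 = ends"
  by (auto simp: vertices_def ends_def)

lemma vertices_Suc: "vertices c (Suc n) = (\<Union>j\<in>letters. psi c j ` vertices c n)"
  by (fastforce simp: vertices_def words_Suc)

lemma vertices_eq: "vertices c n = (\<Union>i\<in>words letters n. psi_word c i ` ends)"
  by (simp add: vertices_def ends_def)

lemma psi_word_vertices:
  "i \<in> lists letters \<Longrightarrow> p \<in> vertices c n \<Longrightarrow> psi_word c i p \<in> vertices c (length i + n)"
proof (induction i rule: list.induct)
  case (Cons j i)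
  then show ?case by (auto simp: vertices_Suc)
qed auto

text \<open>Both ends are images of (1, 0), under the first and the second map. This is the reason
  why the vertex sets increase.\<close>

lemma ends_vertices: "ends \<subseteq> vertices c n"
proof (induction n)
  case (Suc n)
  have "(1, 0) \<in> vertices c n" using Suc by (simp add: ends_def)
  then have "psi c 1 (1, 0) \<in> vertices c (Suc n)" "psi c 2 (1, 0) \<in> vertices c (Suc n)"
    unfolding vertices_Suc using letters_subset by blast+
  then show ?case by (simp add: ends_def)
qed simp

lemma vertices_mono_Suc: "vertices c n \<subseteq> vertices c (Suc n)"
proof (induction n)
  case 0 then show ?case using ends_vertices[of "Suc 0"] by simp
next
  case (Suc n)
  show ?case unfolding vertices_Suc[of "Suc n"] by (subst vertices_Suc) (intro UN_mono image_mono Suc order_refl)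
qed

lemma vertices_mono: "m \<le> n \<Longrightarrow> vertices c m \<subseteq> vertices c n"
  by (rule lift_Suc_mono_le[of "vertices c"]) (use vertices_mono_Suc in auto)

lemma vertices_rhombus: "vertices c n \<subseteq> rhombus"
  unfolding vertices_eq using psi_word_rhombus ends_rhombus wordsD(2) by blast

abbreviation "V \<equiv> all_vertices c"

lemma V_rhombus: "V \<subseteq> rhombus"
  using vertices_rhombus by (auto simp: all_vertices_def)

lemma ends_V: "ends \<subseteq> V" using ends_vertices by (auto simp: all_vertices_def)

lemma V_unfold: "V = (\<Union>j\<in>letters. psi c j ` V)"
proof -
  have "V = (\<Union>n. vertices c (Suc n))"
    using vertices_mono_Suc by (auto simp: all_vertices_def)
  also have "\<dots> = (\<Union>j\<in>letters. psi c j ` V)"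
    by (auto simp: vertices_Suc all_vertices_def)
  finally show ?thesis .
qed

lemma psi_word_V: "i \<in> lists letters \<Longrightarrow> x \<in> V \<Longrightarrow> psi_word c i x \<in> V"
  unfolding all_vertices_def using psi_word_vertices by blast

lemma bounded_V: "bounded V"
  using V_rhombus compact_rhombus bounded_subset compact_imp_bounded by blast

lemma compact_cl_V: "compact (closure V)"
  using bounded_V by simp

lemma cl_V_rhombus: "closure V \<subseteq> rhombus"
  using V_rhombus compact_rhombus by (simp add: closure_minimal compact_imp_closed)

lemma closure_psi_word:
  assumes "i \<in> lists letters" shows "closure (psi_word c i ` V) = psi_word c i ` closure V"
proof (rule closure_unique)
  show "psi_word c i ` V \<subseteq> psi_word c i ` closure V" using closure_subset by blast
  show "closed (psi_word c i ` closure V)"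
    using continuous_psi_word[OF assms] compact_cl_V by (simp add: compact_continuous_image compact_imp_closed)
  show "psi_word c i ` closure V \<subseteq> T'" if "psi_word c i ` V \<subseteq> T'" "closed T'" for T'
    using continuous_psi_word[OF assms] that by (intro image_closure_subset) auto
qed

lemma closure_V_unfold: "closure V = (\<Union>j\<in>letters. psi c j ` closure V)"
proof -
  have "closure (\<Union>j\<in>letters. psi c j ` V) = (\<Union>j\<in>letters. closure (psi c j ` V))"
    by (simp add: letters_def closure_Un)
  also have "\<dots> = (\<Union>j\<in>letters. psi c j ` closure V)"
    using closure_psi_word[of "[_]"] by (intro SUP_cong) auto
  finally show ?thesis using V_unfold by simp
qed

lemma invariant_words:
  assumes "K = (\<Union>j\<in>letters. psi c j ` K)"
  shows "K = (\<Union>i\<in>words letters n. psi_word c i ` K)"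
proof (induction n)
  case (Suc n)
  have "(\<Union>i\<in>words letters (Suc n). psi_word c i ` K)
      = (\<Union>j\<in>letters. psi c j ` (\<Union>i\<in>words letters n. psi_word c i ` K))"
    by (fastforce simp: words_Suc)
  then show ?case using Suc assms by simp
qed simp

text \<open>A point of \<open>K\<close> is the image of some y in \<open>K\<close> under a word of
  length n. The image of a fixed z in \<open>L\<close> under the same word lies in \<open>L\<close>,
  at distance at most \<open>B / 2 ^ n\<close>. Used in both directions, this gives the uniqueness
  on which the definition of \<open>fractal\<close> rests.\<close>

lemma invariant_subset:
  assumes K: "K = (\<Union>j\<in>letters. psi c j ` K)" "bounded K"
    and L: "L = (\<Union>j\<in>letters. psi c j ` L)" "closed L" "L \<noteq> {}"
  shows "K \<subseteq> L"
proof
  fix x assume "x \<in> K"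
  obtain z where z: "z \<in> L" using L by auto
  obtain B where B: "\<And>y. y \<in> K \<Longrightarrow> dist z y \<le> B" using K(2) unfolding bounded_any_center[where a = z] by auto
  have B0: "0 \<le> B" using B[OF \<open>x \<in> K\<close>] zero_le_dist order_trans by blast
  have "\<exists>y\<in>L. dist y x < e" if "0 < e" for e
  proof -
    have "(\<lambda>n. B / 2 ^ n) \<longlonglongrightarrow> 0" using LIMSEQ_divide_realpow_zero[of 2 B] by simp
    then obtain n where n: "B / 2 ^ n < e"
      using order_tendstoD(2)[of "\<lambda>n. B / 2 ^ n" 0 sequentially e] \<open>0 < e\<close> unfolding eventually_sequentially by blast
    obtain i y where i: "i \<in> words letters n" "y \<in> K" "x = psi_word c i y"
      using invariant_words[OF K(1), of n] \<open>x \<in> K\<close> by blast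
    have "psi_word c i z \<in> L" using invariant_words[OF L(1), of n] i z by blast
    moreover have "dist (psi_word c i z) x \<le> dist z y / 2 ^ n"
      using dist_psi_word[of i z y] i wordsD by auto
    moreover have "dist z y / 2 ^ n \<le> B / 2 ^ n" using B i by (simp add: divide_right_mono)
    ultimately show ?thesis using n by force
  qed
  then have "x \<in> closure L" by (simp add: closure_approachable)
  then show "x \<in> L" using L by simp
qed

lemma fractal_eq: "fractal c = closure V"
  unfolding fractal_def
proof (rule the_equality)
  show "closure V \<noteq> {} \<and> compact (closure V) \<and> closure V = (\<Union>j\<in>letters. psi c j ` closure V)"
    using compact_cl_V closure_V_unfold ends_V closure_subset by (auto simp: ends_def)
  then show "K = closure V" if "K \<noteq> {} \<and> compact K \<and> K = (\<Union>j\<in>letters. psi c j ` K)" for K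
    using invariant_subset[of K "closure V"] invariant_subset[of "closure V" K] that
    by (meson compact_imp_bounded compact_imp_closed subset_antisym)
qed

abbreviation "T \<equiv> fractal c"

lemma T_rhombus: "T \<subseteq> rhombus" using fractal_eq cl_V_rhombus by simp

lemma compact_T: "compact T" using fractal_eq compact_cl_V by simp

lemma T_nonempty: "T \<noteq> {}" using fractal_eq ends_V by (auto simp: ends_def)

section \<open>Cells of the fractal\<close>

definition cell :: "nat list \<Rightarrow> (real \<times> real) set" where
  "cell i = psi_word c i ` T"

lemma T_cells: "T = (\<Union>i\<in>words letters n. cell i)"
  unfolding cell_def by (rule invariant_words) (simp add: fractal_eq closure_V_unfold[symmetric])

lemma cell_subset: "i \<in> lists letters \<Longrightarrow> cell i \<subseteq> T"
  using T_cells[of "length i"] lists_words by auto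

lemma cell_Nil [simp]: "cell [] = T" by (simp add: cell_def)

lemma cell_append: "u \<in> lists letters \<Longrightarrow> cell (i @ u) \<subseteq> cell i"
  using cell_subset by (auto simp: cell_def psi_word_append)

lemma compact_cell: "i \<in> lists letters \<Longrightarrow> compact (cell i)"
  unfolding cell_def by (intro compact_continuous_image continuous_psi_word compact_T)

lemma cell_nonempty: "cell i \<noteq> {}" using T_nonempty by (simp add: cell_def)

lemma cell_closure: "i \<in> lists letters \<Longrightarrow> cell i = closure (psi_word c i ` V)"
  by (simp add: cell_def fractal_eq closure_psi_word)

lemma cell_seq:
  assumes "i \<in> lists letters" "x \<in> cell i"
  obtains xs where "\<And>n::nat. xs n \<in> psi_word c i ` V" "xs \<longlonglongrightarrow> x"
  using assms cell_closure closure_sequential by metis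

text \<open>The cells along an infinite word are nested, compact and non-empty, so they have a
  common point.\<close>

lemma path_point:
  assumes "\<And>n. f n \<in> letters"
  obtains x where "\<And>n. x \<in> cell (map f [0..<n])"
proof -
  let ?i = "\<lambda>n. map f [0..<n]"
  have l: "?i n \<in> lists letters" for n using assms by (induction n) auto
  have mono: "cell (?i n) \<subseteq> cell (?i m)" if "m \<le> n" for m n
  proof -
    have "[0..<n] = [0..<m] @ [m..<n]" using that upt_add_eq_append[of 0 m "n - m"] by simp
    then have "?i n = ?i m @ map f [m..<n]" by simp
    moreover have "map f [m..<n] \<in> lists letters" using assms by (auto simp: in_lists_conv_set)
    ultimately show ?thesis using cell_append by simp
  qed
  have "(\<Inter>n. cell (?i n)) \<noteq> {}"
    using l compact_cell cell_nonempty mono by (intro compact_nest) auto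
  then show ?thesis using that by auto
qed

section \<open>Retractions onto cells\<close>

text \<open>On the fractal, \<open>psi c k \<circ> ret k\<close> retracts onto the cell \<open>k\<close>: the rest is sent to the centre.\<close>

definition ret :: "nat \<Rightarrow> real \<times> real \<Rightarrow> real \<times> real" where
  "ret k z = (if z \<in> psi c k ` rhombus then inv_into rhombus (psi c k) z else (0, 0))"

primrec ret_word :: "nat list \<Rightarrow> real \<times> real \<Rightarrow> real \<times> real" where
  "ret_word [] = id"
| "ret_word (k # i) = ret_word i \<circ> ret k"

lemma ret_psi: "k \<in> letters \<Longrightarrow> z \<in> rhombus \<Longrightarrow> ret k (psi c k z) = z"
  using inj_psi[of k] by (auto simp: ret_def inj_on_def intro!: inv_into_f_f)

text \<open>By \<open>psi_inter\<close> such a point lies in the image of the rhombus under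
  \<open>psi c k\<close> only if it is the centre, which is \<open>psi c k (0, 0)\<close>; so both
  cases of \<open>ret\<close> return (0, 0).\<close>

lemma ret_psi_other:
  assumes "k \<in> letters" "j \<in> letters" "j \<noteq> k" "z \<in> rhombus"
  shows "ret k (psi c j z) = (0, 0)"
proof (cases "psi c j z \<in> psi c k ` rhombus")
  case True
  then have "psi c j z = psi c k (0, 0)"
    using assms psi_inter[of j k z] by (auto simp: psi_O)
  then show ?thesis using ret_psi[of k "(0, 0)"] assms by simp
qed (simp add: ret_def)

lemma ret_O:
  "ret 1 (0, 0) = (1, 0)" "ret 1 (1, 0) = (0, 0)" "ret 2 (0, 0) = (0, 0)" "ret 2 (1, 0) = (1, 0)"
  "ret 3 (0, 0) = (0, 0)" "ret 3 (1, 0) = (0, 0)"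
  using ret_psi[of 1 "(1, 0)"] ret_psi[of 2 "(1, 0)"] ret_psi_other[of 1 2 "(1, 0)"]
    ret_psi_other[of 3 2 "(1, 0)"] ret_psi_other[of 3 1 "(1, 0)"] ret_psi_other[of 2 1 "(1, 0)"]
  by (auto simp: letters_def)

lemma ret_word_append: "ret_word (i @ u) = ret_word u \<circ> ret_word i"
  by (induction i) (auto simp: o_assoc)

lemma ret_word_psi: "i \<in> lists letters \<Longrightarrow> z \<in> rhombus \<Longrightarrow> ret_word i (psi_word c i z) = z"
  by (induction i) (auto simp: ret_psi psi_word_rhombus)

lemma ret_word_ends: "i \<in> lists letters \<Longrightarrow> z \<in> ends \<Longrightarrow> ret_word i z \<in> ends"
proof (induction i arbitrary: z rule: list.induct)
  case (Cons k i)
  have "ret k z \<in> ends" using Cons.prems ret_O by (auto simp: letters_def ends_def)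
  then show ?case using Cons by simp
qed auto

lemma ret_vertices:
  assumes "k \<in> letters" "z \<in> vertices c (Suc n)" shows "ret k z \<in> vertices c n"
proof -
  obtain j y where "j \<in> letters" "y \<in> vertices c n" "z = psi c j y"
    using assms by (auto simp: vertices_Suc)
  moreover have "y \<in> rhombus" "(0, 0) \<in> vertices c n"
    using vertices_rhombus ends_vertices calculation by (auto simp: ends_def)
  ultimately show ?thesis
    using assms(1) ret_psi[of k y] ret_psi_other[of k j y] by (cases "j = k") simp_all
qed

lemma ret_word_vertices:
  "i \<in> words letters m \<Longrightarrow> z \<in> vertices c (m + n) \<Longrightarrow> ret_word i z \<in> vertices c n"
proof (induction m arbitrary: i z)
  case (Suc m)
  then obtain k u where "i = k # u" "k \<in> letters" "u \<in> words letters m" by (auto simp: words_Suc)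
  then show ?case using Suc.IH[of u "ret k z"] Suc.prems ret_vertices[of k z "m + n"] by simp
qed auto

text \<open>A whole cell \<open>i\<close> lies on one side of any other edge \<open>j\<close> of its
  level: from the first differing letter on everything is sent to (0, 0), and the remaining
  retractions keep it at an end.\<close>

lemma ret_word_other:
  assumes "i \<in> lists letters" "j \<in> lists letters" "length i = length j" "i \<noteq> j" "z \<in> rhombus"
  shows "ret_word j (psi_word c i z) = ret_word j (psi_word c i (0, 0)) \<and>
    ret_word j (psi_word c i z) \<in> ends"
  using assms
proof (induction i arbitrary: j rule: list.induct)
  case (Cons a i)
  then obtain b u where j: "j = b # u" by (cases j) auto
  show ?case
  proof (cases "a = b")
    case True
    then show ?thesis using Cons.IH[of u] Cons.prems j by (auto simp: ret_psi psi_word_rhombus)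
  next
    case False
    then show ?thesis using Cons.prems j ret_word_ends[of u]
      by (auto simp: ret_psi_other psi_word_rhombus ends_def)
  qed
qed auto

text \<open>The side of the edge \<open>i\<close> on which a vertex of level \<open>length i\<close> lies.\<close>

definition far :: "nat list \<Rightarrow> real \<times> real \<Rightarrow> real" where
  "far i z = of_bool (ret_word i z = (1, 0))"

lemma far_Cons: "far (k # i) z = far i (ret k z)"
  by (simp add: far_def)

lemma far_append: "far (i @ u) z = far u (ret_word i z)"
  by (simp add: far_def ret_word_append)

lemma far_Nil: "far [] (0, 0) = 0" "far [] (1, 0) = 1"
  by (auto simp: far_def)

text \<open>This is how the tree structure enters: the difference telescopes along the edges that
  separate x from y. All first-level cells share the centre (1/2, 0), so in the induction both
  points are compared with the centre, and only the branch containing the point contributes. Vector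
  values allow f to be the identity of the plane, as in \<open>res_pos\<close>.\<close>

lemma tree_identity:
  "x \<in> vertices c n \<Longrightarrow> y \<in> vertices c n \<Longrightarrow>
   f x - f y = (\<Sum>i\<in>words letters n. (far i x - far i y) *\<^sub>R (f (psi_word c i (1, 0)) - f (psi_word c i (0, 0))))"
  for f :: "real \<times> real \<Rightarrow> 'b :: real_vector"
proof (induction n arbitrary: x y f)
  case 0
  then show ?case by (auto simp: ends_def far_Nil)
next
  case (Suc n)
  let ?D = "\<lambda>f i. f (psi_word c i (1, 0)) - f (psi_word c i (0, 0)) :: 'b"
  let ?S = "\<lambda>x y. (\<Sum>i\<in>words letters (Suc n). (far i x - far i y) *\<^sub>R ?D f i)"
  have O: "(0, 0) \<in> vertices c n" using ends_vertices by (auto simp: ends_def)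
  have retc: "ret k (1/2, 0) = (0, 0)" if "k \<in> letters" for k
    using ret_psi[OF that, of "(0, 0)"] by (simp add: psi_O that)
  have main: "f z - f (1/2, 0) = ?S z (1/2, 0)" if z: "z \<in> vertices c (Suc n)" for z
  proof -
    obtain j y where j: "j \<in> letters" "y \<in> vertices c n" "z = psi c j y"
      using z by (auto simp: vertices_Suc)
    have y: "y \<in> rhombus" using j vertices_rhombus by auto
    have "?S z (1/2, 0) = (\<Sum>k\<in>letters. \<Sum>i\<in>words letters n. (far i (ret k z) - far i (0, 0)) *\<^sub>R ?D (f \<circ> psi c k) i)"
      unfolding sum_words_Suc by (intro sum.cong) (auto simp: far_Cons retc)
    also have "\<dots> = (\<Sum>k\<in>letters. (f \<circ> psi c k) (ret k z) - (f \<circ> psi c k) (0, 0))"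
      using ret_vertices[OF _ z] O by (intro sum.cong refl Suc.IH[symmetric]) auto
    also have "\<dots> = (\<Sum>k\<in>letters. if k = j then f z - f (1/2, 0) else 0)"
      using j y by (intro sum.cong) (auto simp: ret_psi ret_psi_other psi_O)
    finally show ?thesis using j by simp
  qed
  have "f x - f y = (f x - f (1/2, 0)) - (f y - f (1/2, 0))" by simp
  also have "\<dots> = ?S x (1/2, 0) - ?S y (1/2, 0)" using main Suc.prems by simp
  also have "\<dots> = ?S x y"
    unfolding sum_subtractf[symmetric] scaleR_left_diff_distrib[symmetric] by simp
  finally show ?case .
qed

end


section \<open>The tree metric on the vertices\<close>

definition sub :: "(nat list \<Rightarrow> 'b) \<Rightarrow> nat list \<Rightarrow> nat list \<Rightarrow> 'b" where
  "sub a i = (\<lambda>u. a (i @ u))"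

definition edge_lengths :: "(nat list \<Rightarrow> real) \<Rightarrow> bool" where
  "edge_lengths a \<longleftrightarrow> (\<forall>i\<in>lists letters. 0 < a i \<and> a i = a (i @ [1]) + a (i @ [2]))"

lemma edge_lengths_sub: "edge_lengths a \<Longrightarrow> i \<in> lists letters \<Longrightarrow> edge_lengths (sub a i)"
  unfolding edge_lengths_def sub_def append_assoc[symmetric] by (meson append_in_lists_conv)

lemma edge_lengths_nonneg: "edge_lengths a \<Longrightarrow> i \<in> words letters n \<Longrightarrow> 0 \<le> a i"
  by (force simp: edge_lengths_def words_def)

lemma edge_lengths_pos: "edge_lengths a \<Longrightarrow> i \<in> words letters n \<Longrightarrow> 0 < a i"
  by (auto simp: edge_lengths_def words_def)

context fractal_scale
begin

definition tree_dist_n :: "(nat list \<Rightarrow> real) \<Rightarrow> nat \<Rightarrow> real \<times> real \<Rightarrow> real \<times> real \<Rightarrow> real" where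
  "tree_dist_n a n x y = (\<Sum>i\<in>words letters n. a i * \<bar>far i x - far i y\<bar>)"

text \<open>On vertices the sequence is eventually constant, by \<open>tree_dist_n_Suc\<close>; the
  limit only removes the dependence on a level.\<close>

definition tree_dist :: "(nat list \<Rightarrow> real) \<Rightarrow> real \<times> real \<Rightarrow> real \<times> real \<Rightarrow> real" where
  "tree_dist a x y = lim (\<lambda>n. tree_dist_n a n x y)"

text \<open>On the next level the edge \<open>i\<close> is replaced by \<open>i @ [1]\<close> and
  \<open>i @ [2]\<close> in series, which keeps its length; the edge \<open>i @ [3]\<close> hangs
  off the midpoint and separates no two vertices of level n.\<close>

lemma tree_dist_n_Suc:
  assumes a: "edge_lengths a" and x: "x \<in> vertices c n" and y: "y \<in> vertices c n"
  shows "tree_dist_n a (Suc n) x y = tree_dist_n a n x y"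
  unfolding tree_dist_n_def sum_words_snoc
proof (rule sum.cong[OF refl])
  fix i assume i: "i \<in> words letters n"
  have "a i = a (i @ [1]) + a (i @ [2])" using a i by (auto simp: edge_lengths_def words_def)
  moreover have "ret_word i x \<in> ends" "ret_word i y \<in> ends"
    using ret_word_vertices[OF i, of _ 0] x y by auto
  moreover have "far [1] (0, 0) = 1" "far [1] (1, 0) = 0" "far [2] (0, 0) = 0" "far [2] (1, 0) = 1"
    "far [3] (0, 0) = 0" "far [3] (1, 0) = 0"
    using ret_O by (auto simp: far_def)
  ultimately show "(\<Sum>j\<in>letters. a (i @ [j]) * \<bar>far (i @ [j]) x - far (i @ [j]) y\<bar>) = a i * \<bar>far i x - far i y\<bar>"
    unfolding sum_letters far_append far_append[of i "[]", simplified] ends_def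
    by (auto simp: far_Nil)
qed

lemma tree_dist_n_eq:
  assumes "edge_lengths a" "x \<in> vertices c n" "y \<in> vertices c n" "n \<le> m"
  shows "tree_dist_n a m x y = tree_dist_n a n x y"
  using assms(4)
proof (induction m rule: dec_induct)
  case (step m)
  then have "x \<in> vertices c m" "y \<in> vertices c m" using assms vertices_mono by blast+
  then show ?case using step tree_dist_n_Suc assms by simp
qed simp

lemma tree_dist_eq:
  assumes "edge_lengths a" "x \<in> vertices c n" "y \<in> vertices c n"
  shows "tree_dist a x y = tree_dist_n a n x y"
  unfolding tree_dist_def
  by (intro limI tendsto_eventually eventually_sequentiallyI[of n] tree_dist_n_eq[OF assms])

lemma V_level:
  assumes "finite S" "S \<subseteq> V" obtains n where "S \<subseteq> vertices c n"
proof -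
  have "\<exists>n. S \<subseteq> vertices c n"
    using assms
  proof (induction S)
    case (insert x S)
    then obtain m n where "x \<in> vertices c m" "S \<subseteq> vertices c n" by (auto simp: all_vertices_def)
    then have "insert x S \<subseteq> vertices c (max m n)"
      using vertices_mono[of m "max m n"] vertices_mono[of n "max m n"] by auto
    then show ?case by blast
  qed simp
  then show ?thesis using that by auto
qed

lemma V_level2:
  assumes "x \<in> V" "y \<in> V" obtains n where "x \<in> vertices c n" "y \<in> vertices c n"
  using V_level[of "{x, y}"] assms by auto

lemma tree_dist_refl: "tree_dist a x x = 0"
  by (auto simp: tree_dist_def tree_dist_n_def intro!: limI)

lemma tree_dist_sym: "tree_dist a x y = tree_dist a y x"
  by (simp add: tree_dist_def tree_dist_n_def abs_minus_commute)

lemma tree_dist_triangle: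
  assumes "edge_lengths a" "x \<in> V" "y \<in> V" "z \<in> V"
  shows "tree_dist a x z \<le> tree_dist a x y + tree_dist a y z"
proof -
  obtain n where n: "x \<in> vertices c n" "y \<in> vertices c n" "z \<in> vertices c n"
    using V_level[of "{x, y, z}"] assms by auto
  show ?thesis
    unfolding tree_dist_eq[OF assms(1) n(1,2)] tree_dist_eq[OF assms(1) n(1,3)] tree_dist_eq[OF assms(1) n(2,3)]
      tree_dist_n_def sum.distrib[symmetric] distrib_left[symmetric]
    using edge_lengths_nonneg[OF assms(1)] by (intro sum_mono mult_left_mono) auto
qed

lemma tree_dist_pos:
  assumes "edge_lengths a" "x \<in> V" "y \<in> V" "x \<noteq> y" shows "0 < tree_dist a x y"
proof -
  obtain n where n: "x \<in> vertices c n" "y \<in> vertices c n" using V_level2 assms by blast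
  have "\<exists>i\<in>words letters n. far i x \<noteq> far i y"
  proof (rule ccontr)
    assume "\<not> ?thesis"
    \<comment> \<open>If no edge separated x from y, the tree identity would force the indicator of
      x to agree at x and y.\<close>
    then show False
      using tree_identity[OF n, of "\<lambda>z. of_bool (z = x) :: real"] assms(4) by simp
  qed
  then obtain i where "i \<in> words letters n" "far i x \<noteq> far i y" by blast
  then show ?thesis
    unfolding tree_dist_eq[OF assms(1) n] tree_dist_n_def
    using edge_lengths_pos[OF assms(1)] edge_lengths_nonneg[OF assms(1)]
    by (intro sum_pos2[of _ i]) auto
qed

text \<open>Both points have the same image under the retraction of any other cell of the level, so
  only edges inside the cell \<open>i\<close> separate them.\<close>

lemma tree_dist_cell:
  assumes a: "edge_lengths a" and i: "i \<in> lists letters" and xy: "x \<in> V" "y \<in> V"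
  shows "tree_dist a (psi_word c i x) (psi_word c i y) = tree_dist (sub a i) x y"
proof -
  obtain n where n: "x \<in> vertices c n" "y \<in> vertices c n" using V_level2 xy by blast
  have rh: "x \<in> rhombus" "y \<in> rhombus" using xy V_rhombus by auto
  let ?x = "psi_word c i x" and ?y = "psi_word c i y"
  have "tree_dist a ?x ?y = tree_dist_n a (length i + n) ?x ?y"
    using psi_word_vertices[OF i] n by (intro tree_dist_eq a) auto
  also have "\<dots> = (\<Sum>j\<in>words letters (length i). if j = i then tree_dist_n (sub a i) n x y else 0)"
    unfolding tree_dist_n_def sum_words_add
  proof (rule sum.cong[OF refl])
    fix j assume "j \<in> words letters (length i)"
    then have j: "j \<in> lists letters" "length i = length j" by (auto simp: words_def)
    show "(\<Sum>u\<in>words letters n. a (j @ u) * \<bar>far (j @ u) ?x - far (j @ u) ?y\<bar>)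
      = (if j = i then \<Sum>u\<in>words letters n. sub a i u * \<bar>far u x - far u y\<bar> else 0)"
    proof (cases "j = i")
      case True then show ?thesis using i rh by (simp add: far_append ret_word_psi sub_def)
    next
      case False
      then have "ret_word j ?x = ret_word j ?y" using ret_word_other[OF i j(1,2)] rh by metis
      with False show ?thesis by (simp add: far_append)
    qed
  qed
  also have "\<dots> = tree_dist_n (sub a i) n x y" using i by (simp add: lists_words)
  also have "\<dots> = tree_dist (sub a i) x y" using tree_dist_eq[OF edge_lengths_sub[OF a i] n] by simp
  finally show ?thesis .
qed

text \<open>Among the edges separating x from y, the left-hand side counts only those inside the
  cell \<open>i\<close>.\<close>

lemma tree_dist_ret:
  assumes a: "edge_lengths a" and i: "i \<in> lists letters" and xy: "x \<in> V" "y \<in> V"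
  shows "tree_dist (sub a i) (ret_word i x) (ret_word i y) \<le> tree_dist a x y"
proof -
  obtain m where m: "x \<in> vertices c m" "y \<in> vertices c m" using V_level2 xy by blast
  have n: "x \<in> vertices c (length i + m)" "y \<in> vertices c (length i + m)"
    using m vertices_mono[of m "length i + m"] by auto
  have i': "i \<in> words letters (length i)" using i lists_words by auto
  have "tree_dist (sub a i) (ret_word i x) (ret_word i y) = tree_dist_n (sub a i) m (ret_word i x) (ret_word i y)"
    using n i' ret_word_vertices by (intro tree_dist_eq edge_lengths_sub a i) blast+
  also have "\<dots> = (\<Sum>u\<in>words letters m. a (i @ u) * \<bar>far (i @ u) x - far (i @ u) y\<bar>)"
    by (simp add: tree_dist_n_def sub_def far_append)
  also have "\<dots> \<le> (\<Sum>j\<in>words letters (length i). \<Sum>u\<in>words letters m. a (j @ u) * \<bar>far (j @ u) x - far (j @ u) y\<bar>)"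
    using edge_lengths_nonneg[OF a words_append]
    by (intro member_le_sum i') (auto intro!: sum_nonneg mult_nonneg_nonneg)
  also have "\<dots> = tree_dist a x y"
    unfolding tree_dist_eq[OF a n] tree_dist_n_def sum_words_add ..
  finally show ?thesis .
qed

lemma tree_dist_ends:
  assumes "edge_lengths a" shows "tree_dist a (0, 0) (1, 0) = a []"
proof -
  have "tree_dist a (0, 0) (1, 0) = tree_dist_n a 0 (0, 0) (1, 0)"
    by (intro tree_dist_eq assms) (auto simp: ends_def)
  then show ?thesis by (simp add: tree_dist_n_def far_Nil)
qed

lemma tree_dist_ge_edge:
  assumes a: "edge_lengths a" and i: "i \<in> lists letters" and xy: "x \<in> V" "y \<in> V"
    and "ret_word i x \<in> ends" "ret_word i y \<in> ends" "ret_word i x \<noteq> ret_word i y"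
  shows "a i \<le> tree_dist a x y"
proof -
  have "a i = tree_dist (sub a i) (ret_word i x) (ret_word i y)"
    using assms(5-) tree_dist_ends[OF edge_lengths_sub[OF a i]] tree_dist_sym[of "sub a i" "(1, 0)" "(0, 0)"]
    by (auto simp: ends_def sub_def)
  then show ?thesis using tree_dist_ret[OF a i xy] by simp
qed

text \<open>Walk from (0, 0) along the edge \<open>[1]\<close> to the centre, which is the image of
  (0, 0) in the first-level cell containing x, and repeat there: each level costs one edge.\<close>

lemma tree_dist_O_le:
  assumes "edge_lengths a" "x \<in> vertices c n" "\<And>u. u \<in> lists letters \<Longrightarrow> a u \<le> b (length u)"
  shows "tree_dist a (0, 0) x \<le> (\<Sum>k\<le>n. b k)"
  using assms
proof (induction n arbitrary: a x b)
  case 0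
  have "0 < a []" using 0 edge_lengths_pos[of a "[]" 0] by simp
  then have "0 \<le> b 0" using 0(3)[of "[]"] by simp
  then show ?case using 0 tree_dist_ends[OF 0(1)] 0(3)[of "[]"] by (auto simp: ends_def tree_dist_refl)
next
  case (Suc n)
  note a = Suc.prems(1)
  obtain j y where j: "j \<in> letters" "y \<in> vertices c n" "x = psi c j y"
    using Suc.prems by (auto simp: vertices_Suc)
  have V: "(0, 0) \<in> V" "(1, 0) \<in> V" "x \<in> V" "(1/2, 0) \<in> V" "y \<in> V"
    using ends_V Suc.prems j psi_word_V[of "[1]" "(0, 0)"]
    by (auto simp: all_vertices_def ends_def letters_def)
  have 1: "[1] \<in> lists letters" by (simp add: letters_def)
  have "tree_dist a (0, 0) (1/2, 0) = a [1]"
    using tree_dist_cell[OF a 1 V(2,1)] tree_dist_ends[OF edge_lengths_sub[OF a 1]]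
      tree_dist_sym[of "sub a [1]" "(1, 0)" "(0, 0)"] by (simp add: sub_def)
  moreover have "a [1] \<le> b 1" using Suc.prems(3)[OF 1] by simp
  moreover have "tree_dist a (1/2, 0) x = tree_dist (sub a [j]) (0, 0) y"
    using tree_dist_cell[OF a _ V(1,5), of "[j]"] j by (simp add: psi_O)
  moreover have "tree_dist (sub a [j]) (0, 0) y \<le> (\<Sum>k\<le>n. b (Suc k))"
    using Suc.prems(3)[of "j # _"] j by (intro Suc.IH edge_lengths_sub a) (auto simp: sub_def)
  moreover have "(\<Sum>k\<le>Suc n. b k) = b 0 + (\<Sum>k\<le>n. b (Suc k))" by (rule sum.atMost_Suc_shift)
  moreover have "tree_dist a (0, 0) x \<le> tree_dist a (0, 0) (1/2, 0) + tree_dist a (1/2, 0) x"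
    by (intro tree_dist_triangle a V)
  moreover have "a [] = a [1] + a [2]" using a unfolding edge_lengths_def by (metis append_Nil lists.Nil)
  moreover have "0 < a [2]" using edge_lengths_pos[OF a, of "[2]" 1] by (simp add: words_def letters_def)
  moreover have "a [] \<le> b 0" using Suc.prems(3)[of "[]"] by simp
  ultimately show ?case by linarith
qed

lemma tree_dist_le:
  assumes "edge_lengths a" "x \<in> V" "y \<in> V" "\<And>u. u \<in> lists letters \<Longrightarrow> a u \<le> b (length u)" "summable b"
  shows "tree_dist a x y \<le> 2 * suminf b"
proof -
  have b: "0 \<le> b k" for k
  proof -
    have "replicate k 1 \<in> lists letters" by (auto simp: letters_def in_lists_conv_set)
    then show ?thesis
      using assms(4)[of "replicate k 1"] edge_lengths_nonneg[OF assms(1), of "replicate k 1" k]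
      by (simp add: words_def)
  qed
  obtain n where n: "x \<in> vertices c n" "y \<in> vertices c n" using V_level2 assms by blast
  have O: "(0, 0) \<in> V" using ends_V by (auto simp: ends_def)
  have "(\<Sum>k\<le>n. b k) \<le> suminf b" using b assms by (intro sum_le_suminf) auto
  then have *: "tree_dist a (0, 0) x \<le> suminf b" "tree_dist a (0, 0) y \<le> suminf b"
    using tree_dist_O_le[OF assms(1) n(1) assms(4)] tree_dist_O_le[OF assms(1) n(2) assms(4)] by linarith+
  have "tree_dist a x y \<le> tree_dist a x (0, 0) + tree_dist a (0, 0) y"
    using assms O by (intro tree_dist_triangle) auto
  then show ?thesis using * tree_dist_sym[of a x] by simp
qed

lemma tree_dist_cell_le:
  assumes "edge_lengths a" "i \<in> lists letters" "x \<in> psi_word c i ` V" "y \<in> psi_word c i ` V"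
    "\<And>u. u \<in> lists letters \<Longrightarrow> a (i @ u) \<le> b (length u)" "summable b"
  shows "tree_dist a x y \<le> 2 * suminf b"
  using assms tree_dist_cell[OF assms(1,2)] tree_dist_le[OF edge_lengths_sub[OF assms(1,2)], of _ _ b]
  by (auto simp: sub_def)


section \<open>The vertex resistance is the tree metric\<close>

definition wenergy :: "(nat list \<Rightarrow> real) \<Rightarrow> nat \<Rightarrow> (real \<times> real \<Rightarrow> real) \<Rightarrow> real" where
  "wenergy a n f = (\<Sum>i\<in>words letters n. 1 / a i * (f (psi_word c i (0, 0)) - f (psi_word c i (1, 0)))\<^sup>2)"

lemma far_square: "\<bar>far i x - far i y\<bar> = (far i x - far i y)\<^sup>2"
  by (auto simp: far_def)

lemma energy_ge:
  assumes a: "edge_lengths a" and n: "x \<in> vertices c n" "y \<in> vertices c n"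
  shows "(f x - f y)\<^sup>2 \<le> wenergy a n f * tree_dist a x y"
proof -
  let ?d = "\<lambda>i. f (psi_word c i (1, 0)) - f (psi_word c i (0, 0))"
  have "f x - f y = (\<Sum>i\<in>words letters n. (?d i / sqrt (a i)) * (sqrt (a i) * (far i x - far i y)))"
    unfolding tree_identity[OF n, of f]
    using edge_lengths_pos[OF a] by (intro sum.cong) (fastforce simp: mult.commute)+
  then have "(f x - f y)\<^sup>2 \<le> (\<Sum>i\<in>words letters n. (?d i / sqrt (a i))\<^sup>2)
      * (\<Sum>i\<in>words letters n. (sqrt (a i) * (far i x - far i y))\<^sup>2)"
    by (simp only: Cauchy_Schwarz_ineq_sum)
  also have "(\<Sum>i\<in>words letters n. (?d i / sqrt (a i))\<^sup>2) = wenergy a n f"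
    unfolding wenergy_def using edge_lengths_pos[OF a]
    by (intro sum.cong) (auto simp: power_divide power2_commute less_imp_le)
  also have "(\<Sum>i\<in>words letters n. (sqrt (a i) * (far i x - far i y))\<^sup>2) = tree_dist a x y"
    unfolding tree_dist_eq[OF a n] tree_dist_n_def far_square using edge_lengths_pos[OF a]
    by (intro sum.cong) (auto simp: power_mult_distrib less_imp_le)
  finally show ?thesis .
qed

text \<open>The Gromov product \<open>(y | z)\<close> based at \<open>x\<close>, normalised: the energy minimiser.\<close>

definition potential :: "(nat list \<Rightarrow> real) \<Rightarrow> real \<times> real \<Rightarrow> real \<times> real \<Rightarrow> real \<times> real \<Rightarrow> real" where
  "potential a x y z = (tree_dist a x z + tree_dist a x y - tree_dist a y z) / (2 * tree_dist a x y)"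

text \<open>Moving along the edge \<open>i\<close> crosses no other edge of the level, so the
  distance to x changes by \<open>a i\<close>, with a sign given by the side of x.\<close>

lemma tree_dist_edge_diff:
  assumes a: "edge_lengths a" and n: "x \<in> vertices c n" and i: "i \<in> words letters n"
  shows "tree_dist a x (psi_word c i (0, 0)) - tree_dist a x (psi_word c i (1, 0)) = a i * (2 * far i x - 1)"
proof -
  have il: "i \<in> lists letters" "length i = n" using i by (auto simp: words_def)
  have v: "psi_word c i (0, 0) \<in> vertices c n" "psi_word c i (1, 0) \<in> vertices c n"
    using psi_word_vertices[OF il(1), of _ 0] il by (auto simp: ends_def)
  have "tree_dist a x (psi_word c i (0, 0)) - tree_dist a x (psi_word c i (1, 0)) =
    (\<Sum>k\<in>words letters n. a k * (\<bar>far k x - far k (psi_word c i (0, 0))\<bar> - \<bar>far k x - far k (psi_word c i (1, 0))\<bar>))"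
    unfolding tree_dist_eq[OF a n v(1)] tree_dist_eq[OF a n v(2)] tree_dist_n_def
    by (simp add: sum_subtractf right_diff_distrib)
  also have "\<dots> = (\<Sum>k\<in>words letters n. if k = i then a i * (2 * far i x - 1) else 0)"
  proof (rule sum.cong[OF refl])
    fix k assume k: "k \<in> words letters n"
    show "a k * (\<bar>far k x - far k (psi_word c i (0, 0))\<bar> - \<bar>far k x - far k (psi_word c i (1, 0))\<bar>) =
      (if k = i then a i * (2 * far i x - 1) else 0)"
    proof (cases "k = i")
      case True
      then have "far k (psi_word c i (0, 0)) = 0" "far k (psi_word c i (1, 0)) = 1"
        using ret_word_psi[OF il(1)] by (auto simp: far_def)
      then show ?thesis using True by (auto simp: far_def)
    next
      case False
      have "k \<in> lists letters" "length i = length k" using k il by (auto simp: words_def)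
      then have "far k (psi_word c i (0, 0)) = far k (psi_word c i (1, 0))"
        using ret_word_other[OF il(1), of k "(1, 0)"] False by (auto simp: far_def)
      then show ?thesis using False by simp
    qed
  qed
  also have "\<dots> = a i * (2 * far i x - 1)" using i by simp
  finally show ?thesis .
qed

text \<open>The potential changes by \<open>a i / D\<close> on the edges that separate x from y and
  is constant on the others, so the energy is \<open>D / D\<^sup>2\<close> on every level that
  contains both points.\<close>

lemma wenergy_potential:
  assumes a: "edge_lengths a" and n: "x \<in> vertices c n" "y \<in> vertices c n" and "x \<noteq> y"
  shows "wenergy a n (potential a x y) = 1 / tree_dist a x y"
proof -
  define D where "D = tree_dist a x y"
  have D: "0 < D" unfolding D_def using n assms by (intro tree_dist_pos) (auto simp: all_vertices_def)
  have "wenergy a n (potential a x y) = (\<Sum>i\<in>words letters n. a i * \<bar>far i x - far i y\<bar> / D\<^sup>2)"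
    unfolding wenergy_def
  proof (rule sum.cong[OF refl])
    fix i assume i: "i \<in> words letters n"
    have "potential a x y (psi_word c i (0, 0)) - potential a x y (psi_word c i (1, 0))
      = (a i * (2 * far i x - 1) - a i * (2 * far i y - 1)) / (2 * D)"
      unfolding tree_dist_edge_diff[OF a n(1) i, symmetric] tree_dist_edge_diff[OF a n(2) i, symmetric]
      by (simp add: potential_def D_def diff_divide_distrib add_divide_distrib)
    also have "\<dots> = a i * (far i x - far i y) / D" by (simp add: algebra_simps diff_divide_distrib)
    finally have *: "potential a x y (psi_word c i (0, 0)) - potential a x y (psi_word c i (1, 0)) = \<dots>" .
    show "1 / a i * (potential a x y (psi_word c i (0, 0)) - potential a x y (psi_word c i (1, 0)))\<^sup>2
      = a i * \<bar>far i x - far i y\<bar> / D\<^sup>2"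
      unfolding * far_square using edge_lengths_pos[OF a i] by (simp add: power2_eq_square)
  qed
  also have "\<dots> = D / D\<^sup>2"
    unfolding D_def tree_dist_eq[OF a n] tree_dist_n_def sum_divide_distrib ..
  also have "\<dots> = 1 / D" by (simp add: power2_eq_square)
  finally show ?thesis by (simp add: D_def)
qed

text \<open>The potential has constant energy from some level on, so it lies in the domain and
  attains the lower bound of \<open>energy_ge\<close>: the infimum is a minimum.\<close>

lemma vertex_resistance_eq:
  assumes a: "edge_lengths a" and v: "\<And>i. i \<in> lists letters \<Longrightarrow> a i = cascade_prod v i * limit_factor v i"
    and xy: "x \<in> V" "y \<in> V"
  shows "vertex_resistance c v x y = tree_dist a x y"
proof (cases "x = y")
  case False
  have en: "energy_n c v n f = wenergy a n f" for n f
    unfolding energy_n_def wenergy_def using v wordsD(2) by (intro sum.cong refl) simp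
  obtain n where n: "x \<in> vertices c n" "y \<in> vertices c n" using V_level2[OF xy] .
  have n: "x \<in> vertices c m" "y \<in> vertices c m" if "n \<le> m" for m
    using vertices_mono[OF that] n by auto
  define D where "D = tree_dist a x y"
  have D: "0 < D" unfolding D_def using a xy False by (intro tree_dist_pos) auto
  let ?g = "potential a x y"
  let ?S = "{energy c v f | f. f \<in> energy_dom c v \<and> f x = 0 \<and> f y = 1}"
  have lim: "(\<lambda>m. energy_n c v m ?g) \<longlonglongrightarrow> 1 / D"
    unfolding en D_def
    by (intro tendsto_eventually eventually_sequentiallyI[of n] wenergy_potential[OF a n False])
  have "1 / D \<in> ?S"
    using lim D tree_dist_sym[of a x y] by (auto intro!: exI[of _ ?g] limI[symmetric] convergentI
      simp: energy_def energy_dom_def potential_def tree_dist_refl D_def)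
  moreover have "1 / D \<le> z" if "z \<in> ?S" for z
  proof -
    obtain f where f: "z = energy c v f" "convergent (\<lambda>m. energy_n c v m f)" "f x = 0" "f y = 1"
      using \<open>z \<in> ?S\<close> by (auto simp: energy_dom_def)
    have l: "(\<lambda>m. energy_n c v m f) \<longlonglongrightarrow> z" using f by (simp add: energy_def convergent_LIMSEQ_iff)
    have "1 / D \<le> energy_n c v m f" if "n \<le> m" for m
      using energy_ge[OF a n(1)[OF that] n(2)[OF that], of f] f D by (simp add: en D_def field_simps)
    then show ?thesis using l by (intro LIMSEQ_le_const[OF l]) auto
  qed
  ultimately have "Inf ?S = 1 / D" by (intro cInf_eq_minimum) auto
  then show ?thesis using False by (simp add: vertex_resistance_def D_def)
qed (simp add: vertex_resistance_def tree_dist_refl)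

end


section \<open>Extension to the fractal\<close>

context fractal_scale
begin

lemma V_cells: "V = (\<Union>i\<in>words letters n. psi_word c i ` V)"
  by (rule invariant_words[OF V_unfold])

lemma cells_share_vertex:
  assumes "i \<in> words letters n" "j \<in> words letters n"
    "psi_word c i ` rhombus \<inter> psi_word c j ` rhombus \<noteq> {}"
  obtains z where "z \<in> psi_word c i ` V" "z \<in> psi_word c j ` V"
proof (cases "i = j")
  case True
  then show ?thesis using that[of "psi_word c i (0, 0)"] ends_V by (auto simp: ends_def)
next
  case False
  obtain p q where pq: "p \<in> rhombus" "q \<in> rhombus" "psi_word c i p = psi_word c j q"
    using assms(3) by blast
  then have "p \<in> ends \<and> q \<in> ends"
    using assms False by (intro cells_inter) (auto simp: words_def)
  then have "p \<in> V" "q \<in> V" using ends_V by auto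
  then have "psi_word c i p \<in> psi_word c i ` V" by simp
  moreover have "psi_word c i p \<in> psi_word c j ` V" using \<open>q \<in> V\<close> pq(3) by simp
  ultimately show ?thesis by (rule that)
qed

text \<open>There are finitely many pairs of compact images, and disjoint ones have positive
  distance. Hence nearby vertices lie in cells that share a vertex, from which
  \<open>D_uniform\<close> follows.\<close>

lemma close_cells_meet:
  obtains \<delta> where "0 < \<delta>" "\<And>i j p q. i \<in> words letters n \<Longrightarrow> j \<in> words letters n \<Longrightarrow>
    p \<in> psi_word c i ` rhombus \<Longrightarrow> q \<in> psi_word c j ` rhombus \<Longrightarrow> dist p q < \<delta> \<Longrightarrow>
    psi_word c i ` rhombus \<inter> psi_word c j ` rhombus \<noteq> {}"
proof -
  let ?W = "words letters n \<times> words letters n"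
  let ?R = "\<lambda>i. psi_word c i ` rhombus"
  have "\<exists>d>0. ?R (fst ij) \<inter> ?R (snd ij) = {} \<longrightarrow> (\<forall>p\<in>?R (fst ij). \<forall>q\<in>?R (snd ij). d \<le> dist p q)"
    if "ij \<in> ?W" for ij
  proof (cases "?R (fst ij) \<inter> ?R (snd ij) = {}")
    case True
    have "compact (?R i)" if "i \<in> words letters n" for i
      using that wordsD(2) by (intro compact_continuous_image continuous_psi_word compact_rhombus) auto
    then show ?thesis
      using separate_compact_closed[of "?R (fst ij)" "?R (snd ij)"] True that compact_imp_closed
      by (metis mem_Times_iff)
  qed (auto intro: exI[of _ 1])
  then obtain d where d: "\<And>ij. ij \<in> ?W \<Longrightarrow> 0 < (d ij :: real)"
    "\<And>ij p q. ij \<in> ?W \<Longrightarrow> ?R (fst ij) \<inter> ?R (snd ij) = {} \<Longrightarrow> p \<in> ?R (fst ij) \<Longrightarrow> q \<in> ?R (snd ij) \<Longrightarrow> d ij \<le> dist p q"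
    by metis
  have fin: "finite (insert 1 (d ` ?W))" by simp
  show ?thesis
  proof (rule that[of "Min (insert 1 (d ` ?W))"])
    show "0 < Min (insert 1 (d ` ?W))" using d(1) by (subst Min_gr_iff) auto
    fix i j p q
    assume *: "i \<in> words letters n" "j \<in> words letters n" "p \<in> ?R i" "q \<in> ?R j"
      "dist p q < Min (insert 1 (d ` ?W))"
    then have "Min (insert 1 (d ` ?W)) \<le> d (i, j)" by (intro Min_le fin) auto
    then have "\<not> d (i, j) \<le> dist p q" using *(5) by linarith
    then show "?R i \<inter> ?R j \<noteq> {}" using d(2)[of "(i, j)" p q] *(1-4) by fastforce
  qed
qed

lemma ret_word_2: "ret_word (replicate k 2) (0, 0) = (0, 0)" "ret_word (replicate k 2) (1, 0) = (1, 0)"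
  by (induction k) (auto simp: ret_O)

text \<open>The cell \<open>replicate k 2\<close> sits at the end (1, 0) and hangs on the rest of
  level k by its other end only, so the rest collapses to that end.\<close>

lemma ret_word_2_psi:
  assumes "t \<in> words letters k" "t \<noteq> replicate k 2" "p \<in> rhombus"
  shows "ret_word (replicate k 2) (psi_word c t p) = (0, 0)"
  using assms
proof (induction k arbitrary: t)
  case (Suc k)
  then obtain j u where t: "t = j # u" "j \<in> letters" "u \<in> words letters k" by (auto simp: words_Suc)
  have r: "psi_word c u p \<in> rhombus" using Suc.prems t wordsD(2) psi_word_rhombus by blast
  have 2: "2 \<in> letters" by (simp add: letters_def)
  show ?case
  proof (cases "j = 2")
    case True then show ?thesis using Suc t r ret_psi[OF 2] by simp
  next
    case False then show ?thesis using t r ret_psi_other[OF 2 t(2)] by (simp add: ret_word_2)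
  qed
qed simp

end

text \<open>One realisation with edge lengths \<open>a\<close>, where \<open>b\<close> bounds the
  longest edge of each level. Summability of \<open>b\<close> makes the diameters of small cells
  tend to zero, so that the tree metric extends to the fractal.\<close>

locale resistance_form = fractal_scale +
  fixes v a :: "nat list \<Rightarrow> real" and b :: "nat \<Rightarrow> real"
  assumes edge_lengths: "edge_lengths a"
    and a_eq: "\<And>i. i \<in> lists letters \<Longrightarrow> a i = cascade_prod v i * limit_factor v i"
    and a_le: "\<And>i. i \<in> lists letters \<Longrightarrow> a i \<le> b (length i)"
    and summable_b: "summable b"
begin

abbreviation "D \<equiv> tree_dist a"
abbreviation "res \<equiv> resistance c v"

lemmas D_triangle = tree_dist_triangle[OF edge_lengths]

lemma small_cells:
  assumes "0 < e"
  obtains n where "\<And>i x y. i \<in> words letters n \<Longrightarrow> x \<in> psi_word c i ` V \<Longrightarrow> y \<in> psi_word c i ` V \<Longrightarrow> D x y < e"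
proof -
  obtain n where n: "norm (\<Sum>k. b (k + n)) < e / 2"
    using suminf_exist_split[OF _ summable_b, of "e / 2"] assms by auto
  have "D x y < e" if i: "i \<in> words letters n" and xy: "x \<in> psi_word c i ` V" "y \<in> psi_word c i ` V" for i x y
  proof -
    have "D x y \<le> 2 * (\<Sum>k. b (k + n))"
      using a_le[of "i @ _"] wordsD[OF i]
      by (intro tree_dist_cell_le[OF edge_lengths _ xy]) (auto simp: add.commute summable_b)
    then show ?thesis using n by simp
  qed
  then show ?thesis using that by blast
qed

lemma D_uniform:
  assumes "0 < e"
  obtains \<delta> where "0 < \<delta>" "\<And>x y. x \<in> V \<Longrightarrow> y \<in> V \<Longrightarrow> dist x y < \<delta> \<Longrightarrow> D x y < e"
proof -
  obtain n where n: "\<And>i x y. i \<in> words letters n \<Longrightarrow> x \<in> psi_word c i ` V \<Longrightarrow> y \<in> psi_word c i ` V \<Longrightarrow> D x y < e / 2"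
    using small_cells[of "e / 2"] assms by auto
  obtain \<delta> where \<delta>: "0 < \<delta>" "\<And>i j p q. i \<in> words letters n \<Longrightarrow> j \<in> words letters n \<Longrightarrow>
    p \<in> psi_word c i ` rhombus \<Longrightarrow> q \<in> psi_word c j ` rhombus \<Longrightarrow> dist p q < \<delta> \<Longrightarrow>
    psi_word c i ` rhombus \<inter> psi_word c j ` rhombus \<noteq> {}"
    using close_cells_meet[of n] by blast
  have "D x y < e" if xy: "x \<in> V" "y \<in> V" "dist x y < \<delta>" for x y
  proof -
    obtain i j where ij: "i \<in> words letters n" "j \<in> words letters n" "x \<in> psi_word c i ` V" "y \<in> psi_word c j ` V"
      using xy V_cells[of n] by blast
    have "psi_word c i ` rhombus \<inter> psi_word c j ` rhombus \<noteq> {}"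
      using ij xy V_rhombus by (intro \<delta>(2)[of i j x y]) auto
    then obtain z where z: "z \<in> psi_word c i ` V" "z \<in> psi_word c j ` V"
      using cells_share_vertex ij by blast
    have "z \<in> V" using z ij(1) V_cells by blast
    then have "D x y \<le> D x z + D z y" using xy by (intro D_triangle) auto
    then show ?thesis using n[OF ij(1,3) z(1)] n[OF ij(2) z(2) ij(4)] by simp
  qed
  then show ?thesis using that \<delta>(1) by blast
qed

lemma D_diff:
  assumes "x \<in> V" "y \<in> V" "x' \<in> V" "y' \<in> V"
  shows "\<bar>D x y - D x' y'\<bar> \<le> D x x' + D y y'"
  using D_triangle[of x x' y] D_triangle[of x' y' y] D_triangle[of x' x y'] D_triangle[of x y y'] assms
    tree_dist_sym[of a x x'] tree_dist_sym[of a y y'] by linarith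

lemma D_uniformly_continuous: "uniformly_continuous_on (V \<times> V) (\<lambda>(x, y). D x y)"
  unfolding uniformly_continuous_on_def
proof (intro allI impI)
  fix e :: real assume "0 < e"
  then obtain \<delta> where \<delta>: "0 < \<delta>" "\<And>x y. x \<in> V \<Longrightarrow> y \<in> V \<Longrightarrow> dist x y < \<delta> \<Longrightarrow> D x y < e / 2"
    using D_uniform[of "e / 2"] by auto
  have "dist (D x y) (D x' y') < e"
    if "x \<in> V" "y \<in> V" "x' \<in> V" "y' \<in> V" "dist (x, y) (x', y') < \<delta>" for x y x' y'
  proof -
    have "dist x x' < \<delta>" "dist y y' < \<delta>"
      using that(5) dist_fst_le[of "(x, y)" "(x', y')"] dist_snd_le[of "(x, y)" "(x', y')"] by auto
    then have "D x x' < e / 2" "D y y' < e / 2" using \<delta> that by auto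
    then show ?thesis using D_diff[OF that(1-4)] by (simp add: dist_real_def)
  qed
  then show "\<exists>d>0. \<forall>p\<in>V \<times> V. \<forall>q\<in>V \<times> V. dist q p < d \<longrightarrow>
      dist (case q of (x, y) \<Rightarrow> D x y) (case p of (x, y) \<Rightarrow> D x y) < e"
    using \<delta>(1) by (intro exI[of _ \<delta>]) auto
qed

text \<open>The uniformly continuous extension of \<open>D\<close> to the closure supplies the
  unique number asked for by the definite description in \<open>resistance\<close>.\<close>

lemma res_tendsto:
  assumes "\<And>n. xs n \<in> V" "\<And>n. ys n \<in> V" "xs \<longlonglongrightarrow> x" "ys \<longlonglongrightarrow> y"
  shows "(\<lambda>n. D (xs n) (ys n)) \<longlonglongrightarrow> res x y"
proof -
  obtain g where g: "uniformly_continuous_on (closure (V \<times> V)) g"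
    "\<And>p. p \<in> V \<times> V \<Longrightarrow> (case p of (x, y) \<Rightarrow> D x y) = g p"
    using uniformly_continuous_on_extension_on_closure[OF D_uniformly_continuous] by metis
  have lim: "(\<lambda>n. D (xs n) (ys n)) \<longlonglongrightarrow> g (x, y)"
    if "\<And>n. xs n \<in> V" "\<And>n. ys n \<in> V" "xs \<longlonglongrightarrow> x" "ys \<longlonglongrightarrow> y" for xs ys x y
  proof -
    have "x \<in> closure V" "y \<in> closure V" using that by (auto simp: closure_sequential)
    then have "(\<lambda>n. g (xs n, ys n)) \<longlonglongrightarrow> g (x, y)"
      using uniformly_continuous_imp_continuous[OF g(1)] that closure_subset
      by (intro continuous_on_tendsto_compose[of "closure (V \<times> V)" g] tendsto_Pair)
         (auto simp: closure_Times intro!: always_eventually)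
    then show ?thesis using g(2)[of "(xs _, ys _)"] that by simp
  qed
  have "x \<in> closure V" "y \<in> closure V" using assms by (auto simp: closure_sequential)
  then have "res x y = (THE r. \<forall>xs ys. range xs \<subseteq> V \<longrightarrow> range ys \<subseteq> V \<longrightarrow>
             xs \<longlonglongrightarrow> x \<longrightarrow> ys \<longlonglongrightarrow> y \<longrightarrow> (\<lambda>n. vertex_resistance c v (xs n) (ys n)) \<longlonglongrightarrow> r)"
    by (simp add: resistance_def fractal_eq)
  also have "\<dots> = g (x, y)"
  proof (rule the_equality)
    have *: "(\<lambda>n. vertex_resistance c v (xs n) (ys n)) = (\<lambda>n. D (xs n) (ys n))"
      if "range xs \<subseteq> V" "range ys \<subseteq> V" for xs ys
      using that vertex_resistance_eq[OF edge_lengths a_eq] by (auto simp: subset_eq)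
    then show "\<forall>xs ys. range xs \<subseteq> V \<longrightarrow> range ys \<subseteq> V \<longrightarrow> xs \<longlonglongrightarrow> x \<longrightarrow> ys \<longlonglongrightarrow> y \<longrightarrow>
        (\<lambda>n. vertex_resistance c v (xs n) (ys n)) \<longlonglongrightarrow> g (x, y)"
    proof (intro allI impI)
      fix xs ys assume h: "range xs \<subseteq> V" "range ys \<subseteq> V" "xs \<longlonglongrightarrow> x" "ys \<longlonglongrightarrow> y"
      show "(\<lambda>n. vertex_resistance c v (xs n) (ys n)) \<longlonglongrightarrow> g (x, y)"
        unfolding *[OF h(1,2)] using h by (intro lim) auto
    qed
    fix r assume "\<forall>xs ys. range xs \<subseteq> V \<longrightarrow> range ys \<subseteq> V \<longrightarrow> xs \<longlonglongrightarrow> x \<longrightarrow> ys \<longlonglongrightarrow> y \<longrightarrow>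
        (\<lambda>n. vertex_resistance c v (xs n) (ys n)) \<longlonglongrightarrow> r"
    moreover have "range xs \<subseteq> V" "range ys \<subseteq> V" using assms by auto
    ultimately have "(\<lambda>n. D (xs n) (ys n)) \<longlonglongrightarrow> r" using assms(3,4) *[of xs ys] by metis
    then show "r = g (x, y)" using lim[OF assms] LIMSEQ_unique by blast
  qed
  finally show ?thesis using lim[OF assms] by simp
qed

text \<open>Transfers bounds for \<open>D\<close> on vertices to \<open>res\<close> on cells, since
  the vertices in a cell are dense in it.\<close>

lemma res_in:
  assumes "i \<in> lists letters" "j \<in> lists letters" "x \<in> cell i" "y \<in> cell j" "closed S"
    "\<And>x' y'. x' \<in> psi_word c i ` V \<Longrightarrow> y' \<in> psi_word c j ` V \<Longrightarrow> D x' y' \<in> S"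
  shows "res x y \<in> S"
proof -
  obtain xs ys where *: "\<And>n. xs n \<in> psi_word c i ` V" "xs \<longlonglongrightarrow> x" "\<And>n. ys n \<in> psi_word c j ` V" "ys \<longlonglongrightarrow> y"
    using assms cell_seq by metis
  have "psi_word c i ` V \<subseteq> V" "psi_word c j ` V \<subseteq> V" using psi_word_V assms(1,2) by auto
  with * have "xs n \<in> V" "ys n \<in> V" for n by auto
  then have "(\<lambda>n. D (xs n) (ys n)) \<longlonglongrightarrow> res x y" by (intro res_tendsto *)
  then show ?thesis
    by (rule Lim_in_closed_set[OF assms(5) _ sequentially_bot, rotated]) (intro always_eventually allI assms(6) *)
qed

lemma res_ge:
  assumes "i \<in> lists letters" "j \<in> lists letters" "x \<in> cell i" "y \<in> cell j"
    "\<And>x' y'. x' \<in> psi_word c i ` V \<Longrightarrow> y' \<in> psi_word c j ` V \<Longrightarrow> r \<le> D x' y'"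
  shows "r \<le> res x y"
  using res_in[OF assms(1-4), of "{r..}"] assms(5) by auto

lemma res_cell_le:
  assumes "i \<in> lists letters" "x \<in> cell i" "y \<in> cell i"
    "\<And>u. u \<in> lists letters \<Longrightarrow> a (i @ u) \<le> b' (length u)" "summable b'"
  shows "res x y \<le> 2 * suminf b'"
  using res_in[OF assms(1,1,2,3), of "{..2 * suminf b'}"] tree_dist_cell_le[OF edge_lengths assms(1) _ _ assms(4,5)]
  by auto

lemma T_seq: assumes "x \<in> T" obtains xs where "\<And>n::nat. xs n \<in> V" "xs \<longlonglongrightarrow> x"
  using cell_seq[of "[]" x] assms by auto

text \<open>Take cells i and j of a level so fine that they are far apart in the plane. If no third
  edge separated their base points, the tree identity for the identity of the plane would bound the
  distance of these points by the lengths of the two segments i and j. So some edge k different from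
  both separates all of the cell i from all of the cell j.\<close>

lemma res_pos:
  assumes "x \<in> T" "y \<in> T" "x \<noteq> y" shows "0 < res x y"
proof -
  obtain B where B: "\<And>p q. p \<in> rhombus \<Longrightarrow> q \<in> rhombus \<Longrightarrow> dist p q \<le> B"
    using compact_imp_bounded[OF compact_rhombus] bounded_two_points by metis
  \<comment> \<open>The numerator pays for two cells of diameter at most \<open>B / 2 ^ n\<close>
    and for two segments of length at most \<open>1 / 2 ^ n\<close>.\<close>
  have "(\<lambda>n. (2 + 2 * B) / 2 ^ n) \<longlonglongrightarrow> 0" using LIMSEQ_divide_realpow_zero[of 2 "2 + 2 * B"] by simp
  then obtain n where n: "(2 + 2 * B) / 2 ^ n < dist x y"
    using order_tendstoD(2)[of "\<lambda>n. (2 + 2 * B) / 2 ^ n" 0 sequentially "dist x y"] assms(3)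
    unfolding eventually_sequentially by auto
  obtain i j where ij: "i \<in> words letters n" "j \<in> words letters n" "x \<in> cell i" "y \<in> cell j"
    using assms T_cells[of n] by blast
  then have ijl: "i \<in> lists letters" "j \<in> lists letters" "length i = n" "length j = n" by (auto simp: words_def)
  let ?z = "psi_word c i (0, 0)" and ?z' = "psi_word c j (0, 0)"
  have near: "dist p (psi_word c k (0, 0)) \<le> B / 2 ^ n" if p: "p \<in> cell k" and k: "k \<in> words letters n" for p k
  proof -
    obtain q where q: "q \<in> rhombus" "p = psi_word c k q" using p T_rhombus by (auto simp: cell_def)
    then have "dist p (psi_word c k (0, 0)) \<le> dist q (0, 0) / 2 ^ n"
      using dist_psi_word[of k q "(0, 0)"] wordsD[OF k] by simp
    also have "\<dots> \<le> B / 2 ^ n" using B q by (intro divide_right_mono) auto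
    finally show ?thesis .
  qed
  have far_z: "2 / 2 ^ n < dist ?z ?z'"
  proof -
    have "dist x y \<le> dist x ?z + dist ?z ?z' + dist y ?z'"
      using dist_triangle[of x y ?z] dist_triangle[of ?z y ?z'] dist_commute[of y ?z'] by linarith
    then show ?thesis using near[OF ij(3,1)] near[OF ij(4,2)] n by (simp add: add_divide_distrib)
  qed
  have zv: "?z \<in> vertices c n" "?z' \<in> vertices c n"
    using psi_word_vertices[OF ijl(1), of "(0, 0)" 0] psi_word_vertices[OF ijl(2), of "(0, 0)" 0] ijl
    by (simp_all add: ends_def)
  have "\<exists>k\<in>words letters n - {i, j}. far k ?z \<noteq> far k ?z'"
  proof (rule ccontr)
    assume neg: "\<not> ?thesis"
    let ?f = "\<lambda>k. (far k ?z - far k ?z') *\<^sub>R (psi_word c k (1, 0) - psi_word c k (0, 0))"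
    have "?z - ?z' = (\<Sum>k\<in>words letters n. ?f k)" by (rule tree_identity[OF zv, of "\<lambda>z. z"])
    also have "\<dots> = (\<Sum>k\<in>{i, j}. ?f k)"
      using neg ij by (intro sum.mono_neutral_right) auto
    finally have e: "?z - ?z' = (\<Sum>k\<in>{i, j}. ?f k)" .
    have "dist ?z ?z' \<le> (\<Sum>k\<in>{i, j}. norm (?f k))"
      unfolding dist_norm e by (rule norm_sum)
    also have "\<dots> \<le> (\<Sum>k\<in>{i, j}. 1 / 2 ^ n)"
    proof (rule sum_mono)
      fix k assume "k \<in> {i, j}"
      then have "dist (psi_word c k (1, 0)) (psi_word c k (0, 0)) \<le> dist (1::real, 0::real) (0, 0) / 2 ^ n"
        using dist_psi_word[of k "(1, 0)" "(0, 0)"] ijl by auto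
      moreover have "dist (1::real, 0::real) (0, 0) = 1" by (simp add: dist_Pair_Pair)
      moreover have "\<bar>far k ?z - far k ?z'\<bar> \<le> 1" by (auto simp: far_def)
      ultimately show "norm (?f k) \<le> 1 / 2 ^ n"
        using mult_mono[of "\<bar>far k ?z - far k ?z'\<bar>" 1 "norm (psi_word c k (1, 0) - psi_word c k (0, 0))" "1 / 2 ^ n"]
        by (simp add: dist_norm)
    qed
    also have "\<dots> \<le> 2 / 2 ^ n" by (cases "i = j") (simp_all add: divide_right_mono)
    finally show False using far_z by simp
  qed
  then obtain k where k: "k \<in> words letters n" "k \<noteq> i" "k \<noteq> j" "far k ?z \<noteq> far k ?z'" by blast
  have kl: "k \<in> lists letters" "length k = n" using k by (auto simp: words_def)
  have "a k \<le> res x y"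
  proof (rule res_ge[OF ijl(1,2) ij(3,4)])
    fix x' y' assume xy: "x' \<in> psi_word c i ` V" "y' \<in> psi_word c j ` V"
    obtain p q where pq: "p \<in> V" "q \<in> V" "x' = psi_word c i p" "y' = psi_word c j q" using xy by blast
    have "x' \<in> V" "y' \<in> V" unfolding pq(3,4) using psi_word_V ijl(1,2) pq(1,2) by blast+
    moreover have "ret_word k x' = ret_word k ?z \<and> ret_word k x' \<in> ends"
      unfolding pq(3) by (rule ret_word_other) (use pq V_rhombus k kl ijl in \<open>auto intro: subsetD\<close>)
    moreover have "ret_word k y' = ret_word k ?z' \<and> ret_word k y' \<in> ends"
      unfolding pq(4) by (rule ret_word_other) (use pq V_rhombus k kl ijl in \<open>auto intro: subsetD\<close>)
    ultimately show "a k \<le> D x' y'"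
      using k(4) unfolding far_def by (intro tree_dist_ge_edge[OF edge_lengths kl(1)]) metis+
  qed
  then show ?thesis using edge_lengths_pos[OF edge_lengths k(1)] by simp
qed

lemma res_metric: "Metric_space T res"
proof
  have sym: "res x y = res y x" if "x \<in> T" "y \<in> T" for x y
  proof -
    obtain xs where xs: "\<And>n. xs n \<in> V" "xs \<longlonglongrightarrow> x" using T_seq[OF \<open>x \<in> T\<close>] by blast
    obtain ys where ys: "\<And>n. ys n \<in> V" "ys \<longlonglongrightarrow> y" using T_seq[OF \<open>y \<in> T\<close>] by blast
    show ?thesis
      using res_tendsto[OF xs(1) ys(1) xs(2) ys(2)] res_tendsto[OF ys(1) xs(1) ys(2) xs(2)]
        tree_dist_sym[of a] LIMSEQ_unique by auto
  qed
  then show "res x y = res y x" for x y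
    by (cases "x \<in> T \<and> y \<in> T") (auto simp: resistance_def)
  have refl: "res x x = 0" if "x \<in> T" for x
  proof -
    obtain xs where xs: "\<And>n. xs n \<in> V" "xs \<longlonglongrightarrow> x" using T_seq[OF \<open>x \<in> T\<close>] by blast
    show ?thesis using res_tendsto[OF xs(1) xs(1) xs(2) xs(2)] by (simp add: tree_dist_refl LIMSEQ_const_iff)
  qed
  show "0 \<le> res x y" for x y
    using res_pos[of x y] refl[of x] by (cases "x \<in> T \<and> y \<in> T"; cases "x = y") (auto simp: resistance_def)
  show "res x y = 0 \<longleftrightarrow> x = y" if "x \<in> T" "y \<in> T" for x y
    using res_pos[of x y] refl[of x] that by (metis less_irrefl)
  fix x y z assume "x \<in> T" "y \<in> T" "z \<in> T"
  obtain xs where xs: "\<And>n. xs n \<in> V" "xs \<longlonglongrightarrow> x" using T_seq[OF \<open>x \<in> T\<close>] by blast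
  obtain ys where ys: "\<And>n. ys n \<in> V" "ys \<longlonglongrightarrow> y" using T_seq[OF \<open>y \<in> T\<close>] by blast
  obtain zs where zs: "\<And>n. zs n \<in> V" "zs \<longlonglongrightarrow> z" using T_seq[OF \<open>z \<in> T\<close>] by blast
  show "res x z \<le> res x y + res y z"
    using xs ys zs D_triangle
    by (intro LIMSEQ_le[OF res_tendsto[OF xs(1) zs(1) xs(2) zs(2)]
       tendsto_add[OF res_tendsto[OF xs(1) ys(1) xs(2) ys(2)] res_tendsto[OF ys(1) zs(1) ys(2) zs(2)]]]) auto
qed

text \<open>Every point of another cell retracts to one of the two ends of the cell
  \<open>i\<close>. Leaving the cell through (1, 0) means crossing the whole subcell
  \<open>i @ replicate k 2\<close>, and leaving it through (0, 0) the whole subcell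
  \<open>i @ 1 # replicate k 2\<close>, unless the starting point lies there. The second word is one
  letter longer, so u has k + 1 letters and only its first k are compared with the first
  word.\<close>

lemma res_separation:
  assumes i: "i \<in> lists letters" and u: "u \<in> words letters (Suc k)"
    and avoid: "take k u \<noteq> replicate k 2" "u \<noteq> 1 # replicate k 2"
    and j: "j \<in> lists letters" "length j = length i" "j \<noteq> i"
    and xy: "x \<in> cell (i @ u)" "y \<in> cell j"
  shows "min (a (i @ replicate k 2)) (a (i @ 1 # replicate k 2)) \<le> res x y"
proof (rule res_ge[OF _ j(1) xy])
  show iu: "i @ u \<in> lists letters" using i u by (auto simp: words_def)
  fix x' y' assume x': "x' \<in> psi_word c (i @ u) ` V" and y': "y' \<in> psi_word c j ` V"
  have V: "x' \<in> V" "y' \<in> V" using x' y' psi_word_V[OF iu] psi_word_V[OF j(1)] by auto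
  obtain p where p: "p \<in> rhombus" "x' = psi_word c i (psi_word c u p)"
    using x' V_rhombus by (auto simp: psi_word_append)
  have ul: "u \<in> lists letters" "length u = Suc k" using u by (auto simp: words_def)
  have retx: "ret_word i x' = psi_word c u p"
    using p ret_word_psi[OF i] psi_word_rhombus[OF ul(1)] by simp
  obtain q where q: "q \<in> rhombus" "y' = psi_word c j q" using y' V_rhombus by blast
  have rety: "ret_word i y' \<in> ends" unfolding q(2) using ret_word_other[OF j(1) i j(2,3) q(1)] by blast
  have letter: "1 \<in> letters" "2 \<in> letters" by (auto simp: letters_def)
  have rl: "replicate k 2 \<in> lists letters" using letter by (auto simp: in_lists_conv_set)
  have x0: "ret_word (replicate k 2) (psi_word c u p) = (0, 0)"
  proof -
    have d: "drop k u \<in> lists letters" "take k u \<in> words letters k"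
      using ul by (auto simp: words_def in_lists_conv_set dest: in_set_dropD in_set_takeD)
    have "psi_word c u p = psi_word c (take k u) (psi_word c (drop k u) p)"
      using psi_word_append[of "take k u" "drop k u"] by simp
    then show ?thesis using ret_word_2_psi[OF d(2) avoid(1)] psi_word_rhombus[OF d(1) p(1)] by simp
  qed
  have x1: "ret_word (1 # replicate k 2) (psi_word c u p) = (0, 0)"
  proof -
    obtain l t where t: "u = l # t" "l \<in> letters" "t \<in> words letters k" using u by (auto simp: words_Suc)
    have r: "psi_word c t p \<in> rhombus" using t p psi_word_rhombus wordsD(2) by blast
    show ?thesis
    proof (cases "l = 1")
      case True
      then show ?thesis using ret_psi[OF letter(1) r] ret_word_2_psi[OF t(3) _ p(1)] avoid(2) t by simp
    next
      case False
      then show ?thesis using ret_psi_other[OF letter(1) t(2) _ r] t by (simp add: ret_word_2)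
    qed
  qed
  show "min (a (i @ replicate k 2)) (a (i @ 1 # replicate k 2)) \<le> D x' y'"
  proof (cases "ret_word i y' = (1, 0)")
    case True
    then have "a (i @ replicate k 2) \<le> D x' y'"
      using V i rl by (intro tree_dist_ge_edge[OF edge_lengths])
        (auto simp: ret_word_append retx x0 ret_word_2 ends_def)
    then show ?thesis by simp
  next
    case False
    then have "ret_word i y' = (0, 0)" using rety by (auto simp: ends_def)
    then have "a (i @ 1 # replicate k 2) \<le> D x' y'"
      using V i rl letter x1 ret_O by (intro tree_dist_ge_edge[OF edge_lengths])
        (auto simp: ret_word_append retx ret_word_2 ends_def)
    then show ?thesis by simp
  qed
qed

end


section \<open>Bounds for Hausdorff measures\<close>

lemma ediam_le: "(\<And>x y. x \<in> U \<Longrightarrow> y \<in> U \<Longrightarrow> d x y \<le> B) \<Longrightarrow> ediam d U \<le> ennreal B"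
  unfolding ediam_def by (intro SUP_least ennreal_leI)

lemma ediam_ge: "x \<in> U \<Longrightarrow> y \<in> U \<Longrightarrow> ennreal (d x y) \<le> ediam d U"
  unfolding ediam_def by (meson SUP_upper2 order_refl)

lemma ediam_empty [simp]: "ediam d {} = 0"
  by (simp add: ediam_def bot_ennreal)

lemma hausdorff_premeasure_le_finite_cover:
  assumes W: "finite W" and cover: "A \<subseteq> (\<Union>i\<in>W. F i)" and FX: "\<And>i. i \<in> W \<Longrightarrow> F i \<subseteq> X"
    and B: "\<And>i x y. i \<in> W \<Longrightarrow> x \<in> F i \<Longrightarrow> y \<in> F i \<Longrightarrow> d x y \<le> B i"
    and B0: "\<And>i. i \<in> W \<Longrightarrow> 0 \<le> B i" "\<And>i. i \<in> W \<Longrightarrow> B i \<le> \<delta>" and s: "0 < s"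
  shows "hausdorff_premeasure X d s \<delta> A \<le> ennreal (\<Sum>i\<in>W. B i powr s)"
proof -
  obtain h where h: "bij_betw h {0..<card W} W" using ex_bij_betw_nat_finite[OF W] by blast
  define U where "U m = (if m < card W then F (h m) else {})" for m
  have hW: "h m \<in> W" if "m < card W" for m using h that by (auto simp: bij_betw_def)
  have U: "U m \<subseteq> X \<and> ediam d (U m) \<le> ennreal \<delta>" for m
    using FX[OF hW] order_trans[OF ediam_le[OF B[OF hW]] ennreal_leI[OF B0(2)[OF hW]]]
    by (auto simp: U_def)
  have "A \<subseteq> (\<Union>m. U m)"
  proof
    fix x assume "x \<in> A"
    then obtain i where "i \<in> W" "x \<in> F i" using cover by auto
    moreover have "i \<in> h ` {0..<card W}" using \<open>i \<in> W\<close> h by (simp add: bij_betw_def)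
    then obtain m where "m < card W" "h m = i" by auto
    ultimately show "x \<in> (\<Union>m. U m)" by (auto simp: U_def intro!: exI[of _ m])
  qed
  then have "hausdorff_premeasure X d s \<delta> A \<le> (\<Sum>m. ennreal (enn2real (ediam d (U m)) powr s))"
    unfolding hausdorff_premeasure_def using U by (intro Inf_lower) blast
  also have "\<dots> = (\<Sum>m\<in>{0..<card W}. ennreal (enn2real (ediam d (U m)) powr s))"
    by (intro suminf_finite) (auto simp: U_def)
  also have "\<dots> \<le> (\<Sum>m\<in>{0..<card W}. ennreal (B (h m) powr s))"
  proof (intro sum_mono ennreal_leI powr_mono2)
    fix m assume "m \<in> {0..<card W}"
    then have "m < card W" by simp
    then show "enn2real (ediam d (U m)) \<le> B (h m)"
      using ediam_le[OF B[OF hW]] B0(1)[OF hW] by (auto simp: U_def intro!: enn2real_leI)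
  qed (use s in auto)
  also have "\<dots> = (\<Sum>i\<in>W. ennreal (B i powr s))"
    by (rule sum.reindex_bij_betw[OF h])
  finally show ?thesis by (simp add: sum_ennreal)
qed

text \<open>The measure is a supremum over scales, so the scale 1 suffices; diameters of at most 1
  make the sum grow when the exponent drops from s to \<open>s'\<close>.\<close>

lemma hausdorff_measure_nonzero:
  assumes c: "0 < c" and s: "0 < s'" "s' \<le> s"
    and cover: "\<And>U :: nat \<Rightarrow> 'a set. X \<subseteq> (\<Union>n. U n) \<Longrightarrow> (\<And>n. U n \<subseteq> X \<and> ediam d (U n) \<le> 1) \<Longrightarrow>
      ennreal c \<le> (\<Sum>n. ennreal (enn2real (ediam d (U n)) powr s))"
  shows "hausdorff_measure X d s' X \<noteq> 0"
proof -
  have "ennreal c \<le> hausdorff_premeasure X d s' 1 X"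
    unfolding hausdorff_premeasure_def
  proof (rule Inf_greatest, clarify)
    fix U :: "nat \<Rightarrow> 'a set"
    assume U: "X \<subseteq> (\<Union>n. U n)" "\<forall>n. U n \<subseteq> X \<and> ediam d (U n) \<le> ennreal 1"
    then have "ennreal c \<le> (\<Sum>n. ennreal (enn2real (ediam d (U n)) powr s))"
      by (intro cover) auto
    also have "\<dots> \<le> (\<Sum>n. ennreal (enn2real (ediam d (U n)) powr s'))"
    proof (intro suminf_le ennreal_leI summableI)
      fix n
      have "enn2real (ediam d (U n)) \<le> 1" using U(2) by (auto intro!: enn2real_leI)
      then show "enn2real (ediam d (U n)) powr s \<le> enn2real (ediam d (U n)) powr s'"
        using s by (cases "enn2real (ediam d (U n)) = 0") (auto intro!: powr_mono' simp: less_le)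
    qed
    finally show "ennreal c \<le> (\<Sum>n. ennreal (enn2real (ediam d (U n)) powr s'))" .
  qed
  also have "\<dots> \<le> hausdorff_measure X d s' X"
    unfolding hausdorff_measure_def by (intro SUP_upper) auto
  finally show ?thesis using c by (metis ennreal_eq_0_iff leD le_zero_eq)
qed

lemma hausdorff_dim_eqI:
  assumes "0 < \<alpha>" "\<And>e. 0 < e \<Longrightarrow> \<exists>s>0. s \<le> \<alpha> + e \<and> hausdorff_measure X d s X = 0"
    "\<And>s. 0 < s \<Longrightarrow> s < \<alpha> \<Longrightarrow> hausdorff_measure X d s X \<noteq> 0"
  shows "hausdorff_dim X d = ereal \<alpha>"
  unfolding hausdorff_dim_def
proof (rule antisym)
  show "Inf {ereal s | s. 0 < s \<and> hausdorff_measure X d s X = 0} \<le> ereal \<alpha>"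
  proof (rule ereal_le_epsilon2)
    fix e :: real assume "0 < e"
    then obtain s where s: "0 < s" "s \<le> \<alpha> + e" "hausdorff_measure X d s X = 0" using assms(2) by blast
    then have "Inf {ereal s | s. 0 < s \<and> hausdorff_measure X d s X = 0} \<le> ereal s" by (intro Inf_lower) auto
    also have "\<dots> \<le> ereal (\<alpha> + e)" using s by simp
    finally show "Inf {ereal s | s. 0 < s \<and> hausdorff_measure X d s X = 0} \<le> ereal \<alpha> + ereal e"
      by simp
  qed
  show "ereal \<alpha> \<le> Inf {ereal s | s. 0 < s \<and> hausdorff_measure X d s X = 0}"
    using assms(3) by (intro Inf_greatest) (auto simp: not_less[symmetric])
qed

context resistance_form
begin

text \<open>\<open>G i\<close> collects the s-th powers of all edges below \<open>i\<close> with
  weights \<open>1 / r ^ k\<close>, so an edge k levels below \<open>i\<close> has length at most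
  \<open>G i powr (1 / s) * q ^ k\<close>. The geometric series bounds the diameter of the cell by
  \<open>B i\<close>, and the level sums of \<open>B i powr s\<close> tend to 0. Of the assumed rate
  \<open>r\<^sup>2\<close>, one factor pays for the weights and the other one for the convergence of
  the series in k.\<close>

lemma hausdorff_measure_0:
  assumes s: "0 < s" and r: "0 < r" "r < 1" and C: "\<And>m. (\<Sum>u\<in>words letters m. a u powr s) \<le> C * (r\<^sup>2) ^ m"
  shows "hausdorff_measure T res s T = 0"
proof -
  define q where "q = r powr (1 / s)"
  have q: "0 < q" "q < 1" using r s powr_less_mono2[of "1 / s" r 1] by (auto simp: q_def)
  define S where "S i k = (\<Sum>u\<in>words letters k. a (i @ u) powr s)" for i k
  define G where "G i = (\<Sum>k. S i k / r ^ k)" for i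
  define \<kappa> where "\<kappa> = (2 / (1 - q)) powr s"
  have S0: "0 \<le> S i k" for i k by (auto simp: S_def intro!: sum_nonneg)
  have S_sum: "(\<Sum>i\<in>words letters n. S i k) = (\<Sum>u\<in>words letters (n + k). a u powr s)" for n k
    by (simp add: S_def sum_words_add)
  have C0: "0 \<le> C" using C[of 0] by (simp add: order_trans[OF powr_ge_zero])
  have term_le: "(\<Sum>i\<in>words letters n. S i k / r ^ k) \<le> C * (r\<^sup>2) ^ n * r ^ k" for n k
  proof -
    have "(\<Sum>i\<in>words letters n. S i k / r ^ k) \<le> C * (r\<^sup>2) ^ (n + k) / r ^ k"
      unfolding sum_divide_distrib[symmetric] S_sum using C r by (intro divide_right_mono) auto
    also have "\<dots> = C * (r\<^sup>2) ^ n * r ^ k"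
      using r by (simp add: power_add power2_eq_square power_mult_distrib)
    finally show ?thesis .
  qed
  have summ_r: "summable (\<lambda>k. C * (r\<^sup>2) ^ n * r ^ k)" for n
    using r by (intro summable_mult summable_geometric) auto
  have summ: "summable (\<lambda>k. S i k / r ^ k)" if i: "i \<in> words letters n" for i n
  proof (rule summable_comparison_test'[OF summ_r[of n], of 0])
    fix k
    have "S i k / r ^ k \<le> (\<Sum>i\<in>words letters n. S i k / r ^ k)"
      using S0 r i by (intro member_le_sum) auto
    then show "norm (S i k / r ^ k) \<le> C * (r\<^sup>2) ^ n * r ^ k" using term_le[of k n] S0 r by simp
  qed
  have G0: "0 \<le> G i" if "i \<in> words letters n" for i n
    unfolding G_def using summ[OF that] S0 r by (intro suminf_nonneg) auto
  have G_sum: "(\<Sum>i\<in>words letters n. G i) \<le> C / (1 - r) * (r\<^sup>2) ^ n" for n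
  proof -
    have "(\<Sum>i\<in>words letters n. G i) = (\<Sum>k. \<Sum>i\<in>words letters n. S i k / r ^ k)"
      unfolding G_def using summ by (intro suminf_sum[symmetric])
    also have "\<dots> \<le> (\<Sum>k. C * (r\<^sup>2) ^ n * r ^ k)"
      by (intro suminf_le term_le summ_r summable_sum summ)
    also have "\<dots> = C / (1 - r) * (r\<^sup>2) ^ n"
      using r by (subst suminf_mult) (auto simp: suminf_geometric)
    finally show ?thesis .
  qed
  define B where "B i = 2 * (\<Sum>k. G i powr (1 / s) * q ^ k)" for i
  have B_eq: "B i = 2 * (G i powr (1 / s) / (1 - q))" for i
    unfolding B_def using q by (subst suminf_mult) (auto simp: suminf_geometric)
  have B_pow: "B i powr s = \<kappa> * G i" if "i \<in> words letters n" for i n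
  proof -
    have "B i powr s = ((2 / (1 - q)) * G i powr (1 / s)) powr s" by (simp add: B_eq)
    also have "\<dots> = \<kappa> * (G i powr (1 / s)) powr s" using q by (subst powr_mult) (auto simp: \<kappa>_def)
    finally show ?thesis using s G0[OF that] by (simp add: powr_powr)
  qed
  have B: "res x y \<le> B i" if i: "i \<in> words letters n" and xy: "x \<in> cell i" "y \<in> cell i" for i n x y
    unfolding B_def
  proof (rule res_cell_le[OF _ xy])
    show "i \<in> lists letters" using i wordsD by blast
    show "summable (\<lambda>k. G i powr (1 / s) * q ^ k)" using q by (intro summable_mult summable_geometric) auto
    fix u assume u: "u \<in> lists letters"
    define k where "k = length u"
    have uk: "u \<in> words letters k" using u lists_words by (simp add: k_def)
    have pos: "0 < a (i @ u)" using edge_lengths_pos[OF edge_lengths words_append[OF i uk]] .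
    have "a (i @ u) powr s \<le> S i k" unfolding S_def using uk by (intro member_le_sum) auto
    moreover have "S i k / r ^ k \<le> G i" unfolding G_def
      using sum_le_suminf[OF summ[OF i], of "{k}"] S0 r by simp
    ultimately have "a (i @ u) powr s \<le> G i * r ^ k" using r by (simp add: divide_le_eq)
    then have "(a (i @ u) powr s) powr (1 / s) \<le> (G i * r ^ k) powr (1 / s)"
      using s by (intro powr_mono2) auto
    also have "\<dots> = G i powr (1 / s) * q ^ k"
      using G0[OF i] r by (simp add: powr_mult q_def powr_realpow[symmetric] powr_powr mult.commute)
    finally show "a (i @ u) \<le> G i powr (1 / s) * q ^ length u" using pos s by (simp add: powr_powr k_def)
  qed
  have pre: "hausdorff_premeasure T res s \<delta> T \<le> ennreal e" if "0 < \<delta>" "0 < e" for \<delta> e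
  proof -
    have "(\<lambda>n. \<kappa> * (C / (1 - r)) * (r\<^sup>2) ^ n) \<longlonglongrightarrow> \<kappa> * (C / (1 - r)) * 0"
      using r by (intro tendsto_mult tendsto_const LIMSEQ_realpow_zero) (auto simp: abs_square_less_1)
    moreover have "0 < min e (\<delta> powr s)" using that by simp
    ultimately obtain n where n: "\<kappa> * (C / (1 - r)) * (r\<^sup>2) ^ n < min e (\<delta> powr s)"
      using order_tendstoD(2)[of "\<lambda>n. \<kappa> * (C / (1 - r)) * (r\<^sup>2) ^ n" "\<kappa> * (C / (1 - r)) * 0" sequentially "min e (\<delta> powr s)"]
      unfolding eventually_sequentially by auto
    have sumB: "(\<Sum>i\<in>words letters n. B i powr s) \<le> \<kappa> * (C / (1 - r)) * (r\<^sup>2) ^ n"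
    proof -
      have "(\<Sum>i\<in>words letters n. B i powr s) = \<kappa> * (\<Sum>i\<in>words letters n. G i)"
        unfolding sum_distrib_left by (intro sum.cong B_pow) auto
      also have "\<dots> \<le> \<kappa> * (C / (1 - r) * (r\<^sup>2) ^ n)"
        by (intro mult_left_mono G_sum) (simp add: \<kappa>_def)
      finally show ?thesis by (simp add: mult.assoc)
    qed
    have "B i \<le> \<delta>" if i: "i \<in> words letters n" for i
    proof -
      have "B i powr s \<le> (\<Sum>i\<in>words letters n. B i powr s)" using i by (intro member_le_sum) auto
      then have "B i powr s < \<delta> powr s" using sumB n by linarith
      then show ?thesis using \<open>0 < \<delta>\<close> s powr_mono2[of s \<delta> "B i"] by (meson le_cases less_imp_le not_less order_less_le_trans)
    qed
    then have "hausdorff_premeasure T res s \<delta> T \<le> ennreal (\<Sum>i\<in>words letters n. B i powr s)"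
      using B T_cells[of n] cell_subset wordsD(2) s q
      by (intro hausdorff_premeasure_le_finite_cover[where F = cell]) (auto simp: B_eq)
    also have "\<dots> \<le> ennreal e" using sumB n by (intro ennreal_leI) linarith
    finally show ?thesis .
  qed
  have "hausdorff_premeasure T res s \<delta> T = 0" if "0 < \<delta>" for \<delta>
  proof (rule antisym)
    show "hausdorff_premeasure T res s \<delta> T \<le> 0"
      by (rule ennreal_le_epsilon) (use pre[OF that] in simp)
  qed simp
  then show ?thesis unfolding hausdorff_measure_def
    by (auto intro!: antisym SUP_least)
qed

end

section \<open>Paths of positive weight\<close>

text \<open>If all three children failed, summing over them would contradict
  \<open>f i < \<mu> i\<close>; so the strict inequality passes to some child, letter by
  letter.\<close>

lemma superadditive_path:
  fixes f \<mu> :: "nat list \<Rightarrow> ennreal"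
  assumes f: "\<And>i. i \<in> lists letters \<Longrightarrow> (\<Sum>j\<in>letters. f (i @ [j])) \<le> f i"
    and \<mu>: "\<And>i. i \<in> lists letters \<Longrightarrow> \<mu> i \<le> (\<Sum>j\<in>letters. \<mu> (i @ [j]))"
    and less: "f [] < \<mu> []"
  obtains g where "\<And>n. g n \<in> letters" "\<And>n. f (map g [0..<n]) < \<mu> (map g [0..<n])"
proof -
  have "\<exists>j\<in>letters. f (i @ [j]) < \<mu> (i @ [j])" if "i \<in> lists letters" "f i < \<mu> i" for i
  proof (rule ccontr)
    assume "\<not> ?thesis"
    then have "(\<Sum>j\<in>letters. \<mu> (i @ [j])) \<le> (\<Sum>j\<in>letters. f (i @ [j]))"
      by (intro sum_mono) (auto simp: not_less)
    then have "\<mu> i \<le> f i" using f[OF that(1)] \<mu>[OF that(1)] by (meson order_trans)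
    with that show False by auto
  qed
  then obtain nxt where nxt: "\<And>i. i \<in> lists letters \<Longrightarrow> f i < \<mu> i \<Longrightarrow>
      nxt i \<in> letters \<and> f (i @ [nxt i]) < \<mu> (i @ [nxt i])"
    by metis
  define J where "J = rec_nat [] (\<lambda>_ i. i @ [nxt i])"
  have J: "J 0 = []" "\<And>n. J (Suc n) = J n @ [nxt (J n)]" by (auto simp: J_def)
  have inv: "J n \<in> lists letters \<and> f (J n) < \<mu> (J n)" for n
    by (induction n) (use less nxt in \<open>auto simp: J\<close>)
  have path: "map (\<lambda>n. nxt (J n)) [0..<n] = J n" for n
    by (induction n) (auto simp: J)
  show ?thesis
    using that[of "\<lambda>n. nxt (J n)"] inv nxt unfolding path by blast
qed

definition extends :: "nat list \<Rightarrow> nat list \<Rightarrow> bool" where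
  "extends x i \<longleftrightarrow> take (length i) x = i"

lemma extends_self [simp]: "extends i i" "extends i []"
  by (auto simp: extends_def)

text \<open>A mass m at the word \<open>x\<close> is counted at every prefix of \<open>x\<close>,
  and at most one child of a prefix is again a prefix.\<close>

lemma extends_superadditive:
  "(\<Sum>j\<in>letters. if extends x (i @ [j]) then m else 0) \<le> (if extends x i then m else (0 :: ennreal))"
proof (cases "extends x i")
  case True
  have unique: "j = x ! length i" if "extends x (i @ [j])" for j
    using that unfolding extends_def
    by (metis length_append_singleton lessI nth_append_length nth_take)
  have "(\<Sum>j\<in>letters. if extends x (i @ [j]) then m else 0) \<le> (\<Sum>j\<in>letters. if j = x ! length i then m else 0)"
  proof (rule sum_mono)
    fix j show "(if extends x (i @ [j]) then m else 0) \<le> (if j = x ! length i then m else 0)"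
      using unique[of j] by (cases "extends x (i @ [j])") simp_all
  qed
  also have "\<dots> \<le> m" by simp
  finally show ?thesis using True by simp
next
  case False
  have "take (length i) x = i" if "take (Suc (length i)) x = i @ [j]" for j
    using arg_cong[OF that, of "take (length i)"] by (simp add: min_def)
  then show ?thesis using False by (auto simp: extends_def)
qed

lemma powr_of_power: "0 < x \<Longrightarrow> (x ^ k) powr y = (x powr y) ^ k" for x :: real
  by (simp add: powr_realpow[symmetric] powr_powr mult.commute)

lemma suminf_term_le: "f k \<le> suminf f" for f :: "nat \<Rightarrow> ennreal"
  using sum_le_suminf[of f "{k}"] by simp

text \<open>
  The discarded words \<open>w @ u\<close> of level \<open>k\<close>: here \<open>w\<close> has length \<open>L * k\<close>, and \<open>d ^ k\<close> is the
  tolerated deviation from typical size. With \<open>u = []\<close> the cell \<open>w\<close> itself is discarded.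
\<close>

definition bad :: "(nat list \<Rightarrow> real) \<Rightarrow> (nat list \<Rightarrow> real) \<Rightarrow> (nat list \<Rightarrow> real) \<Rightarrow> real \<Rightarrow> real \<Rightarrow> nat \<Rightarrow> nat \<Rightarrow> nat list \<Rightarrow> nat list \<Rightarrow> bool" where
  "bad a l \<mu> \<alpha> d L k w u \<longleftrightarrow>
     u = [] \<and> (l w powr \<alpha> / d ^ k < \<mu> w \<or> a (w @ replicate k 2) < l w * d ^ k \<or> a (w @ 1 # replicate k 2) < l w * d ^ k) \<or>
     u = replicate k 2 \<or> u = 1 # replicate k 2 \<or> u \<in> words letters L \<and> l (w @ u) < l w * d ^ k"

lemma finite_bad: "finite {u. bad a l \<mu> \<alpha> d L k w u}"
proof (rule finite_subset)
  show "{u. bad a l \<mu> \<alpha> d L k w u} \<subseteq> {[], replicate k 2, 1 # replicate k 2} \<union> words letters L"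
    by (auto simp: bad_def)
qed auto

lemma bad_letters: "bad a l \<mu> \<alpha> d L k w u \<Longrightarrow> u \<in> lists letters"
  by (auto simp: bad_def words_def in_lists_conv_set letters_def)

context resistance_form
begin

text \<open>Suppose that a cover has a small sum. A covering set that meets only one cell of some
  level, of mass at most \<open>C * R n\<close>, charges such a cell \<open>h n\<close>
  (\<open>f\<^sub>1\<close>), and the discarded words from \<open>k\<^sub>0\<close> on charge
  themselves (\<open>f\<^sub>2\<close>). The total charge is less than the mass, so some infinite
  path stays undercharged. Its point lies in a covering set, and the path cell at the scale of that
  set shows that the set does charge a cell. This cell must lie on the path, where the charge is
  then at least the mass: a contradiction.\<close>

lemma hausdorff_measure_lower:
  fixes l \<mu> :: "nat list \<Rightarrow> real" and C\<^sub>0 \<eta> \<alpha> s d :: real and L :: nat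
  assumes l: "\<And>i. i \<in> lists letters \<Longrightarrow> 0 < l i" "\<And>i. i \<in> lists letters \<Longrightarrow> l i \<le> C\<^sub>0 * \<eta> ^ length i"
    and \<mu>: "\<And>i. i \<in> lists letters \<Longrightarrow> 0 \<le> \<mu> i" "\<And>i. i \<in> lists letters \<Longrightarrow> \<mu> i = (\<Sum>j\<in>letters. \<mu> (i @ [j]))" "0 < \<mu> []"
    and \<eta>: "0 < \<eta>" "\<eta> < 1" and d: "0 < d" "d < 1" and s: "0 < s" "s < \<alpha>"
    and L: "0 < L" "(\<eta> ^ L) powr (\<alpha> - s) \<le> d powr (2 * \<alpha> + 1)"
    and bad: "summable (\<lambda>k. \<Sum>w\<in>words letters (L * k). \<Sum>u | bad a l \<mu> \<alpha> d L k w u. \<mu> (w @ u))"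
    and s': "0 < s'" "s' \<le> s"
  shows "hausdorff_measure T res s' T \<noteq> 0"
proof -
  let ?bad = "bad a l \<mu> \<alpha> d L"
  define tot where "tot k = (\<Sum>w\<in>words letters (L * k). \<Sum>u | ?bad k w u. \<mu> (w @ u))" for k
  have tot0: "0 \<le> tot k" for k
    unfolding tot_def using \<mu>(1) wordsD(2) bad_letters by (intro sum_nonneg) auto
  have summ: "summable tot" using bad by (simp add: tot_def[abs_def])
  obtain k\<^sub>0 where k0: "(\<Sum>k. tot (k + k\<^sub>0)) < \<mu> [] / 2"
    using suminf_exist_split[OF _ summ, of "\<mu> [] / 2"] \<mu>(3) unfolding real_norm_def
    by (meson abs_le_D1 half_gt_zero order_refl le_less_trans)
  \<comment> \<open>Radii below this value are compared with separations only from index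
    \<open>k\<^sub>0\<close> on; it is positive as a minimum over finitely many words.\<close>
  define thr where "thr = Min ((\<lambda>w. l w * d ^ k\<^sub>0) ` words letters (L * k\<^sub>0))"
  have words_ne: "words letters n \<noteq> {}" for n
    by (auto simp: words_def letters_def in_lists_conv_set intro!: exI[of _ "replicate n 1"])
  have thr: "0 < thr" unfolding thr_def using words_ne l(1) d wordsD(2)
    by (subst Min_gr_iff) auto
  have thr_le: "thr \<le> l w * d ^ k\<^sub>0" if "w \<in> words letters (L * k\<^sub>0)" for w
    unfolding thr_def using that by (intro Min_le) auto
  have C0: "0 < C\<^sub>0" using l[of "[]"] by simp
  define C where "C = C\<^sub>0 powr (\<alpha> - s) / d powr \<alpha>"
  have C: "0 < C" using C0 d by (simp add: C_def)
  \<comment> \<open>The first bound puts all radii below \<open>thr\<close>, the second one keeps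
    the total charge of the cover at no more than half of the mass.\<close>
  define e where "e = min (thr powr s / 2) (\<mu> [] / (4 * C))"
  have e: "0 < e" "2 * e \<le> thr powr s" "C * (2 * e) \<le> \<mu> [] / 2"
    using thr \<mu>(3) C by (auto simp: e_def min_def field_simps)
  show ?thesis
  proof (rule hausdorff_measure_nonzero[OF e(1) s'])
    fix U :: "nat \<Rightarrow> (real \<times> real) set"
    assume cover: "T \<subseteq> (\<Union>n. U n)" and U: "\<And>n. U n \<subseteq> T \<and> ediam res (U n) \<le> 1"
    define \<Delta> where "\<Delta> n = enn2real (ediam res (U n))" for n
    have \<Delta>: "res x y \<le> \<Delta> n" if "x \<in> U n" "y \<in> U n" for x y n
    proof -
      have "ennreal (res x y) \<le> ediam res (U n)" using that by (rule ediam_ge)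
      also have "\<dots> = ennreal (\<Delta> n)" unfolding \<Delta>_def
        using U[of n] by (subst ennreal_enn2real) (auto simp: less_top[symmetric] top_unique)
      finally show ?thesis by (simp add: \<Delta>_def)
    qed
    show "ennreal e \<le> (\<Sum>n. ennreal (enn2real (ediam res (U n)) powr s))"
    proof (rule ccontr)
      assume "\<not> ?thesis"
      then have small: "(\<Sum>n. ennreal (\<Delta> n powr s)) < ennreal e" by (simp add: \<Delta>_def)
      \<comment> \<open>The added term makes \<open>R n\<close> positive and the radius
        \<open>r n\<close> strictly larger than the diameter; over all n it adds up to
        \<open>e\<close>.\<close>
      define R where "R n = \<Delta> n powr s + e * (1 / 2) ^ Suc n" for n
      define r where "r n = R n powr (1 / s)" for n
      have R: "0 < R n" for n using e by (auto simp: R_def intro!: add_nonneg_pos)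
      have r: "0 < r n" "r n powr s = R n" for n
        using R[of n] s by (auto simp: r_def powr_powr)
      have "\<Delta> n < r n" for n
      proof -
        have "\<Delta> n powr s < r n powr s" using e by (simp add: r R_def)
        then show ?thesis using r(1)[of n] s powr_mono2[of s "r n" "\<Delta> n"] by (meson less_imp_le not_less)
      qed
      have Rsum: "(\<Sum>n. ennreal (R n)) \<le> ennreal (2 * e)"
      proof -
        have "(\<Sum>n. ennreal (R n)) = (\<Sum>n. ennreal (\<Delta> n powr s) + ennreal (e * (1 / 2) ^ Suc n))"
          unfolding R_def using e by (intro suminf_cong ennreal_plus) auto
        also have "\<dots> = (\<Sum>n. ennreal (\<Delta> n powr s)) + (\<Sum>n. ennreal (e * (1 / 2) ^ Suc n))"
          by (rule suminf_add[symmetric]) auto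
        also have "(\<Sum>n. ennreal (e * (1 / 2) ^ Suc n)) = ennreal (e * 1)"
          using e by (intro suminf_ennreal_eq sums_mult power_half_series) auto
        finally have "(\<Sum>n. ennreal (R n)) \<le> ennreal e + ennreal e"
          using small by (simp add: add_right_mono)
        then show ?thesis using e by (simp flip: ennreal_plus)
      qed
      have r_thr: "r n < thr" for n
      proof -
        have "ennreal (\<Delta> n powr s) < ennreal e" using suminf_term_le[of "\<lambda>n. ennreal (\<Delta> n powr s)" n] small by simp
        then have "\<Delta> n powr s < e" by (simp add: ennreal_less_iff)
        moreover have "e * (1 / 2) ^ Suc n \<le> e * 1" using e by (intro mult_left_mono power_le_one) auto
        ultimately have "r n powr s < thr powr s" using e unfolding r R_def by linarith
        then show ?thesis using thr s powr_mono2[of s thr "r n"] by (meson less_imp_le not_less)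
      qed
      define G where "G n i \<longleftrightarrow> i \<in> lists letters \<and> \<mu> i \<le> C * R n \<and>
        (\<forall>j\<in>lists letters. length j = length i \<longrightarrow> j \<noteq> i \<longrightarrow> U n \<inter> cell j = {})" for n i
      \<comment> \<open>Any such cell will do: that it lies on the path is deduced at the end from
        the last clause of \<open>G\<close>.\<close>
      define h where "h n = (SOME i. G n i)" for n
      define m where "m n = (if \<exists>i. G n i then ennreal (\<mu> (h n)) else 0)" for n
      have hG: "G n (h n)" if "G n i" for n i unfolding h_def using that by (rule someI)
      define f\<^sub>1 where "f\<^sub>1 i = (\<Sum>n. if extends (h n) i then m n else 0)" for i
      define f\<^sub>2 where "f\<^sub>2 i = (\<Sum>k. \<Sum>w\<in>words letters (L * (k + k\<^sub>0)). \<Sum>u | ?bad (k + k\<^sub>0) w u.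
        if extends (w @ u) i then ennreal (\<mu> (w @ u)) else 0)" for i
      have "(\<Sum>j\<in>letters. f\<^sub>1 (i @ [j]) + f\<^sub>2 (i @ [j])) \<le> f\<^sub>1 i + f\<^sub>2 i" if "i \<in> lists letters" for i
      proof -
        have "(\<Sum>j\<in>letters. f\<^sub>1 (i @ [j])) = (\<Sum>n. \<Sum>j\<in>letters. if extends (h n) (i @ [j]) then m n else 0)"
          unfolding f\<^sub>1_def by (intro suminf_sum[symmetric]) auto
        also have "\<dots> \<le> f\<^sub>1 i" unfolding f\<^sub>1_def by (intro suminf_le extends_superadditive) auto
        finally have 1: "(\<Sum>j\<in>letters. f\<^sub>1 (i @ [j])) \<le> f\<^sub>1 i" .
        have "(\<Sum>j\<in>letters. f\<^sub>2 (i @ [j])) = (\<Sum>k. \<Sum>j\<in>letters. \<Sum>w\<in>words letters (L * (k + k\<^sub>0)). \<Sum>u | ?bad (k + k\<^sub>0) w u.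
          if extends (w @ u) (i @ [j]) then ennreal (\<mu> (w @ u)) else 0)"
          unfolding f\<^sub>2_def by (intro suminf_sum[symmetric]) auto
        also have "\<dots> = (\<Sum>k. \<Sum>w\<in>words letters (L * (k + k\<^sub>0)). \<Sum>u | ?bad (k + k\<^sub>0) w u. \<Sum>j\<in>letters.
          if extends (w @ u) (i @ [j]) then ennreal (\<mu> (w @ u)) else 0)"
          by (intro suminf_cong) (simp only: sum.swap[of _ _ letters])
        also have "\<dots> \<le> f\<^sub>2 i" unfolding f\<^sub>2_def by (intro suminf_le sum_mono extends_superadditive) auto
        finally show ?thesis using 1 by (simp add: sum.distrib add_mono)
      qed
      moreover have "ennreal (\<mu> i) \<le> (\<Sum>j\<in>letters. ennreal (\<mu> (i @ [j])))" if "i \<in> lists letters" for i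
        using \<mu>(1)[of "i @ [_]"] \<mu>(2)[OF that] that by (simp add: sum_ennreal)
      moreover have "f\<^sub>1 [] + f\<^sub>2 [] < ennreal (\<mu> [])"
      proof -
        have "f\<^sub>1 [] \<le> (\<Sum>n. ennreal C * ennreal (R n))"
          unfolding f\<^sub>1_def using hG C by (intro suminf_le) (auto simp: m_def G_def ennreal_mult[symmetric] R less_imp_le ennreal_leI)
        also have "\<dots> \<le> ennreal C * ennreal (2 * e)" using Rsum by (simp add: mult_left_mono)
        also have "\<dots> \<le> ennreal (\<mu> [] / 2)" using C e by (simp add: ennreal_mult[symmetric] ennreal_leI)
        finally have 1: "f\<^sub>1 [] \<le> ennreal (\<mu> [] / 2)" .
        have "f\<^sub>2 [] = (\<Sum>k. ennreal (tot (k + k\<^sub>0)))"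
        proof -
          have pos: "0 \<le> \<mu> (w @ u)" if "w \<in> words letters n" "u \<in> {u. ?bad k w u}" for w u n k
            using that wordsD(2) bad_letters by (intro \<mu>(1)) auto
          have "(\<Sum>w\<in>words letters (L * k). \<Sum>u | ?bad k w u. ennreal (\<mu> (w @ u)))
            = (\<Sum>w\<in>words letters (L * k). ennreal (\<Sum>u | ?bad k w u. \<mu> (w @ u)))" for k
            using pos by (intro sum.cong refl sum_ennreal)
          also have "\<dots> k = ennreal (tot k)" for k
            unfolding tot_def using pos by (intro sum_ennreal sum_nonneg)
          finally show ?thesis unfolding f\<^sub>2_def by simp
        qed
        also have "\<dots> = ennreal (\<Sum>k. tot (k + k\<^sub>0))"
          using summ tot0 by (intro suminf_ennreal2) (auto simp: summable_iff_shift)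
        also have "\<dots> < ennreal (\<mu> [] / 2)" using k0 \<mu>(3) by (intro ennreal_lessI) auto
        finally have 2: "f\<^sub>2 [] < ennreal (\<mu> [] / 2)" .
        have "f\<^sub>1 [] + f\<^sub>2 [] \<le> ennreal (\<mu> [] / 2) + f\<^sub>2 []" using 1 by (rule add_right_mono)
        also have "\<dots> < ennreal (\<mu> [] / 2) + ennreal (\<mu> [] / 2)"
          using 2 by (simp add: ennreal_add_left_cancel_less)
        finally have "f\<^sub>1 [] + f\<^sub>2 [] < ennreal (\<mu> [] / 2) + ennreal (\<mu> [] / 2)" .
        then show ?thesis using \<mu>(3) by (simp flip: ennreal_plus)
      qed
      ultimately obtain g where g: "\<And>n. g n \<in> letters"
        "\<And>n. f\<^sub>1 (map g [0..<n]) + f\<^sub>2 (map g [0..<n]) < ennreal (\<mu> (map g [0..<n]))"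
        using superadditive_path[of "\<lambda>i. f\<^sub>1 i + f\<^sub>2 i" "\<lambda>i. ennreal (\<mu> i)"] by blast
      define W where "W n = map g [0..<n]" for n
      have Wl: "W n \<in> words letters n" for n using g(1) by (auto simp: W_def words_def in_lists_conv_set)
      have Wl': "W n \<in> lists letters" for n using Wl wordsD by blast
      have W_add: "W (n + k) = W n @ map g [n..<n + k]" for n k
        unfolding W_def upt_add_eq_append[OF le0] map_append ..
      have f1: "f\<^sub>1 (W n) < ennreal (\<mu> (W n))" for n
        using le_less_trans[OF add_increasing2[OF zero_le order_refl] g(2)[of n]] unfolding W_def .
      have f2: "f\<^sub>2 (W n) < ennreal (\<mu> (W n))" for n
        using le_less_trans[OF add_increasing[OF zero_le order_refl] g(2)[of n]] unfolding W_def .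
      \<comment> \<open>No discarded word lies on the path, since its own charge would make
        \<open>f\<^sub>2\<close> at least its mass.\<close>
      have good: "W (L * k + length u) \<noteq> W (L * k) @ u" if k: "k\<^sub>0 \<le> k" and u: "?bad k (W (L * k)) u" for k u
      proof
        assume eq: "W (L * k + length u) = W (L * k) @ u"
        let ?t = "\<lambda>w x. if extends (w @ x) (W (L * k) @ u) then ennreal (\<mu> (w @ x)) else 0"
        have "ennreal (\<mu> (W (L * k) @ u)) = ?t (W (L * k)) u" by simp
        also have "\<dots> \<le> (\<Sum>x | ?bad k (W (L * k)) x. ?t (W (L * k)) x)"
          by (rule member_le_sum[of u "{x. ?bad k (W (L * k)) x}" "?t (W (L * k))"]) (use u finite_bad in auto)
        also have "\<dots> \<le> (\<Sum>w\<in>words letters (L * k). \<Sum>x | ?bad k w x. ?t w x)"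
          by (rule member_le_sum[of "W (L * k)" "words letters (L * k)" "\<lambda>w. \<Sum>x | ?bad k w x. ?t w x"]) (use Wl in auto)
        also have "\<dots> \<le> f\<^sub>2 (W (L * k) @ u)"
          unfolding f\<^sub>2_def using k by (intro order_trans[OF _ suminf_term_le[of _ "k - k\<^sub>0"]]) simp
        finally show False using f2[of "L * k + length u"] eq by simp
      qed
      obtain x where x: "\<And>n. x \<in> cell (W n)"
        by (rule path_point[of g]) (use g(1) in \<open>auto simp: W_def\<close>)
      then have "x \<in> T" using cell_subset[OF Wl'[of 0]] x[of 0] by blast
      then obtain n where n: "x \<in> U n" using cover by auto
      \<comment> \<open>The distance from the point x to the other cells of length
        \<open>L * k\<close> that \<open>res_separation\<close> guarantees once nothing is
        discarded.\<close>
      define \<rho> where "\<rho> k = l (W (L * k)) * d ^ k" for k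
      have \<rho>0: "\<rho> k\<^sub>0 > r n" using thr_le[OF Wl] r_thr[of n] by (simp add: \<rho>_def)
      have l_le: "l (W (L * k)) \<le> C\<^sub>0 * (\<eta> ^ L) ^ k" for k
        using l(2)[OF Wl', of "L * k"] wordsD(1)[OF Wl] by (simp add: power_mult)
      have "\<exists>k\<ge>k\<^sub>0. \<rho> k \<le> r n"
      proof -
        have "(\<lambda>k. C\<^sub>0 * (\<eta> ^ L) ^ k) \<longlonglongrightarrow> C\<^sub>0 * 0"
          using \<eta> L by (intro tendsto_mult tendsto_const LIMSEQ_realpow_zero) (auto simp: power_less_one_iff)
        then have "\<forall>\<^sub>F k in sequentially. C\<^sub>0 * (\<eta> ^ L) ^ k < r n"
          using order_tendstoD(2) r(1)[of n] by fastforce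
        then have "\<forall>\<^sub>F k in sequentially. C\<^sub>0 * (\<eta> ^ L) ^ k < r n \<and> k\<^sub>0 \<le> k"
          using eventually_ge_at_top by (rule eventually_conj)
        then obtain k where k: "C\<^sub>0 * (\<eta> ^ L) ^ k < r n" "k\<^sub>0 \<le> k"
          using eventually_happens'[OF sequentially_bot] by blast
        have "\<rho> k \<le> l (W (L * k)) * 1" unfolding \<rho>_def
          using d l(1)[OF Wl', of "L * k"] by (intro mult_left_mono power_le_one) auto
        then show ?thesis using l_le[of k] k by (intro exI[of _ k]) (linarith | simp)+
      qed
      \<comment> \<open>The stopping index: here the guaranteed separation crosses the radius of the
        covering set.\<close>
      have ex: "\<exists>k. k\<^sub>0 \<le> k \<and> r n < \<rho> k \<and> \<rho> (Suc k) \<le> r n"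
      proof (rule ccontr)
        assume neg: "\<not> ?thesis"
        have "r n < \<rho> (k\<^sub>0 + j)" for j
          by (induction j) (use \<rho>0 neg in \<open>auto simp: not_le\<close>)
        then show False using \<open>\<exists>k\<ge>k\<^sub>0. \<rho> k \<le> r n\<close> by (metis le_add_diff_inverse not_le)
      qed
      then obtain k where k: "k\<^sub>0 \<le> k" "r n < \<rho> k" "\<rho> (Suc k) \<le> r n" by blast
      define w where "w = W (L * k)"
      have w: "w \<in> lists letters" "length w = L * k" using Wl'[of "L * k"] by (auto simp: w_def W_def)
      have nb: "\<not> ?bad k w []" using good[OF k(1), of "[]"] by (auto simp: w_def)
      then have w1: "\<mu> w \<le> l w powr \<alpha> / d ^ k" "l w * d ^ k \<le> a (w @ replicate k 2)"
        "l w * d ^ k \<le> a (w @ 1 # replicate k 2)" by (auto simp: bad_def not_less)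
      have ext: "map g [L * k..<L * k + n] \<noteq> u" if "?bad k w u" "length u = n" for u n
        using good[OF k(1), of u] that W_add[of "L * k" n] by (auto simp: w_def)
      have step: "l w * d ^ k \<le> l (W (L * Suc k))"
      proof -
        let ?u = "map g [L * k..<L * k + L]"
        have "W (L * Suc k) = w @ ?u" using W_add[of "L * k" L] by (simp add: w_def add.commute)
        moreover have "?u \<in> words letters L" using g(1) by (auto simp: words_def in_lists_conv_set)
        ultimately show ?thesis using ext[of ?u L] unfolding bad_def by fastforce
      qed
      \<comment> \<open>A factor \<open>d ^ k\<close> is lost over the \<open>L\<close> letters
        after w, and \<open>d ^ Suc k\<close> comes from the definition of
        \<open>\<rho> (Suc k)\<close>.\<close>
      have "l w * d ^ (2 * k + 1) \<le> r n"
      proof -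
        have "l w * d ^ (2 * k + 1) = l w * d ^ k * d ^ Suc k" by (simp add: power_add[symmetric] mult_2)
        also have "\<dots> \<le> \<rho> (Suc k)" unfolding \<rho>_def using step d by (intro mult_right_mono) auto
        finally show ?thesis using k by simp
      qed
      then have lw: "l w \<le> r n / d ^ (2 * k + 1)" using d by (simp add: pos_le_divide_eq)
      have rs: "r n powr (\<alpha> - s) \<le> C\<^sub>0 powr (\<alpha> - s) * (d ^ k) powr (2 * \<alpha> + 1)"
      proof -
        have "\<rho> k \<le> l w * 1" unfolding \<rho>_def w_def
          using d l(1)[OF Wl', of "L * k"] by (intro mult_left_mono power_le_one) auto
        then have "r n \<le> C\<^sub>0 * (\<eta> ^ L) ^ k" using k(2) l_le[of k] by (simp add: w_def)
        then have "r n powr (\<alpha> - s) \<le> (C\<^sub>0 * (\<eta> ^ L) ^ k) powr (\<alpha> - s)"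
          using r(1)[of n] s by (intro powr_mono2) auto
        also have "\<dots> = C\<^sub>0 powr (\<alpha> - s) * ((\<eta> ^ L) powr (\<alpha> - s)) ^ k"
          using C0 \<eta> powr_of_power[of "\<eta> ^ L" k] by (simp add: powr_mult)
        also have "\<dots> \<le> C\<^sub>0 powr (\<alpha> - s) * (d powr (2 * \<alpha> + 1)) ^ k"
          using L by (intro mult_left_mono power_mono) auto
        also have "(d powr (2 * \<alpha> + 1)) ^ k = (d ^ k) powr (2 * \<alpha> + 1)" using d by (simp add: powr_of_power)
        finally show ?thesis .
      qed
      \<comment> \<open>In total \<open>d\<close> enters with the exponent
        \<open>(2 * k + 1) * \<alpha> + k\<close>. Apart from \<open>d powr \<alpha>\<close>, which
        is part of \<open>C\<close>, this is \<open>k * (2 * \<alpha> + 1)\<close>, and the choice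
        of \<open>L\<close> compensates for it through \<open>rs\<close>.\<close>
      have "\<mu> w \<le> C * R n"
      proof -
        have "\<mu> w \<le> (r n / d ^ (2 * k + 1)) powr \<alpha> / d ^ k"
          using w1(1) lw l(1)[OF w(1)] s d
          by (intro order_trans[OF w1(1)] divide_right_mono powr_mono2) auto
        also have "\<dots> = r n powr s * (r n powr (\<alpha> - s)) / (d powr \<alpha> * (d ^ k) powr (2 * \<alpha> + 1))"
        proof -
          have "(d ^ (2 * k + 1)) powr \<alpha> = d powr \<alpha> * (d ^ k) powr (2 * \<alpha>)"
          proof -
            have "d ^ (2 * k + 1) = d * (d ^ k * d ^ k)" by (simp add: power_add mult_2)
            moreover have "(d ^ k) powr (2 * \<alpha>) = (d ^ k) powr \<alpha> * (d ^ k) powr \<alpha>"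
              using powr_add[of "d ^ k" \<alpha> \<alpha>] by (simp only: mult_2)
            ultimately show ?thesis using d by (simp add: powr_mult)
          qed
          moreover have "(d ^ k) powr (2 * \<alpha> + 1) = (d ^ k) powr (2 * \<alpha>) * d ^ k"
            using d by (simp add: powr_add)
          ultimately show ?thesis using r(1)[of n] d by (simp add: powr_divide powr_add[symmetric] mult.assoc)
        qed
        also have "\<dots> \<le> r n powr s * (C\<^sub>0 powr (\<alpha> - s) * (d ^ k) powr (2 * \<alpha> + 1)) / (d powr \<alpha> * (d ^ k) powr (2 * \<alpha> + 1))"
          using rs d by (intro divide_right_mono mult_left_mono) auto
        also have "\<dots> = C * R n" using d r(2)[of n] by (simp add: C_def)
        finally show ?thesis .
      qed
      moreover have "U n \<inter> cell j = {}" if j: "j \<in> lists letters" "length j = length w" "j \<noteq> w" for j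
      proof (rule ccontr)
        assume "U n \<inter> cell j \<noteq> {}"
        then obtain y where y: "y \<in> U n" "y \<in> cell j" by auto
        let ?u = "map g [L * k..<L * k + Suc k]"
        have u: "?u \<in> words letters (Suc k)" using g(1) by (auto simp: words_def in_lists_conv_set)
        have tk: "take k ?u = map g [L * k..<L * k + k]" by (simp add: take_map)
        have "take k ?u \<noteq> replicate k 2" unfolding tk by (rule ext) (auto simp: bad_def)
        moreover have "?u \<noteq> 1 # replicate k 2" by (rule ext) (auto simp: bad_def)
        moreover have "x \<in> cell (w @ ?u)" using x[of "L * k + Suc k"] W_add[of "L * k" "Suc k"] by (simp add: w_def)
        ultimately have "min (a (w @ replicate k 2)) (a (w @ 1 # replicate k 2)) \<le> res x y"
          using res_separation[OF w(1) u _ _ j] y(2) by blast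
        then have "\<rho> k \<le> res x y" using w1 by (simp add: \<rho>_def w_def)
        then show False using \<Delta>[OF n y(1)] \<open>\<Delta> n < r n\<close> k(2) by linarith
      qed
      ultimately have Gw: "G n w" using w by (simp add: G_def)
      \<comment> \<open>The point x lies in \<open>U n\<close> and in the path cell whose length is
        that of \<open>h n\<close>, so the last clause of \<open>G\<close> forces this path cell to
        be \<open>h n\<close>.\<close>
      let ?i = "W (length (h n))"
      have hn: "h n \<in> lists letters" using hG[OF Gw] by (simp add: G_def)
      have "?i = h n"
      proof (rule ccontr)
        assume "?i \<noteq> h n"
        then have "U n \<inter> cell ?i = {}" using hG[OF Gw] Wl' by (auto simp: G_def W_def)
        then show False using n x by blast
      qed
      have "m n \<le> f\<^sub>1 (h n)" unfolding f\<^sub>1_def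
        using suminf_term_le[of "\<lambda>n'. if extends (h n') (h n) then m n' else 0" n] by simp
      moreover have "m n = ennreal (\<mu> (h n))" using Gw by (auto simp: m_def)
      ultimately show False using f1[of "length (h n)"] \<open>?i = h n\<close> by simp
    qed
  qed
qed

end


section \<open>The branching structure of the cascade\<close>

text \<open>Weights lie in \<open>(0, 1]\<close> almost surely; clipping makes every product bounded everywhere.\<close>

definition clip :: "real \<Rightarrow> real" where
  "clip r = max 0 (min 1 r)"

lemma clip_bounds [simp]: "0 \<le> clip r" "clip r \<le> 1"
  by (auto simp: clip_def)

lemma clip_id: "0 \<le> r \<Longrightarrow> r \<le> 1 \<Longrightarrow> clip r = r"
  by (auto simp: clip_def)

lemma measurable_clip [measurable]: "clip \<in> borel_measurable borel"
  unfolding clip_def by measurable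

text \<open>A configuration x assigns to each word i the triple of weights of its children, so
  \<open>x i j\<close> is the weight of \<open>i @ [j]\<close>. The restriction to
  \<open>lists letters\<close> keeps the shifted configuration in the carrier of the product
  space.\<close>

definition branch :: "nat \<Rightarrow> (nat list \<Rightarrow> nat \<Rightarrow> real) \<Rightarrow> nat list \<Rightarrow> nat \<Rightarrow> real" where
  "branch j x = (\<lambda>i\<in>lists letters. x (j # i))"

primrec lprod :: "nat list \<Rightarrow> (nat list \<Rightarrow> nat \<Rightarrow> real) \<Rightarrow> real" where
  "lprod [] x = 1"
| "lprod (j # i) x = clip (x [] j) * lprod i (branch j x)"

primrec subtree :: "nat list \<Rightarrow> (nat list \<Rightarrow> nat \<Rightarrow> real) \<Rightarrow> nat list \<Rightarrow> nat \<Rightarrow> real" where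
  "subtree [] x = x"
| "subtree (j # i) x = subtree i (branch j x)"

lemma subtree_Nil: "subtree [] = (\<lambda>x. x)"
  by (rule ext) simp

lemma lprod_nonneg [simp]: "0 \<le> lprod i x"
  by (induction i arbitrary: x) auto

lemma lprod_le_1 [simp]: "lprod i x \<le> 1"
proof (induction i arbitrary: x)
  case (Cons j i)
  then show ?case using mult_mono[of "clip (x [] j)" 1 "lprod i (branch j x)" 1] by simp
qed auto

lemma lprod_append: "lprod (i @ u) x = lprod i x * lprod u (subtree i x)"
  by (induction i arbitrary: x) auto

lemma subtree_append: "subtree (i @ u) x = subtree u (subtree i x)"
  by (induction i arbitrary: x) auto

text \<open>\<open>N\<close> is the joint law of the weights of the three children of a word, and
  \<open>\<Omega>\<close> below is the canonical space of the cascade.\<close>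

locale cascade_law = N: prob_space N for N :: "(nat \<Rightarrow> real) measure" +
  assumes sets_N [measurable_cong]: "sets N = sets (Pi\<^sub>M letters (\<lambda>_. borel))"
    and N_pos: "\<And>j. j \<in> letters \<Longrightarrow> AE t in N. 0 < t j"
begin

definition "\<Omega> = Pi\<^sub>M (lists letters) (\<lambda>_. N)"

sublocale P: product_prob_space "\<lambda>_. N" "lists letters"
  by unfold_locales

sublocale prob_space \<Omega>
  unfolding \<Omega>_def by (rule P.prob_space_axioms)

lemma measurable_coord [measurable]: "i \<in> lists letters \<Longrightarrow> (\<lambda>x. x i) \<in> measurable \<Omega> N"
  unfolding \<Omega>_def by measurable

lemma measurable_letter [measurable]: "j \<in> letters \<Longrightarrow> (\<lambda>t. t j) \<in> borel_measurable N"
  by measurable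

lemma measurable_branch [measurable]: "j \<in> letters \<Longrightarrow> branch j \<in> measurable \<Omega> \<Omega>"
  unfolding branch_def[abs_def] by (subst (2) \<Omega>_def) (intro measurable_restrict measurable_coord, auto)

text \<open>Prefixing a letter is injective on words, so the triples below it are again independent
  copies with law \<open>N\<close>.\<close>

lemma distr_branch: "j \<in> letters \<Longrightarrow> distr \<Omega> \<Omega> (branch j) = \<Omega>"
  using distr_PiM_reindex[of "lists letters" "\<lambda>_. N" "(#) j" "lists letters"] N.prob_space_axioms
  by (auto simp: \<Omega>_def branch_def[abs_def] inj_on_def)

lemma measurable_subtree [measurable]: "i \<in> lists letters \<Longrightarrow> subtree i \<in> measurable \<Omega> \<Omega>"
proof (induction i rule: list.induct)
  case (Cons j i)
  then have "(\<lambda>x. subtree i (branch j x)) \<in> measurable \<Omega> \<Omega>" by (intro measurable_compose[OF measurable_branch]) auto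
  moreover have "subtree (j # i) = (\<lambda>x. subtree i (branch j x))" by (rule ext) simp
  ultimately show ?case by simp
qed (simp add: measurable_ident_sets subtree_Nil)

lemma distr_subtree: "i \<in> lists letters \<Longrightarrow> distr \<Omega> \<Omega> (subtree i) = \<Omega>"
proof (induction i rule: list.induct)
  case (Cons j i)
  have "subtree (j # i) = subtree i \<circ> branch j" by (rule ext) simp
  moreover have j: "j \<in> letters" and i: "i \<in> lists letters" using Cons.prems by auto
  ultimately have "distr \<Omega> \<Omega> (subtree (j # i)) = distr (distr \<Omega> \<Omega> (branch j)) \<Omega> (subtree i)"
    by (simp only: distr_distr[OF measurable_subtree[OF i] measurable_branch[OF j]])
  then show ?case by (simp only: distr_branch[OF j] Cons.IH[OF i])
qed (simp add: distr_id2 subtree_Nil)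

text \<open>There are only countably many words, and every subtree has the law of the whole
  configuration.\<close>

lemma AE_subtrees:
  assumes "AE x in \<Omega>. Q x" shows "AE x in \<Omega>. \<forall>i\<in>lists letters. Q (subtree i x)"
proof (subst AE_ball_countable)
  show "countable (lists letters)" by (intro countable_lists countable_finite) simp
  show "\<forall>i\<in>lists letters. AE x in \<Omega>. Q (subtree i x)"
  proof
    fix i assume i: "i \<in> lists letters"
    show "AE x in \<Omega>. Q (subtree i x)"
      using assms AE_distrD[OF measurable_subtree[OF i], of Q] unfolding distr_subtree[OF i] by blast
  qed
qed

lemma measurable_lprod [measurable]: "i \<in> lists letters \<Longrightarrow> lprod i \<in> borel_measurable \<Omega>"
proof (induction i rule: list.induct)
  case (Cons j i)
  then have [measurable]: "(\<lambda>x. lprod i (branch j x)) \<in> borel_measurable \<Omega>" "j \<in> letters"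
    by (auto intro!: measurable_compose[OF measurable_branch])
  have "lprod (j # i) = (\<lambda>x. clip (x [] j) * lprod i (branch j x))" by (rule ext) simp
  then show ?case by simp
next
  case Nil
  have "lprod [] = (\<lambda>_. 1)" by (rule ext) simp
  then show ?case by simp
qed

lemma AE_weights_pos: "AE x in \<Omega>. \<forall>j\<in>letters. 0 < x [] j"
proof (subst AE_ball_countable)
  show "\<forall>j\<in>letters. AE x in \<Omega>. 0 < x [] j"
    unfolding \<Omega>_def using N_pos by (intro ballI P.AE_component[where P = "\<lambda>t. 0 < t _"]) auto
qed (auto intro: countable_finite)

lemma AE_lprod_pos: "AE x in \<Omega>. \<forall>i\<in>lists letters. 0 < lprod i x"
  using AE_subtrees[OF AE_weights_pos]
proof (eventually_elim)
  case (elim x)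
  have "0 < lprod i y" if "i \<in> lists letters" "\<forall>u\<in>lists letters. \<forall>j\<in>letters. 0 < subtree u y [] j" for i y
    using that
  proof (induction i arbitrary: y rule: list.induct)
    case (Cons j i)
    then have "\<forall>u\<in>lists letters. \<forall>k\<in>letters. 0 < subtree u (branch j y) [] k"
      by (metis Cons_in_lists_iff subtree.simps(2))
    then have "0 < lprod i (branch j y)" using Cons by auto
    moreover have "0 < y [] j" using Cons.prems by (metis Cons_in_lists_iff lists.Nil subtree.simps(1))
    ultimately show ?case by (auto simp: clip_def)
  qed simp
  then show ?case using elim by blast
qed

section \<open>Independence of the root triple and the branches\<close>

lemma indep_coords: "indep_vars (\<lambda>_. N) (\<lambda>i x. x i) (lists letters)"
proof (subst indep_vars_iff_distr_eq_PiM')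
  have "distr \<Omega> (Pi\<^sub>M (lists letters) (\<lambda>_. N)) (\<lambda>x. \<lambda>i\<in>lists letters. x i) = distr \<Omega> \<Omega> (\<lambda>x. x)"
    by (intro distr_cong) (auto simp: \<Omega>_def space_PiM PiE_def extensional_restrict)
  moreover have "Pi\<^sub>M (lists letters) (\<lambda>i. distr \<Omega> N (\<lambda>x. x i)) = \<Omega>"
    unfolding \<Omega>_def by (intro PiM_cong refl P.PiM_component)
  ultimately show "distr \<Omega> (Pi\<^sub>M (lists letters) (\<lambda>_. N)) (\<lambda>x. \<lambda>i\<in>lists letters. x i)
      = Pi\<^sub>M (lists letters) (\<lambda>i. distr \<Omega> N (\<lambda>x. x i))"
    by (simp add: distr_id)
qed (auto intro: lists.Nil measurable_coord)

text \<open>The words split into the empty word and, for each letter, the words beginning with it;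
  functions of disjoint blocks of coordinates are independent. The index 0, which is not a letter,
  stands for the root.\<close>

lemma indep_branches:
  fixes H :: "(nat \<Rightarrow> real) \<Rightarrow> 'b :: topological_space"
  assumes [measurable]: "H \<in> borel_measurable N" "\<And>j. j \<in> letters \<Longrightarrow> G j \<in> borel_measurable \<Omega>"
  shows "indep_vars (\<lambda>_. borel) (\<lambda>k x. if k = 0 then H (x []) else G k (branch k x)) (insert 0 letters)"
proof -
  define K where "K k = (if k = 0 then {[]} else (#) k ` lists letters)" for k :: nat
  define F where "F k y = (if k = 0 then H (y []) else G k (\<lambda>i\<in>lists letters. y (k # i)))" for k y
  have Kl: "K k \<subseteq> lists letters" if "k \<in> insert 0 letters" for k using that by (auto simp: K_def letters_def)
  have "indep_vars (\<lambda>k. Pi\<^sub>M (K k) (\<lambda>_. N)) (\<lambda>k x. restrict (\<lambda>i. x i) (K k)) (insert 0 letters)"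
    by (rule indep_vars_restrict[OF indep_coords Kl]) (auto simp: disjoint_family_on_def K_def)
  then have "indep_vars (\<lambda>_. borel) (\<lambda>k x. F k (restrict (\<lambda>i. x i) (K k))) (insert 0 letters)"
  proof (rule indep_vars_compose2)
    fix k assume k: "k \<in> insert 0 letters"
    show "F k \<in> borel_measurable (Pi\<^sub>M (K k) (\<lambda>_. N))"
    proof (cases "k = 0")
      case True
      have "(\<lambda>y. y []) \<in> measurable (Pi\<^sub>M (K k) (\<lambda>_. N)) N"
        using True by (intro measurable_component_singleton) (simp add: K_def)
      then show ?thesis using True by (simp add: F_def[abs_def])
    next
      case False
      then have "k \<in> letters" using k by simp
      have "(\<lambda>y. \<lambda>i\<in>lists letters. y (k # i)) \<in> measurable (Pi\<^sub>M (K k) (\<lambda>_. N)) \<Omega>"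
        unfolding \<Omega>_def using False
        by (intro measurable_restrict measurable_component_singleton) (auto simp: K_def)
      then show ?thesis using False assms(2)[OF \<open>k \<in> letters\<close>] by (simp add: F_def[abs_def])
    qed
  qed
  moreover have "F k (restrict (\<lambda>i. x i) (K k)) = (if k = 0 then H (x []) else G k (branch k x))" for k x
    by (auto simp: F_def K_def branch_def intro!: arg_cong[of _ _ "G k"] ext)
  ultimately show ?thesis by simp
qed

lemma letters_0: "0 \<notin> letters" "j \<in> letters \<Longrightarrow> j \<noteq> 0" by (auto simp: letters_def)

lemma nn_integral_root: "H \<in> borel_measurable N \<Longrightarrow> (\<integral>\<^sup>+x. H (x []) \<partial>\<Omega>) = (\<integral>\<^sup>+t. H t \<partial>N)"
  using P.PiM_component[of "[]"] nn_integral_distr[of "\<lambda>x. x []" \<Omega> N H] by (simp add: \<Omega>_def)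

lemma nn_integral_branch_only:
  "j \<in> letters \<Longrightarrow> G \<in> borel_measurable \<Omega> \<Longrightarrow> (\<integral>\<^sup>+x. G (branch j x) \<partial>\<Omega>) = (\<integral>\<^sup>+x. G x \<partial>\<Omega>)"
  using nn_integral_distr[of "branch j" \<Omega> \<Omega> G] by (simp add: distr_branch)

lemma integral_branch_only:
  "j \<in> letters \<Longrightarrow> G \<in> borel_measurable \<Omega> \<Longrightarrow> (\<integral>x. G (branch j x) \<partial>\<Omega>) = (\<integral>x. G x \<partial>\<Omega>)" for G :: "_ \<Rightarrow> real"
  using integral_distr[of "branch j" \<Omega> \<Omega> G] by (simp add: distr_branch)

lemma nn_integral_branches:
  fixes H :: "_ \<Rightarrow> ennreal"
  assumes "H \<in> borel_measurable N" "\<And>j. j \<in> letters \<Longrightarrow> G j \<in> borel_measurable \<Omega>"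
  shows "(\<integral>\<^sup>+x. H (x []) * (\<Prod>j\<in>letters. G j (branch j x)) \<partial>\<Omega>)
    = (\<integral>\<^sup>+t. H t \<partial>N) * (\<Prod>j\<in>letters. \<integral>\<^sup>+x. G j x \<partial>\<Omega>)"
proof -
  let ?X = "\<lambda>k x. if k = 0 then H (x []) else G k (branch k x)"
  have e: "(\<Prod>k\<in>insert 0 letters. ?X k x) = H (x []) * (\<Prod>j\<in>letters. G j (branch j x))" for x
    using letters_0 by (subst prod.insert) (auto intro!: arg_cong2[of _ _ _ _ "(*)"] prod.cong)
  have "(\<integral>\<^sup>+x. (\<Prod>k\<in>insert 0 letters. ?X k x) \<partial>\<Omega>) = (\<Prod>k\<in>insert 0 letters. \<integral>\<^sup>+x. ?X k x \<partial>\<Omega>)"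
    by (intro indep_vars_nn_integral indep_branches assms) auto
  also have "\<dots> = (\<integral>\<^sup>+t. H t \<partial>N) * (\<Prod>j\<in>letters. \<integral>\<^sup>+x. ?X j x \<partial>\<Omega>)"
    using letters_0 by (subst prod.insert) (auto simp: nn_integral_root assms(1))
  also have "(\<Prod>j\<in>letters. \<integral>\<^sup>+x. ?X j x \<partial>\<Omega>) = (\<Prod>j\<in>letters. \<integral>\<^sup>+x. G j x \<partial>\<Omega>)"
    by (intro prod.cong refl) (simp add: letters_0 nn_integral_branch_only assms(2))
  finally show ?thesis by (simp add: e)
qed

lemma prod_letters_if2:
  assumes "a \<in> letters" "b \<in> letters" "a \<noteq> b"
  shows "(\<Prod>j\<in>letters. if j = a then f j else if j = b then g j else 1) = (f a * g b :: 'b :: comm_monoid_mult)"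
proof -
  have "(\<Prod>j\<in>letters. if j = a then f j else if j = b then g j else 1)
    = (\<Prod>j\<in>letters. (if j = a then f j else 1) * (if j = b then g j else 1))"
    using assms by (intro prod.cong) auto
  then show ?thesis using assms by (simp add: prod.distrib)
qed

lemma nn_integral_branch2:
  fixes H g h :: "_ \<Rightarrow> ennreal"
  assumes [measurable]: "H \<in> borel_measurable N" "g \<in> borel_measurable \<Omega>" "h \<in> borel_measurable \<Omega>"
    and ab: "a \<in> letters" "b \<in> letters" "a \<noteq> b"
  shows "(\<integral>\<^sup>+x. H (x []) * (g (branch a x) * h (branch b x)) \<partial>\<Omega>) = (\<integral>\<^sup>+t. H t \<partial>N) * ((\<integral>\<^sup>+x. g x \<partial>\<Omega>) * (\<integral>\<^sup>+x. h x \<partial>\<Omega>))"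
proof -
  let ?G = "\<lambda>j x. if j = a then g x else if j = b then h x else 1"
  have "(\<Prod>j\<in>letters. ?G j (branch j x)) = g (branch a x) * h (branch b x)" for x
    using prod_letters_if2[OF ab, of "\<lambda>j. g (branch j x)" "\<lambda>j. h (branch j x)"] by simp
  moreover have "(\<Prod>j\<in>letters. \<integral>\<^sup>+x. ?G j x \<partial>\<Omega>) = (\<integral>\<^sup>+x. g x \<partial>\<Omega>) * (\<integral>\<^sup>+x. h x \<partial>\<Omega>)"
  proof -
    have "(\<Prod>j\<in>letters. \<integral>\<^sup>+x. ?G j x \<partial>\<Omega>)
      = (\<Prod>j\<in>letters. if j = a then \<integral>\<^sup>+x. g x \<partial>\<Omega> else if j = b then \<integral>\<^sup>+x. h x \<partial>\<Omega> else 1)"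
      by (intro prod.cong refl) (auto simp: emeasure_space_1)
    then show ?thesis by (simp only: prod_letters_if2[OF ab])
  qed
  ultimately show ?thesis using nn_integral_branches[of H ?G] by simp
qed

lemma nn_integral_branch:
  fixes H g :: "_ \<Rightarrow> ennreal"
  assumes [measurable]: "H \<in> borel_measurable N" "g \<in> borel_measurable \<Omega>" and a: "a \<in> letters"
  shows "(\<integral>\<^sup>+x. H (x []) * g (branch a x) \<partial>\<Omega>) = (\<integral>\<^sup>+t. H t \<partial>N) * (\<integral>\<^sup>+x. g x \<partial>\<Omega>)"
proof -
  obtain b where b: "b \<in> letters" "a \<noteq> b"
    by (cases "a = 1") (use that[of 2] that[of 1] in \<open>simp_all add: letters_def\<close>)
  have "(\<integral>\<^sup>+x. H (x []) * (g (branch a x) * (\<lambda>_. 1) (branch b x)) \<partial>\<Omega>)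
      = (\<integral>\<^sup>+t. H t \<partial>N) * ((\<integral>\<^sup>+x. g x \<partial>\<Omega>) * (\<integral>\<^sup>+x. 1 \<partial>\<Omega>))"
    by (rule nn_integral_branch2[where H = H and g = g and h = "\<lambda>_. 1"]) (fact assms b | simp)+
  then show ?thesis by (simp add: emeasure_space_1)
qed

lemma integral_branch2:
  fixes H g h :: "_ \<Rightarrow> real"
  assumes [measurable]: "H \<in> borel_measurable N" "g \<in> borel_measurable \<Omega>" "h \<in> borel_measurable \<Omega>"
    and ab: "a \<in> letters" "b \<in> letters" "a \<noteq> b"
    and bounds: "\<And>t. \<bar>H t\<bar> \<le> B" "\<And>x. \<bar>g x\<bar> \<le> B" "\<And>x. \<bar>h x\<bar> \<le> B"
  shows "(\<integral>x. H (x []) * (g (branch a x) * h (branch b x)) \<partial>\<Omega>) = (\<integral>x. H (x []) \<partial>\<Omega>) * ((\<integral>x. g x \<partial>\<Omega>) * (\<integral>x. h x \<partial>\<Omega>))"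
proof -
  let ?G = "\<lambda>j x. if j = a then g x else if j = b then h x else 1"
  let ?X = "\<lambda>k x. if k = 0 then H (x []) else ?G k (branch k x)"
  have int: "integrable \<Omega> (?X k)" if "k \<in> insert 0 letters" for k
  proof (rule integrable_const_bound[of _ "max B 1"])
    show "AE x in \<Omega>. norm (?X k x) \<le> max B 1" using bounds by (auto simp: le_max_iff_disj)
    show "?X k \<in> borel_measurable \<Omega>" using that by auto
  qed
  have e: "(\<Prod>k\<in>insert 0 letters. ?X k x) = H (x []) * (g (branch a x) * h (branch b x))" for x
  proof -
    have "(\<Prod>k\<in>letters. ?X k x) = (\<Prod>k\<in>letters. ?G k (branch k x))"
      using letters_0 by (intro prod.cong) auto
    also have "\<dots> = g (branch a x) * h (branch b x)"
      using prod_letters_if2[OF ab, of "\<lambda>j. g (branch j x)" "\<lambda>j. h (branch j x)"] .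
    finally have "(\<Prod>k\<in>letters. ?X k x) = g (branch a x) * h (branch b x)" .
    moreover have "(\<Prod>k\<in>insert 0 letters. ?X k x) = ?X 0 x * (\<Prod>k\<in>letters. ?X k x)"
      by (rule prod.insert) (auto simp: letters_0)
    ultimately show ?thesis by (simp only: refl if_True)
  qed
  have "(\<integral>x. (\<Prod>k\<in>insert 0 letters. ?X k x) \<partial>\<Omega>) = (\<Prod>k\<in>insert 0 letters. \<integral>x. ?X k x \<partial>\<Omega>)"
    by (intro indep_vars_lebesgue_integral indep_branches int) auto
  also have "\<dots> = (\<integral>x. H (x []) \<partial>\<Omega>) * (\<Prod>j\<in>letters. \<integral>x. ?X j x \<partial>\<Omega>)"
    using letters_0 by (subst prod.insert) auto
  also have "(\<Prod>j\<in>letters. \<integral>x. ?X j x \<partial>\<Omega>) = (\<Prod>j\<in>letters. if j = a then \<integral>x. g x \<partial>\<Omega> else if j = b then \<integral>x. h x \<partial>\<Omega> else 1)"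
    using ab by (intro prod.cong refl) (simp add: letters_0 integral_branch_only prob_space)
  also have "\<dots> = (\<integral>x. g x \<partial>\<Omega>) * (\<integral>x. h x \<partial>\<Omega>)" by (rule prod_letters_if2[OF ab])
  finally show ?thesis by (simp add: e)
qed

section \<open>Moments along words and levels\<close>

definition mom :: "nat \<Rightarrow> real \<Rightarrow> ennreal" where
  "mom j \<theta> = (\<integral>\<^sup>+t. ennreal (clip (t j) powr \<theta>) \<partial>N)"

text \<open>The root weight is independent of the branch that it multiplies, so each letter splits
  off one moment, and the subtree finally reached has the original law.\<close>

lemma nn_integral_word:
  fixes G :: "_ \<Rightarrow> ennreal"
  assumes "i \<in> lists letters" "G \<in> borel_measurable \<Omega>"
  shows "(\<integral>\<^sup>+x. ennreal (lprod i x powr \<theta>) * G (subtree i x) \<partial>\<Omega>) = (\<Prod>j\<leftarrow>i. mom j \<theta>) * (\<integral>\<^sup>+x. G x \<partial>\<Omega>)"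
  using assms(1)
proof (induction i rule: list.induct)
  case (Cons j i)
  then have j [measurable]: "j \<in> letters" and i [measurable]: "i \<in> lists letters" by auto
  note [measurable] = assms(2)
  let ?g = "\<lambda>x. ennreal (lprod i x powr \<theta>) * G (subtree i x)"
  have "(\<integral>\<^sup>+x. ennreal (lprod (j # i) x powr \<theta>) * G (subtree (j # i) x) \<partial>\<Omega>)
    = (\<integral>\<^sup>+x. ennreal (clip (x [] j) powr \<theta>) * ?g (branch j x) \<partial>\<Omega>)"
    by (intro nn_integral_cong) (simp add: powr_mult ennreal_mult mult.assoc)
  also have "\<dots> = mom j \<theta> * (\<integral>\<^sup>+x. ?g x \<partial>\<Omega>)"
    unfolding mom_def by (rule nn_integral_branch) measurable
  finally show ?case using Cons.IH i by (simp add: mult.assoc)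
qed simp

lemma sum_words_prod_list:
  "(\<Sum>i\<in>words A n. \<Prod>j\<leftarrow>i. f j) = (\<Sum>j\<in>A. f j :: 'b :: comm_semiring_1) ^ n"
  by (induction n) (simp_all add: sum_words_Suc sum_distrib_left[symmetric] sum_distrib_right[symmetric])

text \<open>The many-to-one formula: products of moments over all words of a level add up to a power
  of the one-step sum, which is 1 for all letters and the critical exponent.\<close>

lemma nn_integral_level:
  fixes G :: "_ \<Rightarrow> ennreal"
  assumes A: "A \<subseteq> letters" and [measurable]: "G \<in> borel_measurable \<Omega>"
  shows "(\<integral>\<^sup>+x. (\<Sum>i\<in>words A n. ennreal (lprod i x powr \<theta>) * G (subtree i x)) \<partial>\<Omega>)
    = (\<Sum>j\<in>A. mom j \<theta>) ^ n * (\<integral>\<^sup>+x. G x \<partial>\<Omega>)"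
proof -
  have l: "i \<in> lists letters" if "i \<in> words A n" for i using that A wordsD(2) mono_words by blast
  have "(\<integral>\<^sup>+x. (\<Sum>i\<in>words A n. ennreal (lprod i x powr \<theta>) * G (subtree i x)) \<partial>\<Omega>)
    = (\<Sum>i\<in>words A n. \<integral>\<^sup>+x. ennreal (lprod i x powr \<theta>) * G (subtree i x) \<partial>\<Omega>)"
  proof (rule nn_integral_sum)
    fix i assume "i \<in> words A n"
    then have [measurable]: "i \<in> lists letters" by (rule l)
    show "(\<lambda>x. ennreal (lprod i x powr \<theta>) * G (subtree i x)) \<in> borel_measurable \<Omega>" by measurable
  qed
  also have "\<dots> = (\<Sum>i\<in>words A n. (\<Prod>j\<leftarrow>i. mom j \<theta>) * (\<integral>\<^sup>+x. G x \<partial>\<Omega>))"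
    using l by (intro sum.cong nn_integral_word) auto
  finally show ?thesis by (simp add: sum_distrib_right[symmetric] sum_words_prod_list)
qed

lemma mom_le_1: "0 \<le> \<theta> \<Longrightarrow> mom j \<theta> \<le> 1"
proof -
  assume "0 \<le> \<theta>"
  then have "clip r powr \<theta> \<le> 1" for r using powr_mono2[of \<theta> "clip r" 1] by simp
  then have "mom j \<theta> \<le> (\<integral>\<^sup>+t. 1 \<partial>N)" unfolding mom_def by (intro nn_integral_mono) simp
  then show ?thesis by (simp add: N.emeasure_space_1)
qed

lemma AE_summable:
  fixes F :: "nat \<Rightarrow> _ \<Rightarrow> real"
  assumes [measurable]: "\<And>n. F n \<in> borel_measurable \<Omega>" and "\<And>n x. 0 \<le> F n x"
    and "(\<Sum>n. \<integral>\<^sup>+x. ennreal (F n x) \<partial>\<Omega>) < \<infinity>"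
  shows "AE x in \<Omega>. summable (\<lambda>n. F n x)"
proof -
  have "(\<integral>\<^sup>+x. (\<Sum>n. ennreal (F n x)) \<partial>\<Omega>) < \<infinity>" using assms(3) by (subst nn_integral_suminf) auto
  then have "AE x in \<Omega>. (\<Sum>n. ennreal (F n x)) \<noteq> \<infinity>"
    by (intro nn_integral_PInf_AE) auto
  then show ?thesis
  proof (eventually_elim)
    case (elim x)
    then show ?case using assms(2) by (intro summable_suminf_not_top) auto
  qed
qed

text \<open>Divided by \<open>q ^ n\<close>, the level sums have geometrically decaying
  expectations. So they are almost surely summable, and in particular bounded in n.\<close>

lemma AE_level_bound:
  fixes G :: "_ \<Rightarrow> real"
  assumes [measurable]: "G \<in> borel_measurable \<Omega>" and G: "\<And>x. 0 \<le> G x" "(\<integral>\<^sup>+x. ennreal (G x) \<partial>\<Omega>) < \<infinity>"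
    and q: "0 < q" "(\<Sum>j\<in>letters. mom j \<theta>) < ennreal q"
  shows "AE x in \<Omega>. \<exists>C. \<forall>n. (\<Sum>i\<in>words letters n. lprod i x powr \<theta> * G (subtree i x)) \<le> C * q ^ n"
proof -
  define F where "F n x = (\<Sum>i\<in>words letters n. lprod i x powr \<theta> * G (subtree i x)) / q ^ n" for n x
  obtain m where m: "0 \<le> m" "(\<Sum>j\<in>letters. mom j \<theta>) = ennreal m" "m < q"
    using q by (cases "\<Sum>j\<in>letters. mom j \<theta>") (auto simp: ennreal_less_iff)
  obtain g where g: "0 \<le> g" "(\<integral>\<^sup>+x. ennreal (G x) \<partial>\<Omega>) = ennreal g"
    using G(2) by (cases "\<integral>\<^sup>+x. ennreal (G x) \<partial>\<Omega>") auto
  have Fm [measurable]: "F n \<in> borel_measurable \<Omega>" for n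
    unfolding F_def[abs_def]
  proof (intro borel_measurable_divide borel_measurable_sum borel_measurable_const)
    fix i assume "i \<in> words letters n"
    then have [measurable]: "i \<in> lists letters" by (rule wordsD)
    show "(\<lambda>x. lprod i x powr \<theta> * G (subtree i x)) \<in> borel_measurable \<Omega>" by measurable
  qed
  have F0: "0 \<le> F n x" for n x unfolding F_def using G(1) q by (intro divide_nonneg_pos sum_nonneg) auto
  have "(\<integral>\<^sup>+x. ennreal (F n x) \<partial>\<Omega>) = ennreal ((m / q) ^ n * g)" for n
  proof -
    have "(\<integral>\<^sup>+x. ennreal (F n x) \<partial>\<Omega>) = (\<integral>\<^sup>+x. ennreal (1 / q ^ n) * (\<Sum>i\<in>words letters n. ennreal (lprod i x powr \<theta>) * ennreal (G (subtree i x))) \<partial>\<Omega>)"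
      unfolding F_def using G(1) q
      by (intro nn_integral_cong) (simp add: ennreal_mult[symmetric] sum_nonneg)
    also have "\<dots> = ennreal (1 / q ^ n) * (\<integral>\<^sup>+x. (\<Sum>i\<in>words letters n. ennreal (lprod i x powr \<theta>) * ennreal (G (subtree i x))) \<partial>\<Omega>)"
    proof (intro nn_integral_cmult borel_measurable_sum)
      fix i assume "i \<in> words letters n"
      then have [measurable]: "i \<in> lists letters" by (rule wordsD)
      show "(\<lambda>x. ennreal (lprod i x powr \<theta>) * ennreal (G (subtree i x))) \<in> borel_measurable \<Omega>" by measurable
    qed
    also have "\<dots> = ennreal (1 / q ^ n) * (ennreal m ^ n * ennreal g)"
      by (subst nn_integral_level) (auto simp: m g)
    also have "\<dots> = ennreal ((m / q) ^ n * g)"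
      using m g q by (simp add: ennreal_power ennreal_mult[symmetric] power_divide)
    finally show ?thesis .
  qed
  moreover have "(\<Sum>n. ennreal ((m / q) ^ n * g)) < \<infinity>"
  proof -
    have "summable (\<lambda>n. (m / q) ^ n * g)" using m q by (intro summable_mult2 summable_geometric) auto
    then show ?thesis using m g q by (subst suminf_ennreal2) auto
  qed
  ultimately have "AE x in \<Omega>. summable (\<lambda>n. F n x)" using F0 by (intro AE_summable) auto
  then show ?thesis
  proof (eventually_elim)
    case (elim x)
    have "(\<Sum>i\<in>words letters n. lprod i x powr \<theta> * G (subtree i x)) \<le> (\<Sum>n. F n x) * q ^ n" for n
    proof -
      have "F n x \<le> (\<Sum>n. F n x)" using sum_le_suminf[OF elim, of "{n}"] F0 by simp
      then show ?thesis using q by (simp add: F_def divide_le_eq)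
    qed
    then show ?case by blast
  qed
qed

end


section \<open>Multiplicative martingales\<close>

text \<open>The pure powers keep the coefficient 1, and all mixed monomials are absorbed by the two
  extreme ones; the constant gives equality at x = y. The coefficient 1 is what lets the moment
  recursion in \<open>moment_Y\<close> contract.\<close>

lemma power_sum2_le:
  fixes x y :: real
  assumes "0 \<le> x" "0 \<le> y"
  shows "(x + y) ^ (n + 2) \<le> x ^ (n + 2) + y ^ (n + 2) + (2 ^ (n + 1) - 1) * (x ^ (n + 1) * y + x * y ^ (n + 1))"
proof (induction n)
  case 0
  show ?case by (simp add: power2_eq_square algebra_simps)
next
  case (Suc n)
  define a b P where "a = x ^ n" and "b = y ^ n" and "P = (2::real) ^ (n + 1) - 1"
  \<comment> \<open>Rearrangement: x - y and the difference of the n-th powers have the same sign,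
    so mixed monomials are dominated by more extreme ones.\<close>
  have "(x - y) * (a - b) \<ge> 0"
  proof (cases "x \<le> y")
    case True
    then have "a \<le> b" unfolding a_def b_def using assms by (intro power_mono) auto
    with True show ?thesis by (simp add: mult_nonpos_nonpos)
  next
    case False
    then have "b \<le> a" unfolding a_def b_def using assms by (intro power_mono) auto
    with False show ?thesis by simp
  qed
  then have "x * y * (x * b + a * y) \<le> x * y * (x * a + y * b)"
    using assms by (intro mult_left_mono) (auto simp: algebra_simps)
  moreover have "0 \<le> P" unfolding P_def by (simp add: one_le_power del: power_Suc)
  ultimately have mix: "P * (x * y * (x * b + a * y)) \<le> P * (x * y * (x * a + y * b))"
    by (rule mult_left_mono)
  have "(x + y) ^ (Suc n + 2) = (x + y) * (x + y) ^ (n + 2)" by simp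
  also have "\<dots> \<le> (x + y) * (x * x * a + y * y * b + P * (x * a * y + x * (y * b)))"
    using mult_left_mono[OF Suc.IH, of "x + y"] assms by (simp add: a_def b_def P_def mult.assoc)
  also have "\<dots> \<le> x * x * x * a + y * y * y * b + (1 + 2 * P) * (x * x * a * y + x * (y * y * b))"
    using mix by (simp add: algebra_simps)
  also have "1 + 2 * P = 2 ^ (Suc n + 1) - 1" by (simp add: P_def)
  finally show ?case by (simp add: a_def b_def mult.assoc)
qed

text \<open>Split off one summand and apply the case of two numbers. In the mixed terms a power of
  the remaining sum needs only a crude bound by the sum of powers, through the largest
  summand.\<close>

lemma power_sum_le:
  assumes "finite A"
  shows "\<exists>C\<ge>0. \<forall>f :: 'b \<Rightarrow> real. (\<forall>j\<in>A. 0 \<le> f j) \<longrightarrow>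
    (\<Sum>j\<in>A. f j) ^ (n + 2) \<le> (\<Sum>j\<in>A. f j ^ (n + 2)) + C * (\<Sum>j\<in>A. \<Sum>k\<in>A - {j}. f j ^ (n + 1) * f k)"
  using assms
proof (induction A)
  case empty
  then show ?case by (intro exI[of _ 0]) simp
next
  case (insert a A)
  then obtain C where C: "0 \<le> C" "\<And>f :: 'b \<Rightarrow> real. (\<forall>j\<in>A. 0 \<le> f j) \<Longrightarrow>
    (\<Sum>j\<in>A. f j) ^ (n + 2) \<le> (\<Sum>j\<in>A. f j ^ (n + 2)) + C * (\<Sum>j\<in>A. \<Sum>k\<in>A - {j}. f j ^ (n + 1) * f k)"
    by blast
  define P where "P = (2::real) ^ (n + 1) - 1"
  have P: "0 \<le> P" unfolding P_def by (simp add: one_le_power del: power_Suc)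
  define c where "c = real (card A) ^ (n + 1)"
  have c: "0 \<le> c" by (simp add: c_def)
  have "(\<Sum>j\<in>insert a A. f j) ^ (n + 2) \<le> (\<Sum>j\<in>insert a A. f j ^ (n + 2)) +
      (C + P + P * c) * (\<Sum>j\<in>insert a A. \<Sum>k\<in>insert a A - {j}. f j ^ (n + 1) * f k)"
    if f: "\<forall>j\<in>insert a A. 0 \<le> f j" for f :: "'b \<Rightarrow> real"
  proof -
    define S where "S = (\<Sum>j\<in>A. f j)"
    have S: "0 \<le> S" unfolding S_def using f by (intro sum_nonneg) auto
    define X1 X2 X3 where "X1 = (\<Sum>j\<in>A. \<Sum>k\<in>A - {j}. f j ^ (n + 1) * f k)"
      and "X2 = (\<Sum>k\<in>A. f a ^ (n + 1) * f k)" and "X3 = (\<Sum>j\<in>A. f j ^ (n + 1) * f a)"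
    have pos: "0 \<le> X1" "0 \<le> X2" "0 \<le> X3"
      unfolding X1_def X2_def X3_def using f by (intro sum_nonneg mult_nonneg_nonneg zero_le_power; auto)+
    have "(\<Sum>j\<in>A. \<Sum>k\<in>insert a A - {j}. f j ^ (n + 1) * f k) = X1 + X3"
    proof -
      have "(\<Sum>k\<in>insert a A - {j}. f j ^ (n + 1) * f k) = (\<Sum>k\<in>A - {j}. f j ^ (n + 1) * f k) + f j ^ (n + 1) * f a"
        if "j \<in> A" for j
      proof -
        have "insert a A - {j} = insert a (A - {j})" "a \<notin> A - {j}" using that insert by auto
        then show ?thesis using insert by (simp add: add.commute)
      qed
      then show ?thesis by (simp add: X1_def X3_def sum.distrib)
    qed
    then have dbl: "(\<Sum>j\<in>insert a A. \<Sum>k\<in>insert a A - {j}. f j ^ (n + 1) * f k) = X2 + (X1 + X3)"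
      using insert by (simp add: X2_def)
    have "S ^ (n + 1) \<le> c * (\<Sum>j\<in>A. f j ^ (n + 1))"
    proof (cases "A = {}")
      case False
      have "Max (f ` A) \<in> f ` A" using False insert(1) by (intro Max_in) auto
      then obtain m where m: "m \<in> A" "f m = Max (f ` A)" by (metis imageE)
      then have "f j \<le> f m" if "j \<in> A" for j using insert that by simp
      then have "S \<le> real (card A) * f m" unfolding S_def using sum_bounded_above[of A f "f m"] by simp
      then have "S ^ (n + 1) \<le> (real (card A) * f m) ^ (n + 1)" using S by (intro power_mono) auto
      also have "\<dots> = c * f m ^ (n + 1)" by (simp only: c_def power_mult_distrib)
      also have "\<dots> \<le> c * (\<Sum>j\<in>A. f j ^ (n + 1))"
        using m f insert c by (intro mult_left_mono member_le_sum) auto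
      finally show ?thesis .
    qed (simp add: S_def)
    then have "f a * S ^ (n + 1) \<le> f a * (c * (\<Sum>j\<in>A. f j ^ (n + 1)))" using f by (intro mult_left_mono) auto
    also have "\<dots> = c * X3" by (simp add: X3_def sum_distrib_left mult_ac)
    finally have S1: "f a * S ^ (n + 1) \<le> c * X3" .
    have S2: "f a ^ (n + 1) * S = X2" by (simp add: X2_def S_def sum_distrib_left)
    have "(f a + S) ^ (n + 2) \<le> f a ^ (n + 2) + S ^ (n + 2) + P * (f a ^ (n + 1) * S + f a * S ^ (n + 1))"
      unfolding P_def using f S by (intro power_sum2_le) auto
    also have "\<dots> \<le> f a ^ (n + 2) + ((\<Sum>j\<in>A. f j ^ (n + 2)) + C * X1) + P * (X2 + c * X3)"
      using C(2)[of f] f S1 S2 P by (intro add_mono mult_left_mono) (auto simp: S_def X1_def)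
    also have "\<dots> \<le> f a ^ (n + 2) + (\<Sum>j\<in>A. f j ^ (n + 2)) + (C + P + P * c) * (X2 + (X1 + X3))"
    proof -
      have "0 \<le> C * X2" "0 \<le> C * X3" "0 \<le> P * X1" "0 \<le> P * X3" "0 \<le> P * c * X1" "0 \<le> P * c * X2"
        using C P c pos by simp_all
      then show ?thesis by (simp add: algebra_simps)
    qed
    finally show ?thesis using insert dbl by (simp add: S_def)
  qed
  then show ?case using C P c by (intro exI[of _ "C + P + P * c"]) auto
qed

text \<open>Used twice: for the letters 1 and 2 with exponent 1, where the limit is the factor R,
  and for all letters with exponent \<alpha>, where the limit M governs the mass. The assumption
  \<open>square\<close> makes the second moments of the increments decay geometrically.\<close>

locale cascade_martingale = cascade_law N for N +
  fixes A :: "nat set" and \<theta> :: real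
  assumes A: "A \<subseteq> letters" "2 \<le> card A" and \<theta>: "0 < \<theta>"
    and mean: "(\<Sum>j\<in>A. mom j \<theta>) = 1" and square: "(\<Sum>j\<in>A. mom j (2 * \<theta>)) < 1"
begin

definition Y :: "nat \<Rightarrow> (nat list \<Rightarrow> nat \<Rightarrow> real) \<Rightarrow> real" where
  "Y n x = (\<Sum>i\<in>words A n. lprod i x powr \<theta>)"

definition Lim :: "(nat list \<Rightarrow> nat \<Rightarrow> real) \<Rightarrow> real" where
  "Lim x = lim (\<lambda>n. Y n x)"

definition z :: "(nat \<Rightarrow> real) \<Rightarrow> nat \<Rightarrow> real" where
  "z t j = clip (t j) powr \<theta>"

lemma finite_A [simp]: "finite A" using A finite_letters finite_subset by blast

lemma z_bounds: "0 \<le> z t j" "z t j \<le> 1"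
  using \<theta> powr_mono2[of \<theta> "clip (t j)" 1] by (auto simp: z_def)

lemma measurable_z [measurable]: "j \<in> A \<Longrightarrow> (\<lambda>t. z t j) \<in> borel_measurable N"
proof -
  assume "j \<in> A"
  then have [measurable]: "j \<in> letters" using A by auto
  show ?thesis unfolding z_def by measurable
qed

lemma Y_0: "Y 0 x = 1" by (simp add: Y_def)

lemma Y_Suc: "Y (Suc n) x = (\<Sum>j\<in>A. z (x []) j * Y n (branch j x))"
  by (simp add: Y_def sum_words_Suc z_def powr_mult sum_distrib_left)

lemma Y_nonneg: "0 \<le> Y n x" by (auto simp: Y_def intro!: sum_nonneg)

lemma words_A: "i \<in> words A n \<Longrightarrow> i \<in> lists letters"
  using A(1) mono_words wordsD(2) by blast

lemma measurable_Y [measurable]: "Y n \<in> borel_measurable \<Omega>"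
  unfolding Y_def[abs_def]
proof (rule borel_measurable_sum)
  fix i assume "i \<in> words A n"
  then have [measurable]: "i \<in> lists letters" by (rule words_A)
  show "(\<lambda>x. lprod i x powr \<theta>) \<in> borel_measurable \<Omega>" by measurable
qed

lemma measurable_Lim [measurable]: "Lim \<in> borel_measurable \<Omega>"
  unfolding Lim_def[abs_def] by (intro borel_measurable_lim_metric measurable_Y)

lemma Y_bounded: "\<exists>B\<ge>1. \<forall>x. Y n x \<le> B"
proof (intro exI conjI allI)
  fix x
  have "Y n x \<le> (\<Sum>i\<in>words A n. 1)"
    unfolding Y_def using \<theta> powr_mono2[of \<theta> "lprod _ x" 1] by (intro sum_mono) simp
  then show "Y n x \<le> 1 + real (card (words A n))" by simp
qed simp

lemma integrable_Y: "integrable \<Omega> (Y n)"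
proof -
  obtain B where "\<And>x. Y n x \<le> B" using Y_bounded by blast
  then show ?thesis using Y_nonneg by (intro integrable_const_bound[of _ B]) auto
qed

lemma nn_integral_Y: "(\<integral>\<^sup>+x. ennreal (Y n x) \<partial>\<Omega>) = 1"
proof -
  have "(\<integral>\<^sup>+x. ennreal (Y n x) \<partial>\<Omega>) = (\<integral>\<^sup>+x. (\<Sum>i\<in>words A n. ennreal (lprod i x powr \<theta>) * 1) \<partial>\<Omega>)"
    by (intro nn_integral_cong) (simp add: Y_def)
  also have "\<dots> = 1" by (subst nn_integral_level[OF A(1)]) (auto simp: mean emeasure_space_1)
  finally show ?thesis .
qed

lemma integral_Y: "(\<integral>x. Y n x \<partial>\<Omega>) = 1"
  using nn_integral_Y Y_nonneg by (intro integral_eq_nn_integral[THEN trans]) auto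

definition \<Delta> :: "nat \<Rightarrow> (nat list \<Rightarrow> nat \<Rightarrow> real) \<Rightarrow> real" where
  "\<Delta> n x = Y (Suc n) x - Y n x"

lemma measurable_\<Delta> [measurable]: "\<Delta> n \<in> borel_measurable \<Omega>"
  unfolding \<Delta>_def[abs_def] by measurable

lemma \<Delta>_Suc: "\<Delta> (Suc n) x = (\<Sum>j\<in>A. z (x []) j * \<Delta> n (branch j x))"
  by (simp add: \<Delta>_def Y_Suc[of "Suc n"] Y_Suc[of n x] sum_subtractf right_diff_distrib)

lemma \<Delta>_bounded: "\<exists>B\<ge>1. \<forall>x. \<bar>\<Delta> n x\<bar> \<le> B"
proof -
  obtain B B' where "1 \<le> B" "1 \<le> B'" "\<And>x. Y n x \<le> B" "\<And>x. Y (Suc n) x \<le> B'" using Y_bounded by metis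
  then have "\<bar>\<Delta> n x\<bar> \<le> B + B'" for x
    using Y_nonneg[of n x] Y_nonneg[of "Suc n" x] unfolding \<Delta>_def by (smt (verit))
  then show ?thesis using \<open>1 \<le> B\<close> \<open>1 \<le> B'\<close> by (intro exI[of _ "B + B'"]) auto
qed

lemma integral_\<Delta>: "(\<integral>x. \<Delta> n x \<partial>\<Omega>) = 0"
  unfolding \<Delta>_def using integrable_Y integral_Y by simp

text \<open>In the square of the recursion \<open>\<Delta>_Suc\<close> the off-diagonal terms
  vanish, as increments of distinct branches are independent and centred; the diagonal terms
  contribute the moments of order \<open>2 * \<theta>\<close>.\<close>

lemma second_moment_\<Delta>:
  "(\<integral>\<^sup>+x. ennreal ((\<Delta> (Suc n) x)\<^sup>2) \<partial>\<Omega>) = (\<Sum>j\<in>A. mom j (2 * \<theta>)) * (\<integral>\<^sup>+x. ennreal ((\<Delta> n x)\<^sup>2) \<partial>\<Omega>)"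
proof -
  obtain B where B: "1 \<le> B" "\<And>x. \<bar>\<Delta> n x\<bar> \<le> B" using \<Delta>_bounded by blast
  let ?f = "\<lambda>j k x. z (x []) j * z (x []) k * (\<Delta> n (branch j x) * \<Delta> n (branch k x))"
  have zz: "\<bar>z t j * z t k\<bar> \<le> 1" for t j k
    using z_bounds[of t j] z_bounds[of t k] mult_mono[of "z t j" 1 "z t k" 1] by (simp add: abs_mult)
  have m [measurable]: "?f j k \<in> borel_measurable \<Omega>" if [measurable]: "j \<in> A" "k \<in> A" for j k
  proof -
    have [measurable]: "j \<in> letters" "k \<in> letters" using that A by auto
    have [measurable]: "(\<lambda>x. z (x []) i) \<in> borel_measurable \<Omega>" if "i \<in> A" for i
      using measurable_compose[OF measurable_coord[of "[]"] measurable_z[OF that]] by simp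
    show ?thesis by measurable
  qed
  have int: "integrable \<Omega> (?f j k)" if "j \<in> A" "k \<in> A" for j k
  proof (rule integrable_const_bound[of _ "1 * (B * B)"])
    show "AE x in \<Omega>. norm (?f j k x) \<le> 1 * (B * B)"
    proof (rule AE_I2)
      fix x
      have "\<bar>\<Delta> n (branch j x) * \<Delta> n (branch k x)\<bar> \<le> B * B"
        unfolding abs_mult using B by (intro mult_mono) auto
      then show "norm (?f j k x) \<le> 1 * (B * B)"
        unfolding real_norm_def abs_mult[of "z (x []) j * z (x []) k"] using zz by (intro mult_mono) auto
    qed
  qed (use m that in auto)
  have zB: "\<bar>z t j * z t k\<bar> \<le> B" for t j k using zz[of t j k] B(1) by linarith
  have off: "(\<integral>x. ?f j k x \<partial>\<Omega>) = 0" if "j \<in> A" "k \<in> A" "j \<noteq> k" for j k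
  proof -
    have "(\<integral>x. ?f j k x \<partial>\<Omega>) = (\<integral>x. z (x []) j * z (x []) k \<partial>\<Omega>) * ((\<integral>x. \<Delta> n x \<partial>\<Omega>) * (\<integral>x. \<Delta> n x \<partial>\<Omega>))"
      using that A zB B(2) by (intro integral_branch2[where H = "\<lambda>t. z t j * z t k" and B = B]) auto
    then show ?thesis by (simp add: integral_\<Delta>)
  qed
  have sq: "(\<Delta> (Suc n) x)\<^sup>2 = (\<Sum>j\<in>A. \<Sum>k\<in>A. ?f j k x)" for x
    by (simp add: \<Delta>_Suc power2_eq_square sum_product mult_ac)
  have "(\<integral>\<^sup>+x. ennreal ((\<Delta> (Suc n) x)\<^sup>2) \<partial>\<Omega>) = ennreal (\<integral>x. (\<Delta> (Suc n) x)\<^sup>2 \<partial>\<Omega>)"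
    unfolding sq using int
    by (intro nn_integral_eq_integral Bochner_Integration.integrable_sum) (auto simp: sq[symmetric])
  also have "(\<integral>x. (\<Delta> (Suc n) x)\<^sup>2 \<partial>\<Omega>) = (\<Sum>j\<in>A. \<Sum>k\<in>A. \<integral>x. ?f j k x \<partial>\<Omega>)"
    unfolding sq using int by (simp add: Bochner_Integration.integral_sum Bochner_Integration.integrable_sum)
  also have "\<dots> = (\<Sum>j\<in>A. \<Sum>k\<in>A. if k = j then \<integral>x. ?f j j x \<partial>\<Omega> else 0)"
    by (intro sum.cong refl) (simp add: off)
  also have "\<dots> = (\<Sum>j\<in>A. \<integral>x. ?f j j x \<partial>\<Omega>)" by simp
  also have "ennreal \<dots> = (\<Sum>j\<in>A. ennreal (\<integral>x. ?f j j x \<partial>\<Omega>))"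
    by (intro sum_ennreal[symmetric] integral_nonneg_AE AE_I2) (simp add: z_bounds)
  also have "\<dots> = (\<Sum>j\<in>A. mom j (2 * \<theta>) * (\<integral>\<^sup>+x. ennreal ((\<Delta> n x)\<^sup>2) \<partial>\<Omega>))"
  proof (rule sum.cong[OF refl])
    fix j assume j: "j \<in> A"
    have "j \<in> letters" using j A by auto
    have "ennreal (\<integral>x. ?f j j x \<partial>\<Omega>) = (\<integral>\<^sup>+x. ennreal (?f j j x) \<partial>\<Omega>)"
      using int[OF j j] by (intro nn_integral_eq_integral[symmetric]) (auto simp: z_bounds)
    also have "\<dots> = (\<integral>\<^sup>+x. (\<lambda>t. ennreal (z t j * z t j)) (x []) * (\<lambda>x. ennreal ((\<Delta> n x)\<^sup>2)) (branch j x) \<partial>\<Omega>)"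
      by (intro nn_integral_cong) (simp add: ennreal_mult[symmetric] power2_eq_square z_bounds)
    also have "\<dots> = (\<integral>\<^sup>+t. ennreal (z t j * z t j) \<partial>N) * (\<integral>\<^sup>+x. ennreal ((\<Delta> n x)\<^sup>2) \<partial>\<Omega>)"
      using j by (intro nn_integral_branch \<open>j \<in> letters\<close>) auto
    also have "(\<integral>\<^sup>+t. ennreal (z t j * z t j) \<partial>N) = mom j (2 * \<theta>)"
      unfolding mom_def z_def by (intro nn_integral_cong) (simp add: powr_add[symmetric])
    finally show "ennreal (\<integral>x. ?f j j x \<partial>\<Omega>) = mom j (2 * \<theta>) * (\<integral>\<^sup>+x. ennreal ((\<Delta> n x)\<^sup>2) \<partial>\<Omega>)" .
  qed
  finally show ?thesis by (simp add: sum_distrib_right)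
qed

lemma sum_\<Delta>_finite: "(\<Sum>n. \<integral>\<^sup>+x. ennreal \<bar>\<Delta> n x\<bar> \<partial>\<Omega>) < \<infinity>"
proof -
  obtain \<rho> where \<rho>: "0 \<le> \<rho>" "(\<Sum>j\<in>A. mom j (2 * \<theta>)) = ennreal \<rho>" "\<rho> < 1"
    using square by (cases "\<Sum>j\<in>A. mom j (2 * \<theta>)") (auto simp: ennreal_less_one_iff)
  obtain B where B: "1 \<le> B" "\<And>x. \<bar>\<Delta> 0 x\<bar> \<le> B" using \<Delta>_bounded by blast
  \<comment> \<open>A rate with \<open>\<rho> \<le> r\<^sup>2\<close> and \<open>r < 1\<close>;
    averaging \<open>\<rho>\<close> with 1 also makes it positive.\<close>
  define r where "r = sqrt ((1 + \<rho>) / 2)"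
  have r: "0 < r" "r < 1" "\<rho> \<le> r\<^sup>2" using \<rho> by (auto simp: r_def)
  define D where "D = B\<^sup>2"
  have V: "(\<integral>\<^sup>+x. ennreal ((\<Delta> n x)\<^sup>2) \<partial>\<Omega>) \<le> ennreal (D * (r\<^sup>2) ^ n)" for n
  proof (induction n)
    case 0
    have "(\<integral>\<^sup>+x. ennreal ((\<Delta> 0 x)\<^sup>2) \<partial>\<Omega>) \<le> (\<integral>\<^sup>+x. ennreal D \<partial>\<Omega>)"
      using B by (intro nn_integral_mono ennreal_leI) (auto simp: D_def abs_le_square_iff[symmetric])
    then show ?case by (simp add: emeasure_space_1)
  next
    case (Suc n)
    have "(\<integral>\<^sup>+x. ennreal ((\<Delta> (Suc n) x)\<^sup>2) \<partial>\<Omega>) \<le> ennreal (r\<^sup>2) * ennreal (D * (r\<^sup>2) ^ n)"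
      unfolding second_moment_\<Delta> \<rho>(2) using r by (intro mult_mono Suc.IH ennreal_leI) auto
    then show ?case by (simp add: ennreal_mult[symmetric] mult_ac D_def)
  qed
  have "(\<integral>\<^sup>+x. ennreal \<bar>\<Delta> n x\<bar> \<partial>\<Omega>) \<le> ennreal ((D + 1) * r ^ n)" for n
  proof -
    have le: "\<bar>\<Delta> n x\<bar> \<le> 1 / r ^ n * (\<Delta> n x)\<^sup>2 + r ^ n" for x
    proof (cases "\<bar>\<Delta> n x\<bar> \<le> r ^ n")
      case True
      moreover have "0 \<le> 1 / r ^ n * (\<Delta> n x)\<^sup>2" using r by simp
      ultimately show ?thesis by linarith
    next
      case False
      then have "\<bar>\<Delta> n x\<bar> * r ^ n \<le> \<bar>\<Delta> n x\<bar> * \<bar>\<Delta> n x\<bar>" by (intro mult_left_mono) auto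
      then have "\<bar>\<Delta> n x\<bar> \<le> 1 / r ^ n * (\<Delta> n x)\<^sup>2" using r by (simp add: field_simps power2_eq_square)
      then show ?thesis using r by (smt (verit) zero_le_power)
    qed
    have "(\<integral>\<^sup>+x. ennreal \<bar>\<Delta> n x\<bar> \<partial>\<Omega>) \<le> (\<integral>\<^sup>+x. ennreal (1 / r ^ n) * ennreal ((\<Delta> n x)\<^sup>2) + ennreal (r ^ n) \<partial>\<Omega>)"
      using le r by (intro nn_integral_mono) (simp add: ennreal_mult[symmetric] ennreal_plus[symmetric] ennreal_leI del: ennreal_plus)
    also have "\<dots> = ennreal (1 / r ^ n) * (\<integral>\<^sup>+x. ennreal ((\<Delta> n x)\<^sup>2) \<partial>\<Omega>) + ennreal (r ^ n)"
      by (simp add: nn_integral_add nn_integral_cmult emeasure_space_1)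
    also have "\<dots> \<le> ennreal (1 / r ^ n) * ennreal (D * (r\<^sup>2) ^ n) + ennreal (r ^ n)"
      by (intro add_right_mono mult_left_mono V) auto
    also have "\<dots> = ennreal ((D + 1) * r ^ n)"
    proof -
      have "1 / r ^ n * (D * (r\<^sup>2) ^ n) = D * r ^ n"
        using r by (simp add: power2_eq_square power_mult_distrib)
      moreover have "ennreal (1 / r ^ n) * ennreal (D * (r\<^sup>2) ^ n) = ennreal (1 / r ^ n * (D * (r\<^sup>2) ^ n))"
        using r by (intro ennreal_mult[symmetric]) (auto simp: D_def)
      ultimately have "ennreal (1 / r ^ n) * ennreal (D * (r\<^sup>2) ^ n) = ennreal (D * r ^ n)" by simp
      moreover have "ennreal (D * r ^ n) + ennreal (r ^ n) = ennreal (D * r ^ n + r ^ n)"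
        using r by (intro ennreal_plus[symmetric]) (auto simp: D_def)
      ultimately show ?thesis by (simp add: distrib_right)
    qed
    finally show ?thesis .
  qed
  then have "(\<Sum>n. \<integral>\<^sup>+x. ennreal \<bar>\<Delta> n x\<bar> \<partial>\<Omega>) \<le> (\<Sum>n. ennreal ((D + 1) * r ^ n))"
    by (intro suminf_le) auto
  also have "\<dots> < \<infinity>"
  proof -
    have "summable (\<lambda>n. (D + 1) * r ^ n)" using r by (intro summable_mult summable_geometric) auto
    then show ?thesis using r by (subst suminf_ennreal2) (auto simp: D_def)
  qed
  finally show ?thesis .
qed

section \<open>Convergence, mean and positivity of the limit\<close>

lemma AE_summable_\<Delta>: "AE x in \<Omega>. summable (\<lambda>n. \<bar>\<Delta> n x\<bar>)"
  using sum_\<Delta>_finite by (intro AE_summable) auto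

lemma Y_telescope: "Y n x = 1 + (\<Sum>k<n. \<Delta> k x)"
  using sum_lessThan_telescope[of "\<lambda>n. Y n x" n] by (simp add: \<Delta>_def Y_0)

text \<open>Absolute summability of the increments takes the place of the martingale convergence
  theorem.\<close>

lemma AE_Y_tendsto: "AE x in \<Omega>. (\<lambda>n. Y n x) \<longlonglongrightarrow> Lim x"
  using AE_summable_\<Delta>
proof eventually_elim
  case (elim x)
  then have "summable (\<lambda>n. \<Delta> n x)" by (rule summable_rabs_cancel)
  then have "convergent (\<lambda>n. \<Sum>k<n. \<Delta> k x)" by (simp add: summable_iff_convergent)
  then have "convergent (\<lambda>n. 1 + (\<Sum>k<n. \<Delta> k x))" by (intro convergent_add convergent_const)
  then show ?case unfolding Lim_def Y_telescope by (simp add: convergent_LIMSEQ_iff)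
qed

text \<open>All \<open>Y n\<close> are dominated by 1 plus the sum of the absolute increments, which
  is integrable, so the mean 1 survives. This excludes the identically vanishing limit in
  \<open>AE_Lim_pos\<close>.\<close>

lemma integral_Lim: "(\<integral>x. Lim x \<partial>\<Omega>) = 1"
proof -
  let ?w = "\<lambda>x. 1 + (\<Sum>n. \<bar>\<Delta> n x\<bar>)"
  have "(\<integral>\<^sup>+x. (\<Sum>n. ennreal \<bar>\<Delta> n x\<bar>) \<partial>\<Omega>) < \<infinity>"
    using sum_\<Delta>_finite by (subst nn_integral_suminf) auto
  moreover have "(\<integral>\<^sup>+x. (\<Sum>n. ennreal \<bar>\<Delta> n x\<bar>) \<partial>\<Omega>) = (\<integral>\<^sup>+x. ennreal (\<Sum>n. \<bar>\<Delta> n x\<bar>) \<partial>\<Omega>)"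
  proof (rule nn_integral_cong_AE)
    show "AE x in \<Omega>. (\<Sum>n. ennreal \<bar>\<Delta> n x\<bar>) = ennreal (\<Sum>n. \<bar>\<Delta> n x\<bar>)"
      using AE_summable_\<Delta> by eventually_elim (simp add: suminf_ennreal2)
  qed
  moreover have "AE x in \<Omega>. 0 \<le> (\<Sum>n. \<bar>\<Delta> n x\<bar>)"
    using AE_summable_\<Delta> by eventually_elim (simp add: suminf_nonneg)
  ultimately have "integrable \<Omega> (\<lambda>x. \<Sum>n. \<bar>\<Delta> n x\<bar>)"
    by (intro integrableI_nonneg) auto
  then have w: "integrable \<Omega> ?w" by simp
  have "AE x in \<Omega>. norm (Y n x) \<le> ?w x" for n
    using AE_summable_\<Delta>
  proof eventually_elim
    case (elim x)
    have "\<bar>Y n x\<bar> \<le> 1 + (\<Sum>k<n. \<bar>\<Delta> k x\<bar>)"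
      unfolding Y_telescope using sum_abs[of "\<lambda>k. \<Delta> k x" "{..<n}"] by linarith
    also have "\<dots> \<le> ?w x" using elim by (intro add_left_mono sum_le_suminf) auto
    finally show ?case by simp
  qed
  then have "(\<lambda>n. \<integral>x. Y n x \<partial>\<Omega>) \<longlonglongrightarrow> (\<integral>x. Lim x \<partial>\<Omega>)"
    by (intro integral_dominated_convergence[OF _ _ w AE_Y_tendsto]) auto
  then show ?thesis by (simp add: integral_Y LIMSEQ_const_iff)
qed

lemma Lim_branches:
  assumes "\<And>j. j \<in> A \<Longrightarrow> (\<lambda>n. Y n (branch j x)) \<longlonglongrightarrow> Lim (branch j x)"
  shows "Lim x = (\<Sum>j\<in>A. z (x []) j * Lim (branch j x))"
proof -
  have "(\<lambda>n. Y (Suc n) x) \<longlonglongrightarrow> (\<Sum>j\<in>A. z (x []) j * Lim (branch j x))"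
    unfolding Y_Suc by (intro tendsto_sum tendsto_mult tendsto_const assms)
  then show ?thesis unfolding Lim_def by (intro limI) (rule LIMSEQ_imp_Suc)
qed

lemma AE_subtrees_tendsto: "AE x in \<Omega>. \<forall>i\<in>lists letters. (\<lambda>n. Y n (subtree i x)) \<longlonglongrightarrow> Lim (subtree i x)"
  by (rule AE_subtrees[OF AE_Y_tendsto])

lemma Lim_nonneg: "(\<lambda>n. Y n x) \<longlonglongrightarrow> Lim x \<Longrightarrow> 0 \<le> Lim x"
  using Y_nonneg by (intro LIMSEQ_le_const) auto

text \<open>The probability \<open>q\<close> of degeneracy satisfies \<open>q = q ^ card A\<close>.\<close>

lemma AE_Lim_pos: "AE x in \<Omega>. 0 < Lim x"
proof -
  define G where "G x = (of_bool (Lim x = 0) :: ennreal)" for x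
  have [measurable]: "G \<in> borel_measurable \<Omega>" unfolding G_def by measurable
  define q where "q = (\<integral>\<^sup>+x. G x \<partial>\<Omega>)"
  have "AE x in \<Omega>. G x = 1 * (\<Prod>j\<in>letters. (if j \<in> A then G else (\<lambda>_. 1)) (branch j x))"
    using AE_subtrees_tendsto AE_weights_pos
  proof eventually_elim
    case (elim x)
    have t: "(\<lambda>n. Y n (branch j x)) \<longlonglongrightarrow> Lim (branch j x)" if "j \<in> A" for j
      using elim(1)[rule_format, of "[j]"] that A by auto
    have zp: "0 < z (x []) j" if "j \<in> A" for j
    proof -
      have "0 < x [] j" using elim(2) that A by blast
      then have "clip (x [] j) \<noteq> 0" by (simp add: clip_def)
      then show ?thesis by (simp add: z_def)
    qed
    have "Lim x = 0 \<longleftrightarrow> (\<forall>j\<in>A. Lim (branch j x) = 0)"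
    proof -
      have "Lim x = 0 \<longleftrightarrow> (\<forall>j\<in>A. z (x []) j * Lim (branch j x) = 0)"
      proof -
        have "Lim x = (\<Sum>j\<in>A. z (x []) j * Lim (branch j x))" by (rule Lim_branches) (rule t)
        then show ?thesis using Lim_nonneg[OF t] z_bounds by (simp add: sum_nonneg_eq_0_iff)
      qed
      also have "\<dots> \<longleftrightarrow> (\<forall>j\<in>A. Lim (branch j x) = 0)" using zp by force
      finally show ?thesis .
    qed
    moreover have "(\<Prod>j\<in>letters. (if j \<in> A then G else (\<lambda>_. 1)) (branch j x)) = (\<Prod>j\<in>A. G (branch j x))"
      using A by (intro prod.mono_neutral_cong_right) auto
    moreover have "(\<Prod>j\<in>A. G (branch j x)) = of_bool (\<forall>j\<in>A. Lim (branch j x) = 0)"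
      by (auto simp: G_def prod_zero_iff intro!: prod.neutral)
    ultimately show ?case by (simp add: G_def)
  qed
  then have "q = (\<integral>\<^sup>+x. (\<lambda>_. 1) (x []) * (\<Prod>j\<in>letters. (if j \<in> A then G else (\<lambda>_. 1)) (branch j x)) \<partial>\<Omega>)"
    unfolding q_def by (intro nn_integral_cong_AE) simp
  also have "\<dots> = (\<integral>\<^sup>+t. 1 \<partial>N) * (\<Prod>j\<in>letters. \<integral>\<^sup>+x. (if j \<in> A then G else (\<lambda>_. 1)) x \<partial>\<Omega>)"
    by (rule nn_integral_branches[where H = "\<lambda>_. 1" and G = "\<lambda>j. if j \<in> A then G else (\<lambda>_. 1)"]) auto
  also have "(\<Prod>j\<in>letters. \<integral>\<^sup>+x. (if j \<in> A then G else (\<lambda>_. 1)) x \<partial>\<Omega>) = (\<Prod>j\<in>A. q)"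
    unfolding q_def by (intro prod.mono_neutral_cong_right) (use A in \<open>auto simp: emeasure_space_1\<close>)
  also have "(\<integral>\<^sup>+t. 1 \<partial>N) = 1" by (simp add: N.emeasure_space_1)
  finally have q_eq: "q = q ^ card A" by simp
  have "q \<le> (\<integral>\<^sup>+x. 1 \<partial>\<Omega>)" unfolding q_def by (intro nn_integral_mono) (simp add: G_def)
  then have "q \<le> 1" by (simp add: emeasure_space_1)
  then obtain p where p: "q = ennreal p" "0 \<le> p" "p \<le> 1" by (cases q) (auto simp: ennreal_le_1 top_unique)
  have "q \<noteq> 1"
  proof
    assume "q = 1"
    have "(\<integral>\<^sup>+x. (1 - G x) \<partial>\<Omega>) = (\<integral>\<^sup>+x. 1 \<partial>\<Omega>) - (\<integral>\<^sup>+x. G x \<partial>\<Omega>)"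
    proof (rule nn_integral_diff)
      show "(\<integral>\<^sup>+x. G x \<partial>\<Omega>) \<noteq> \<infinity>" using \<open>q = 1\<close> by (simp add: q_def[symmetric])
      show "AE x in \<Omega>. G x \<le> 1" by (simp add: G_def)
    qed simp_all
    then have "(\<integral>\<^sup>+x. (1 - G x) \<partial>\<Omega>) = 0" using \<open>q = 1\<close> by (simp add: q_def[symmetric] emeasure_space_1)
    then have "AE x in \<Omega>. 1 - G x = 0" by (subst (asm) nn_integral_0_iff_AE) auto
    then have "AE x in \<Omega>. Lim x = 0"
    proof eventually_elim
      case (elim x)
      then show ?case by (cases "Lim x = 0") (simp_all add: G_def)
    qed
    then have "(\<integral>x. Lim x \<partial>\<Omega>) = (\<integral>x. 0 \<partial>\<Omega>)" by (intro integral_cong_AE) auto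
    then show False by (simp add: integral_Lim)
  qed
  then have "p < 1" using p by (auto simp: less_le)
  have "p = p ^ card A" using q_eq p by (simp add: ennreal_power)
  then have "p = 0"
  proof (rule contrapos_pp)
    assume "p \<noteq> 0"
    then have "0 < p" using p by simp
    have "p ^ card A \<le> p ^ 2" using p A by (intro power_decreasing) auto
    also have "\<dots> < p" using \<open>0 < p\<close> \<open>p < 1\<close> by (simp add: power2_eq_square)
    finally show "p \<noteq> p ^ card A" by simp
  qed
  then have "(\<integral>\<^sup>+x. G x \<partial>\<Omega>) = 0" using p by (simp add: q_def)
  then have "AE x in \<Omega>. G x = 0" by (subst (asm) nn_integral_0_iff_AE) auto
  then show ?thesis
    using AE_Y_tendsto
  proof eventually_elim
    case (elim x)
    then show ?case using Lim_nonneg[OF elim(2)] by (cases "Lim x = 0") (simp_all add: G_def)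
  qed
qed

lemma AE_Lim_good: "AE x in \<Omega>. \<forall>i\<in>lists letters. (\<lambda>n. Y n (subtree i x)) \<longlonglongrightarrow> Lim (subtree i x) \<and>
    0 < Lim (subtree i x) \<and>
    Lim (subtree i x) = (\<Sum>j\<in>A. clip (subtree i x [] j) powr \<theta> * Lim (subtree (i @ [j]) x))"
  using AE_subtrees_tendsto AE_subtrees[OF AE_Lim_pos]
proof eventually_elim
  case (elim x)
  show ?case
  proof
    fix i assume i: "i \<in> lists letters"
    have "(\<lambda>n. Y n (branch j (subtree i x))) \<longlonglongrightarrow> Lim (branch j (subtree i x))" if "j \<in> A" for j
      using elim(1)[rule_format, of "i @ [j]"] i that A by (auto simp: subtree_append)
    then have "Lim (subtree i x) = (\<Sum>j\<in>A. clip (subtree i x [] j) powr \<theta> * Lim (subtree (i @ [j]) x))"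
      using Lim_branches[of "subtree i x"] by (simp add: z_def subtree_append)
    then show "(\<lambda>n. Y n (subtree i x)) \<longlonglongrightarrow> Lim (subtree i x) \<and> 0 < Lim (subtree i x) \<and>
      Lim (subtree i x) = (\<Sum>j\<in>A. clip (subtree i x [] j) powr \<theta> * Lim (subtree (i @ [j]) x))"
      using elim i by blast
  qed
qed

text \<open>Induction on the exponent. In the recursion over the branches the pure powers contract:
  as z is at most 1, its power \<open>p + 2\<close> is at most its square, which leaves the factor
  \<open>\<rho>\<close> < 1. The mixed terms, with z bounded by 1, factorise by independence into a
  lower moment, at most \<open>K\<close>, and the mean 1.\<close>

lemma moment_Y: "\<exists>K\<ge>1. \<forall>n. (\<integral>\<^sup>+x. ennreal (Y n x ^ (p + 1)) \<partial>\<Omega>) \<le> ennreal K"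
proof (induction p)
  case 0
  then show ?case by (intro exI[of _ 1]) (simp add: nn_integral_Y)
next
  case (Suc p)
  then obtain K where K: "1 \<le> K" "\<And>n. (\<integral>\<^sup>+x. ennreal (Y n x ^ (p + 1)) \<partial>\<Omega>) \<le> ennreal K" by blast
  obtain C where C: "0 \<le> C" "\<And>f :: nat \<Rightarrow> real. (\<forall>j\<in>A. 0 \<le> f j) \<Longrightarrow>
    (\<Sum>j\<in>A. f j) ^ (p + 2) \<le> (\<Sum>j\<in>A. f j ^ (p + 2)) + C * (\<Sum>j\<in>A. \<Sum>k\<in>A - {j}. f j ^ (p + 1) * f k)"
    using power_sum_le[OF finite_A, of p] by blast
  obtain \<rho> where \<rho>: "0 \<le> \<rho>" "(\<Sum>j\<in>A. mom j (2 * \<theta>)) = ennreal \<rho>" "\<rho> < 1"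
    using square by (cases "\<Sum>j\<in>A. mom j (2 * \<theta>)") (auto simp: ennreal_less_one_iff)
  define D where "D = C * (real (card A) * real (card A) * K)"
  have D: "0 \<le> D" using C K by (simp add: D_def)
  \<comment> \<open>The fixed point of the affine recursion \<open>\<rho> * t + D\<close>, increased
    by 1 to cover the start at n = 0.\<close>
  define L where "L = 1 + D / (1 - \<rho>)"
  have L: "1 \<le> L" "\<rho> * L + D \<le> L"
  proof -
    show "1 \<le> L" using D \<rho> by (simp add: L_def)
    have "D = (1 - \<rho>) * (L - 1)" using \<rho> by (simp add: L_def)
    then show "\<rho> * L + D \<le> L" using \<rho> by (simp add: algebra_simps)
  qed
  have "(\<integral>\<^sup>+x. ennreal (Y n x ^ (p + 2)) \<partial>\<Omega>) \<le> ennreal L" for n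
  proof (induction n)
    case 0
    then show ?case using L by (simp add: Y_0 emeasure_space_1)
  next
    case (Suc n)
    let ?U = "\<integral>\<^sup>+x. ennreal (Y n x ^ (p + 2)) \<partial>\<Omega>"
    have mz: "(\<lambda>x. z (x []) j) \<in> borel_measurable \<Omega>" if "j \<in> A" for j
      using measurable_compose[OF measurable_coord[of "[]"] measurable_z[OF that]] by simp
    have mY: "(\<lambda>x. Y n (branch j x)) \<in> borel_measurable \<Omega>" if "j \<in> A" for j
      using that A by (intro measurable_compose[OF measurable_branch measurable_Y]) auto
    let ?a = "\<lambda>j x. ennreal ((z (x []) j * Y n (branch j x)) ^ (p + 2))"
    let ?b = "\<lambda>j k x. ennreal ((z (x []) j * Y n (branch j x)) ^ (p + 1) * (z (x []) k * Y n (branch k x)))"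
    have pos: "0 \<le> z (x []) j * Y n (branch j x)" for j x using z_bounds Y_nonneg by simp
    have "(\<integral>\<^sup>+x. ennreal (Y (Suc n) x ^ (p + 2)) \<partial>\<Omega>)
      \<le> (\<integral>\<^sup>+x. (\<Sum>j\<in>A. ?a j x) + ennreal C * (\<Sum>j\<in>A. \<Sum>k\<in>A - {j}. ?b j k x) \<partial>\<Omega>)"
    proof (rule nn_integral_mono)
      fix x
      have "ennreal (Y (Suc n) x ^ (p + 2)) \<le> ennreal ((\<Sum>j\<in>A. (z (x []) j * Y n (branch j x)) ^ (p + 2)) + C *
        (\<Sum>j\<in>A. \<Sum>k\<in>A - {j}. (z (x []) j * Y n (branch j x)) ^ (p + 1) * (z (x []) k * Y n (branch k x))))"
        unfolding Y_Suc using pos by (intro ennreal_leI C(2)) auto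
      also have "\<dots> = (\<Sum>j\<in>A. ?a j x) + ennreal C * (\<Sum>j\<in>A. \<Sum>k\<in>A - {j}. ?b j k x)"
      proof -
        let ?w = "\<lambda>j. z (x []) j * Y n (branch j x)"
        let ?S1 = "\<Sum>j\<in>A. ?w j ^ (p + 2)" and ?S2 = "\<Sum>j\<in>A. \<Sum>k\<in>A - {j}. ?w j ^ (p + 1) * ?w k"
        have w: "0 \<le> ?w j ^ m" "0 \<le> ?w j ^ m * ?w k" for j k m
          using pos[of x j] pos[of x k] by (auto intro!: mult_nonneg_nonneg[of "_ ^ _"])
        have "ennreal ?S1 = (\<Sum>j\<in>A. ?a j x)"
          by (intro sum_ennreal[symmetric] w)
        moreover have "ennreal ?S2 = (\<Sum>j\<in>A. ennreal (\<Sum>k\<in>A - {j}. ?w j ^ (p + 1) * ?w k))"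
          by (intro sum_ennreal[symmetric] sum_nonneg w)
        moreover have "\<dots> = (\<Sum>j\<in>A. \<Sum>k\<in>A - {j}. ?b j k x)"
          by (intro sum.cong refl sum_ennreal[symmetric] w)
        moreover have "ennreal (?S1 + C * ?S2) = ennreal ?S1 + ennreal (C * ?S2)"
          using C by (intro ennreal_plus sum_nonneg mult_nonneg_nonneg w)
        moreover have "ennreal (C * ?S2) = ennreal C * ennreal ?S2"
          using C by (intro ennreal_mult sum_nonneg w)
        ultimately show ?thesis by simp
      qed
      finally show "ennreal (Y (Suc n) x ^ (p + 2)) \<le> (\<Sum>j\<in>A. ?a j x) + ennreal C * (\<Sum>j\<in>A. \<Sum>k\<in>A - {j}. ?b j k x)" .
    qed
    also have "\<dots> = (\<Sum>j\<in>A. \<integral>\<^sup>+x. ?a j x \<partial>\<Omega>) + ennreal C * (\<Sum>j\<in>A. \<Sum>k\<in>A - {j}. \<integral>\<^sup>+x. ?b j k x \<partial>\<Omega>)"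
    proof -
      have ma: "?a j \<in> borel_measurable \<Omega>" if "j \<in> A" for j using mz[OF that] mY[OF that] by measurable
      have mb: "?b j k \<in> borel_measurable \<Omega>" if "j \<in> A" "k \<in> A - {j}" for j k
      proof -
        have k: "k \<in> A" using that by simp
        show ?thesis using mz[OF that(1)] mY[OF that(1)] mz[OF k] mY[OF k] by measurable
      qed
      have m1: "(\<lambda>x :: nat list \<Rightarrow> nat \<Rightarrow> real. \<Sum>j\<in>A. ?a j x) \<in> borel_measurable \<Omega>" by (intro borel_measurable_sum ma)
      have m2: "(\<lambda>x :: nat list \<Rightarrow> nat \<Rightarrow> real. \<Sum>j\<in>A. \<Sum>k\<in>A - {j}. ?b j k x) \<in> borel_measurable \<Omega>" by (intro borel_measurable_sum mb)
      have "(\<integral>\<^sup>+x. (\<Sum>j\<in>A. ?a j x) + ennreal C * (\<Sum>j\<in>A. \<Sum>k\<in>A - {j}. ?b j k x) \<partial>\<Omega>)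
        = (\<integral>\<^sup>+x. (\<Sum>j\<in>A. ?a j x) \<partial>\<Omega>) + ennreal C * (\<integral>\<^sup>+x. (\<Sum>j\<in>A. \<Sum>k\<in>A - {j}. ?b j k x) \<partial>\<Omega>)"
        using m1 m2 by (simp only: nn_integral_add nn_integral_cmult borel_measurable_times_ennreal borel_measurable_const)
      also have "(\<integral>\<^sup>+x. (\<Sum>j\<in>A. ?a j x) \<partial>\<Omega>) = (\<Sum>j\<in>A. \<integral>\<^sup>+x. ?a j x \<partial>\<Omega>)"
        by (intro nn_integral_sum ma)
      also have "(\<integral>\<^sup>+x. (\<Sum>j\<in>A. \<Sum>k\<in>A - {j}. ?b j k x) \<partial>\<Omega>) = (\<Sum>j\<in>A. \<integral>\<^sup>+x. (\<Sum>k\<in>A - {j}. ?b j k x) \<partial>\<Omega>)"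
        by (intro nn_integral_sum borel_measurable_sum mb)
      also have "\<dots> = (\<Sum>j\<in>A. \<Sum>k\<in>A - {j}. \<integral>\<^sup>+x. ?b j k x \<partial>\<Omega>)"
        by (intro sum.cong refl nn_integral_sum mb)
      finally show ?thesis .
    qed
    also have "\<dots> \<le> (\<Sum>j\<in>A. mom j (2 * \<theta>) * ?U) + ennreal C * (\<Sum>j\<in>A. \<Sum>k\<in>A - {j}. ennreal K)"
    proof (intro add_mono sum_mono mult_left_mono)
      fix j assume j: "j \<in> A"
      then have jl: "j \<in> letters" using A by auto
      have "(\<integral>\<^sup>+x. ?a j x \<partial>\<Omega>) \<le> (\<integral>\<^sup>+x. (\<lambda>t. ennreal (z t j * z t j)) (x []) * (\<lambda>x. ennreal (Y n x ^ (p + 2))) (branch j x) \<partial>\<Omega>)"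
      proof (rule nn_integral_mono)
        fix x :: "nat list \<Rightarrow> nat \<Rightarrow> real"
        have "z (x []) j ^ (p + 2) \<le> z (x []) j ^ 2" using z_bounds by (intro power_decreasing) auto
        then have "(z (x []) j * Y n (branch j x)) ^ (p + 2) \<le> z (x []) j * z (x []) j * Y n (branch j x) ^ (p + 2)"
          unfolding power_mult_distrib power2_eq_square using Y_nonneg by (intro mult_right_mono) auto
        then show "?a j x \<le> (\<lambda>t. ennreal (z t j * z t j)) (x []) * (\<lambda>x. ennreal (Y n x ^ (p + 2))) (branch j x)"
          using z_bounds Y_nonneg by (simp add: ennreal_mult[symmetric] ennreal_leI)
      qed
      also have "\<dots> = (\<integral>\<^sup>+t. ennreal (z t j * z t j) \<partial>N) * ?U"
        using j jl by (intro nn_integral_branch) auto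
      also have "(\<integral>\<^sup>+t. ennreal (z t j * z t j) \<partial>N) = mom j (2 * \<theta>)"
        unfolding mom_def z_def by (intro nn_integral_cong) (simp add: powr_add[symmetric])
      finally show "(\<integral>\<^sup>+x. ?a j x \<partial>\<Omega>) \<le> mom j (2 * \<theta>) * ?U" .
      fix k assume k: "k \<in> A - {j}"
      then have kl: "k \<in> letters" "j \<noteq> k" using A by auto
      have "(\<integral>\<^sup>+x. ?b j k x \<partial>\<Omega>) \<le> (\<integral>\<^sup>+x. (\<lambda>_. 1) (x []) * ((\<lambda>x. ennreal (Y n x ^ (p + 1))) (branch j x) * (\<lambda>x. ennreal (Y n x)) (branch k x)) \<partial>\<Omega>)"
      proof (rule nn_integral_mono)
        fix x
        have "(z (x []) j * Y n (branch j x)) ^ (p + 1) \<le> (1 * Y n (branch j x)) ^ (p + 1)"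
          using pos z_bounds Y_nonneg by (intro power_mono mult_right_mono) auto
        moreover have "z (x []) k * Y n (branch k x) \<le> 1 * Y n (branch k x)"
          using z_bounds Y_nonneg by (intro mult_right_mono) auto
        ultimately have "(z (x []) j * Y n (branch j x)) ^ (p + 1) * (z (x []) k * Y n (branch k x))
          \<le> (1 * Y n (branch j x)) ^ (p + 1) * (1 * Y n (branch k x))"
          by (rule mult_mono) (use pos Y_nonneg in auto)
        then show "?b j k x \<le> (\<lambda>_. 1) (x []) * ((\<lambda>x. ennreal (Y n x ^ (p + 1))) (branch j x) * (\<lambda>x. ennreal (Y n x)) (branch k x))"
          using Y_nonneg by (simp add: ennreal_mult[symmetric] ennreal_leI del: power_Suc)
      qed
      also have "\<dots> = (\<integral>\<^sup>+t. 1 \<partial>N) * ((\<integral>\<^sup>+x. ennreal (Y n x ^ (p + 1)) \<partial>\<Omega>) * (\<integral>\<^sup>+x. ennreal (Y n x) \<partial>\<Omega>))"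
        by (rule nn_integral_branch2[where H = "\<lambda>_. 1" and g = "\<lambda>x. ennreal (Y n x ^ (p + 1))" and h = "\<lambda>x. ennreal (Y n x)"])
           (use jl kl in auto)
      also have "\<dots> \<le> ennreal K" using K(2)[of n] by (simp add: nn_integral_Y N.emeasure_space_1)
      finally show "(\<integral>\<^sup>+x. ?b j k x \<partial>\<Omega>) \<le> ennreal K" .
    qed auto
    also have "\<dots> \<le> ennreal \<rho> * ennreal L + ennreal C * (\<Sum>j\<in>A. \<Sum>k\<in>A. ennreal K)"
      unfolding sum_distrib_right[symmetric] \<rho>(2)
      by (intro add_mono mult_left_mono Suc.IH sum_mono sum_mono2) auto
    also have "\<dots> = ennreal (\<rho> * L + D)"
      using \<rho> L C K D by (simp add: D_def ennreal_mult[symmetric] ennreal_of_nat_eq_real_of_nat ennreal_plus[symmetric] mult.assoc del: ennreal_plus)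
    also have "\<dots> \<le> ennreal L" using L by (intro ennreal_leI)
    finally show ?case .
  qed
  then show ?case using L by (intro exI[of _ L]) simp
qed

lemma moment_Lim: "(\<integral>\<^sup>+x. ennreal (Lim x ^ (p + 1)) \<partial>\<Omega>) < \<infinity>"
proof -
  obtain K where K: "\<And>n. (\<integral>\<^sup>+x. ennreal (Y n x ^ (p + 1)) \<partial>\<Omega>) \<le> ennreal K" using moment_Y by blast
  have "(\<integral>\<^sup>+x. ennreal (Lim x ^ (p + 1)) \<partial>\<Omega>) = (\<integral>\<^sup>+x. liminf (\<lambda>n. ennreal (Y n x ^ (p + 1))) \<partial>\<Omega>)"
  proof (rule nn_integral_cong_AE)
    show "AE x in \<Omega>. ennreal (Lim x ^ (p + 1)) = liminf (\<lambda>n. ennreal (Y n x ^ (p + 1)))"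
      using AE_Y_tendsto
    proof eventually_elim
      case (elim x)
      have "(\<lambda>n. ennreal (Y n x ^ (p + 1))) \<longlonglongrightarrow> ennreal (Lim x ^ (p + 1))"
        by (intro tendsto_ennrealI tendsto_power elim)
      then show ?case by (intro lim_imp_Liminf[symmetric]) auto
    qed
  qed
  also have "\<dots> \<le> liminf (\<lambda>n. \<integral>\<^sup>+x. ennreal (Y n x ^ (p + 1)) \<partial>\<Omega>)" by (intro nn_integral_liminf) auto
  also have "\<dots> \<le> liminf (\<lambda>n. ennreal K)" by (intro Liminf_mono always_eventually allI K)
  also have "\<dots> < \<infinity>" by (simp add: Liminf_const)
  finally show ?thesis .
qed

end


section \<open>Moments of the limit factors\<close>

declare One_nat_def [simp del]

lemma (in prob_space) small_values_unlikely:
  fixes f :: "'a \<Rightarrow> real"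
  assumes [measurable]: "f \<in> borel_measurable M" and "AE x in M. 0 < f x" and "0 < (e :: real)"
  shows "\<exists>b>0. (\<integral>\<^sup>+x. of_bool (f x < b) \<partial>M) \<le> ennreal e"
proof -
  have "(\<lambda>n. \<integral>x. of_bool (f x < 1 / real (Suc n)) \<partial>M) \<longlonglongrightarrow> (\<integral>x. (0 :: real) \<partial>M)"
  proof (rule integral_dominated_convergence[where w = "\<lambda>_. 1"])
    show "AE x in M. (\<lambda>n. of_bool (f x < 1 / real (Suc n))) \<longlonglongrightarrow> (0 :: real)"
      using assms(2)
    proof eventually_elim
      case (elim x)
      have "\<forall>\<^sub>F n in sequentially. 1 / real (Suc n) < f x"
        using order_tendstoD(2)[OF LIMSEQ_inverse_real_of_nat elim] by (simp add: inverse_eq_divide)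
      then show ?case by (intro tendsto_eventually) (auto elim: eventually_mono)
    qed
  qed auto
  then have "\<forall>\<^sub>F n in sequentially. (\<integral>x. of_bool (f x < 1 / real (Suc n)) \<partial>M) < e"
    using order_tendstoD(2)[of _ "\<integral>x. (0 :: real) \<partial>M" sequentially e] assms(3) by simp
  then obtain n where n: "(\<integral>x. of_bool (f x < 1 / real (Suc n)) \<partial>M) < e"
    using eventually_happens'[OF sequentially_bot] by blast
  have "(\<integral>\<^sup>+x. of_bool (f x < 1 / real (Suc n)) \<partial>M) = (\<integral>\<^sup>+x. ennreal (of_bool (f x < 1 / real (Suc n))) \<partial>M)"
    by (intro nn_integral_cong) (simp split: split_of_bool)
  also have "\<dots> = ennreal (\<integral>x. of_bool (f x < 1 / real (Suc n)) \<partial>M)"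
    by (intro nn_integral_eq_integral integrable_const_bound[of _ 1]) auto
  finally show ?thesis using n by (intro exI[of _ "1 / real (Suc n)"]) (auto intro: ennreal_leI)
qed

lemma powr_antimono: "0 \<le> x \<Longrightarrow> x \<le> 1 \<Longrightarrow> p \<le> q \<Longrightarrow> x powr q \<le> x powr p" for x :: real
  by (cases "x = 0") (auto intro: powr_mono')

text \<open>Cutting y at the level \<kappa> plays the role of the Cauchy-Schwarz inequality: the
  mean of y over a rare event is at most \<kappa> times its probability plus the second moment over
  \<kappa>.\<close>

lemma mult_of_bool_le:
  fixes y :: real
  assumes "0 < \<kappa>" "0 \<le> y" shows "of_bool B * y \<le> \<kappa> * of_bool B + y\<^sup>2 / \<kappa>"
proof (cases "y \<le> \<kappa>")
  case True
  then have "of_bool B * y \<le> \<kappa> * of_bool B" using assms by (cases B) auto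
  moreover have "0 \<le> y\<^sup>2 / \<kappa>" using assms by simp
  ultimately show ?thesis by linarith
next
  case False
  then have "y * \<kappa> \<le> y * y" using assms by (intro mult_left_mono) auto
  then have "y \<le> y\<^sup>2 / \<kappa>" using assms by (simp add: pos_le_divide_eq power2_eq_square)
  moreover have "of_bool B * y \<le> y" using assms by (cases B) auto
  moreover have "0 \<le> \<kappa> * of_bool B" using assms by simp
  ultimately show ?thesis by linarith
qed

context cascade_law
begin

lemma mom_antimono: "p \<le> q \<Longrightarrow> mom j q \<le> mom j p"
  unfolding mom_def by (intro nn_integral_mono ennreal_leI powr_antimono) auto

lemma mom_pos: "j \<in> letters \<Longrightarrow> 0 < mom j \<theta>"
proof -
  assume j [measurable]: "j \<in> letters"
  have "mom j \<theta> \<noteq> 0"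
  proof
    assume "mom j \<theta> = 0"
    then have "AE t in N. ennreal (clip (t j) powr \<theta>) = 0"
      unfolding mom_def by (subst (asm) nn_integral_0_iff_AE) auto
    then have "AE t in N. False"
      using N_pos[OF j]
    proof eventually_elim
      case (elim t)
      then have "clip (t j) \<noteq> 0" by (simp add: clip_def)
      then show ?case using elim(1) by simp
    qed
    then show False by simp
  qed
  then show ?thesis by (simp add: zero_less_iff_neq_zero)
qed

end

text \<open>\<open>below\<close> also gives the square condition for the martingale with exponent
  \<open>\<alpha>\<close>. Negative moments of order \<open>s\<^sub>0\<close> are required for the
  letters 1 and 2, of which the end subcells and the recursion of R consist.\<close>

locale cascade_system = cascade_law N for N +
  fixes \<alpha> s\<^sub>0 :: real
  assumes mean12: "mom 1 1 + mom 2 1 = 1" and square12: "mom 1 2 + mom 2 2 < 1"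
    and \<alpha>: "0 < \<alpha>" "(\<Sum>j\<in>letters. mom j \<alpha>) = 1"
    and below: "\<And>\<theta>. \<alpha> < \<theta> \<Longrightarrow> (\<Sum>j\<in>letters. mom j \<theta>) < 1"
    and s0: "0 < s\<^sub>0" "mom 1 (- s\<^sub>0) < \<infinity>" "mom 2 (- s\<^sub>0) < \<infinity>"
begin

sublocale R: cascade_martingale N "{1, 2}" 1
  using mean12 square12 by unfold_locales (auto simp: letters_def)

sublocale M: cascade_martingale N letters \<alpha>
proof unfold_locales
  show "2 \<le> card letters" by (simp add: letters_def)
qed (use \<alpha> below in auto)

lemma letter12: "1 \<in> letters" "2 \<in> letters" by (auto simp: letters_def)

lemma R_branches:
  "AE x in \<Omega>. R.Lim x = clip (x [] 1) * R.Lim (branch 1 x) + clip (x [] 2) * R.Lim (branch 2 x) \<and>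
     0 < R.Lim (branch 1 x) \<and> 0 < R.Lim (branch 2 x) \<and> 0 < R.Lim x \<and> 0 < clip (x [] 1) \<and> 0 < clip (x [] 2)"
  using R.AE_Lim_good AE_weights_pos
proof eventually_elim
  case (elim x)
  have "R.Lim x = clip (x [] 1) * R.Lim (branch 1 x) + clip (x [] 2) * R.Lim (branch 2 x)"
    using elim(1)[rule_format, of "[]"] by simp
  moreover have "0 < R.Lim (branch j x)" if "j \<in> letters" for j using elim(1)[rule_format, of "[j]"] that by simp
  moreover have "0 < R.Lim x" using elim(1)[rule_format, of "[]"] by simp
  moreover have "0 < clip (x [] j)" if "j \<in> letters" for j using elim(2) that by (auto simp: clip_def)
  ultimately show ?case using letter12 by blast
qed

text \<open>Either the first arm of the segment is not short, or \<open>R\<close> is bounded below through the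
  second arm; a short first arm is so unlikely that this recursion is contracting.\<close>

lemma negative_moment_R:
  assumes "0 < s" "2 * s \<le> s\<^sub>0"
  shows "(\<integral>\<^sup>+x. ennreal (R.Lim x powr (- s)) \<partial>\<Omega>) < \<infinity>"
proof -
  have fin: "mom 2 (- (2 * s)) < \<infinity>" "mom 2 (- s) < \<infinity>"
    using mom_antimono[of "- s\<^sub>0" "- (2 * s)" 2] mom_antimono[of "- s\<^sub>0" "- s" 2] s0 assms by (auto intro: le_less_trans)
  obtain m1 m2 where m: "0 \<le> m1" "mom 2 (- s) = ennreal m1" "0 \<le> m2" "mom 2 (- (2 * s)) = ennreal m2"
    using fin by (cases "mom 2 (- s)"; cases "mom 2 (- (2 * s))") auto
  \<comment> \<open>Makes \<open>1 / 8 + m2 / \<kappa>\<close> at most 1/4 below.\<close>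
  define \<kappa> where "\<kappa> = 8 * (m2 + 1)"
  have \<kappa>: "0 < \<kappa>" using m by (simp add: \<kappa>_def)
  note [measurable] = letter12
  obtain b1 where b1: "0 < b1" "(\<integral>\<^sup>+t. of_bool (t 1 < b1) \<partial>N) \<le> ennreal (1 / (8 * \<kappa>))"
    using N.small_values_unlikely[OF measurable_letter N_pos, OF letter12(1) letter12(1), of "1 / (8 * \<kappa>)"] \<kappa> by auto
  obtain b2 where b2: "0 < b2" "(\<integral>\<^sup>+x. of_bool (R.Lim x < b2) \<partial>\<Omega>) \<le> ennreal (1 / (4 * (m1 + 1)))"
    using small_values_unlikely[OF R.measurable_Lim R.AE_Lim_pos, of "1 / (4 * (m1 + 1))"] m by auto
  define b where "b = min (min b1 b2) 1"
  have b: "0 < b" "b \<le> 1" "b \<le> b1" "b \<le> b2" using b1 b2 by (auto simp: b_def)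
  \<comment> \<open>The truncation makes the expectation finite, so that an inequality of the form
    \<open>\<psi> \<le> C + \<psi> / 2\<close> can be solved for \<open>\<psi>\<close>; the
    resulting bound does not depend on \<open>K\<close>.\<close>
  define g where "g K x = min (R.Lim x powr (- s)) K" for K :: real and x
  have g0: "0 \<le> g K x" if "0 \<le> K" for K x using that by (simp add: g_def)
  have [measurable]: "g K \<in> borel_measurable \<Omega>" for K unfolding g_def by measurable
  \<comment> \<open>If neither the first weight nor the limit of its branch is below
    \<open>b\<close>, then the limit is at least \<open>b * b\<close>.\<close>
  define C where "C = b powr (- (2 * s))"
  have "(\<integral>\<^sup>+x. ennreal (g K x) \<partial>\<Omega>) \<le> ennreal (2 * C)" if K: "0 \<le> K" for K
  proof -
    let ?H = "\<lambda>t :: nat \<Rightarrow> real. of_bool (t 1 < b) * clip (t 2) powr (- s)"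
    let ?G = "\<lambda>x. of_bool (R.Lim x < b) :: ennreal"
    let ?\<psi> = "\<integral>\<^sup>+x. ennreal (g K x) \<partial>\<Omega>"
    have "AE x in \<Omega>. ennreal (g K x) \<le> ennreal C +
      ((\<lambda>t. ennreal (?H t)) (x []) * (\<lambda>x. ennreal (g K x)) (branch 2 x)
      + (\<lambda>t. ennreal (clip (t 2) powr (- s))) (x []) * (?G (branch 1 x) * (\<lambda>x. ennreal (g K x)) (branch 2 x)))"
      using R_branches
    proof eventually_elim
      case (elim x)
      let ?v1 = "clip (x [] 1)" and ?v2 = "clip (x [] 2)"
      let ?R1 = "R.Lim (branch 1 x)" and ?R2 = "R.Lim (branch 2 x)"
      have gg: "g K x \<le> ?v2 powr (- s) * g K (branch 2 x)"
      proof -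
        have "?v2 * ?R2 \<le> R.Lim x" using elim by simp
        then have "R.Lim x powr (- s) \<le> (?v2 * ?R2) powr (- s)" using elim assms by (intro powr_mono2') auto
        also have "\<dots> = ?v2 powr (- s) * ?R2 powr (- s)" using elim by (simp add: powr_mult)
        finally have 1: "R.Lim x powr (- s) \<le> ?v2 powr (- s) * ?R2 powr (- s)" .
        have "1 \<le> ?v2 powr (- s)" using elim assms powr_antimono[of ?v2 "- s" 0] by simp
        then have 2: "K \<le> ?v2 powr (- s) * K" using K mult_right_mono[of 1 "?v2 powr (- s)" K] by simp
        show ?thesis using 1 2 by (auto simp: g_def min_def)
      qed
      have g20: "0 \<le> g K (branch 2 x)" using g0 K by blast
      show ?case
      proof (cases "x [] 1 < b \<or> ?R1 < b")
        case True
        have "ennreal (g K x) \<le> ennreal (?v2 powr (- s)) * ennreal (g K (branch 2 x))"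
          using gg g20 by (simp add: ennreal_mult[symmetric] ennreal_leI)
        also have "\<dots> \<le> ennreal (?H (x [])) * ennreal (g K (branch 2 x))
          + ennreal (?v2 powr (- s)) * (?G (branch 1 x) * ennreal (g K (branch 2 x)))"
          using True by (auto simp: add_increasing add_increasing2)
        finally show ?thesis by (simp add: add_increasing)
      next
        case False
        have "b \<le> ?v1" using False b by (auto simp: clip_def)
        then have "b * b \<le> ?v1 * ?R1" using False b elim by (intro mult_mono) auto
        also have "\<dots> \<le> R.Lim x" using elim by simp
        finally have "R.Lim x powr (- s) \<le> (b * b) powr (- s)" using b assms by (intro powr_mono2') auto
        also have "\<dots> = C" using b by (simp add: C_def powr_mult powr_add[symmetric])
        finally have "g K x \<le> C" by (simp add: g_def)
        then show ?thesis by (intro add_increasing2 ennreal_leI) auto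
      qed
    qed
    then have "?\<psi> \<le> (\<integral>\<^sup>+x. ennreal C +
      ((\<lambda>t. ennreal (?H t)) (x []) * (\<lambda>x. ennreal (g K x)) (branch 2 x)
      + (\<lambda>t. ennreal (clip (t 2) powr (- s))) (x []) * (?G (branch 1 x) * (\<lambda>x. ennreal (g K x)) (branch 2 x))) \<partial>\<Omega>)"
      by (rule nn_integral_mono_AE)
    also have "\<dots> = ennreal C +
      ((\<integral>\<^sup>+x. (\<lambda>t. ennreal (?H t)) (x []) * (\<lambda>x. ennreal (g K x)) (branch 2 x) \<partial>\<Omega>)
      + (\<integral>\<^sup>+x. (\<lambda>t. ennreal (clip (t 2) powr (- s))) (x []) * (?G (branch 1 x) * (\<lambda>x. ennreal (g K x)) (branch 2 x)) \<partial>\<Omega>))"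
      by (simp add: nn_integral_add emeasure_space_1)
    also have "(\<integral>\<^sup>+x. (\<lambda>t. ennreal (?H t)) (x []) * (\<lambda>x. ennreal (g K x)) (branch 2 x) \<partial>\<Omega>)
      = (\<integral>\<^sup>+t. ennreal (?H t) \<partial>N) * ?\<psi>"
      by (rule nn_integral_branch) (auto simp: letter12)
    also have "(\<integral>\<^sup>+x. (\<lambda>t. ennreal (clip (t 2) powr (- s))) (x []) * (?G (branch 1 x) * (\<lambda>x. ennreal (g K x)) (branch 2 x)) \<partial>\<Omega>)
      = mom 2 (- s) * ((\<integral>\<^sup>+x. ?G x \<partial>\<Omega>) * ?\<psi>)"
      unfolding mom_def
      by (rule nn_integral_branch2[where H = "\<lambda>t. ennreal (clip (t 2) powr (- s))" and g = ?G and h = "\<lambda>x. ennreal (g K x)"])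
         (auto simp: letter12)
    also have "(\<integral>\<^sup>+t. ennreal (?H t) \<partial>N) \<le> ennreal (1 / 4)"
    proof -
      have "(\<integral>\<^sup>+t. ennreal (?H t) \<partial>N)
        \<le> (\<integral>\<^sup>+t. ennreal \<kappa> * of_bool (t 1 < b) + ennreal (1 / \<kappa>) * ennreal (clip (t 2) powr (- (2 * s))) \<partial>N)"
      proof (rule nn_integral_mono)
        fix t :: "nat \<Rightarrow> real"
        have "?H t \<le> \<kappa> * of_bool (t 1 < b) + 1 / \<kappa> * clip (t 2) powr (- (2 * s))"
          using mult_of_bool_le[OF \<kappa>, of "clip (t 2) powr (- s)" "t 1 < b"] by (simp add: power2_eq_square powr_add[symmetric])
        then have "ennreal (?H t) \<le> ennreal (\<kappa> * of_bool (t 1 < b) + 1 / \<kappa> * clip (t 2) powr (- (2 * s)))"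
          by (rule ennreal_leI)
        also have "\<dots> = ennreal (\<kappa> * of_bool (t 1 < b)) + ennreal (1 / \<kappa> * clip (t 2) powr (- (2 * s)))"
          using \<kappa> by (intro ennreal_plus) auto
        also have "ennreal (1 / \<kappa> * clip (t 2) powr (- (2 * s))) = ennreal (1 / \<kappa>) * ennreal (clip (t 2) powr (- (2 * s)))"
          using \<kappa> by (intro ennreal_mult) auto
        also have "ennreal (\<kappa> * of_bool (t 1 < b)) = ennreal \<kappa> * of_bool (t 1 < b)" by simp
        finally show "ennreal (?H t) \<le> ennreal \<kappa> * of_bool (t 1 < b) + ennreal (1 / \<kappa>) * ennreal (clip (t 2) powr (- (2 * s)))" .
      qed
      also have "\<dots> = ennreal \<kappa> * (\<integral>\<^sup>+t. of_bool (t 1 < b) \<partial>N) + ennreal (1 / \<kappa>) * mom 2 (- (2 * s))"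
        unfolding mom_def by (simp add: nn_integral_add nn_integral_cmult)
      also have "\<dots> \<le> ennreal \<kappa> * ennreal (1 / (8 * \<kappa>)) + ennreal (1 / \<kappa>) * ennreal m2"
      proof (intro add_mono mult_left_mono)
        have "(\<integral>\<^sup>+t. of_bool (t 1 < b) \<partial>N) \<le> (\<integral>\<^sup>+t. of_bool (t 1 < b1) \<partial>N)"
          using b by (intro nn_integral_mono) auto
        then show "(\<integral>\<^sup>+t. of_bool (t 1 < b) \<partial>N) \<le> ennreal (1 / (8 * \<kappa>))" using b1(2) by (rule order_trans)
      qed (auto simp: m)
      also have "\<dots> = ennreal (1 / 8 + m2 / \<kappa>)"
        using \<kappa> m by (simp add: ennreal_mult[symmetric] ennreal_plus[symmetric] del: ennreal_plus)
      also have "\<dots> \<le> ennreal (1 / 4)"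
        using m by (intro ennreal_leI) (simp add: \<kappa>_def divide_simps)
      finally show ?thesis .
    qed
    also have "(\<integral>\<^sup>+x. ?G x \<partial>\<Omega>) \<le> ennreal (1 / (4 * (m1 + 1)))"
    proof -
      have "(\<integral>\<^sup>+x. ?G x \<partial>\<Omega>) \<le> (\<integral>\<^sup>+x. of_bool (R.Lim x < b2) \<partial>\<Omega>)" using b by (intro nn_integral_mono) auto
      then show ?thesis using b2(2) by (rule order_trans)
    qed
    finally have le: "?\<psi> \<le> ennreal C + (ennreal (1 / 4) * ?\<psi> + mom 2 (- s) * (ennreal (1 / (4 * (m1 + 1))) * ?\<psi>))"
      by (auto simp: mult_left_mono mult_right_mono add_left_mono add_right_mono)
    have "?\<psi> \<le> (\<integral>\<^sup>+x. ennreal K \<partial>\<Omega>)" by (intro nn_integral_mono ennreal_leI) (simp add: g_def)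
    then have "?\<psi> < \<infinity>" by (auto simp: emeasure_space_1 intro: le_less_trans)
    then obtain \<psi> where \<psi>: "0 \<le> \<psi>" "?\<psi> = ennreal \<psi>" by (cases ?\<psi>) auto
    have "\<psi> \<le> C + (1 / 4 * \<psi> + m1 * (1 / (4 * (m1 + 1)) * \<psi>))"
    proof -
      have "ennreal \<psi> \<le> ennreal (C + (1 / 4 * \<psi> + m1 * (1 / (4 * (m1 + 1)) * \<psi>)))"
      proof -
        have eq: "ennreal C + (ennreal p * ennreal \<psi> + ennreal m1 * (ennreal q * ennreal \<psi>))
          = ennreal (C + (p * \<psi> + m1 * (q * \<psi>)))" if "0 \<le> p" "0 \<le> q" for p q
          using that m \<psi> by (simp add: C_def ennreal_mult ennreal_plus)
        show ?thesis using le m unfolding \<psi>(2) m(2) by (subst (asm) eq) auto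
      qed
      then show ?thesis using m \<psi> by (subst (asm) ennreal_le_iff) (auto simp: C_def)
    qed
    moreover have "m1 * (1 / (4 * (m1 + 1)) * \<psi>) \<le> 1 / 4 * \<psi>"
    proof -
      have "m1 / (m1 + 1) \<le> 1" using m by simp
      then have "m1 / (m1 + 1) * (1 / 4 * \<psi>) \<le> 1 * (1 / 4 * \<psi>)" using \<psi> by (intro mult_right_mono) auto
      then show ?thesis by (simp add: algebra_simps)
    qed
    ultimately have "\<psi> \<le> 2 * C" by linarith
    then show ?thesis unfolding \<psi>(2) by (rule ennreal_leI)
  qed
  then have bound: "(\<integral>\<^sup>+x. ennreal (g (real n) x) \<partial>\<Omega>) \<le> ennreal (2 * C)" for n by simp
  have "(\<integral>\<^sup>+x. ennreal (R.Lim x powr (- s)) \<partial>\<Omega>) = (\<integral>\<^sup>+x. liminf (\<lambda>n. ennreal (g (real n) x)) \<partial>\<Omega>)"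
  proof (intro nn_integral_cong lim_imp_Liminf[symmetric])
    fix x
    obtain k where "R.Lim x powr (- s) \<le> real k" using real_arch_simple by blast
    then have "\<forall>\<^sub>F n in sequentially. g (real n) x = R.Lim x powr (- s)"
      by (intro eventually_sequentiallyI[of k]) (simp add: g_def)
    then show "(\<lambda>n. ennreal (g (real n) x)) \<longlonglongrightarrow> ennreal (R.Lim x powr (- s))"
      by (intro tendsto_ennrealI tendsto_eventually)
  qed simp
  also have "\<dots> \<le> liminf (\<lambda>n. \<integral>\<^sup>+x. ennreal (g (real n) x) \<partial>\<Omega>)" by (intro nn_integral_liminf) auto
  also have "\<dots> \<le> liminf (\<lambda>n. ennreal (2 * C))" by (intro Liminf_mono always_eventually allI bound)
  also have "\<dots> < \<infinity>" by (simp add: Liminf_const)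
  finally show ?thesis .
qed

lemma moment_R_powr: "0 < s \<Longrightarrow> (\<integral>\<^sup>+x. ennreal (\<bar>R.Lim x\<bar> powr s) \<partial>\<Omega>) < \<infinity>"
proof -
  assume s: "0 < s"
  obtain p where p: "s \<le> real (p + 1)" using real_arch_simple[of s] by (metis le_add1 of_nat_le_iff order_trans)
  have "(\<integral>\<^sup>+x. ennreal (\<bar>R.Lim x\<bar> powr s) \<partial>\<Omega>) \<le> (\<integral>\<^sup>+x. 1 + ennreal (R.Lim x ^ (p + 1)) \<partial>\<Omega>)"
  proof (rule nn_integral_mono_AE)
    show "AE x in \<Omega>. ennreal (\<bar>R.Lim x\<bar> powr s) \<le> 1 + ennreal (R.Lim x ^ (p + 1))"
      using R.AE_Lim_pos
    proof eventually_elim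
      case (elim x)
      have "R.Lim x powr s \<le> 1 + R.Lim x ^ (p + 1)"
      proof (cases "R.Lim x \<le> 1")
        case True
        then have "R.Lim x powr s \<le> 1" using elim s powr_mono2[of s "R.Lim x" 1] by simp
        moreover have "0 \<le> R.Lim x ^ (p + 1)" using elim by simp
        ultimately show ?thesis by linarith
      next
        case False
        then have "R.Lim x powr s \<le> R.Lim x powr real (p + 1)" using p by (intro powr_mono) auto
        also have "\<dots> = R.Lim x ^ (p + 1)" using elim by (simp only: powr_realpow)
        finally show ?thesis by simp
      qed
      then have "ennreal (R.Lim x powr s) \<le> ennreal (1 + R.Lim x ^ (p + 1))" by (rule ennreal_leI)
      then show ?case using elim by (simp add: ennreal_plus)
    qed
  qed
  also have "\<dots> = 1 + (\<integral>\<^sup>+x. ennreal (R.Lim x ^ (p + 1)) \<partial>\<Omega>)"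
    by (subst nn_integral_add) (auto simp: emeasure_space_1)
  also have "\<dots> < \<infinity>" using R.moment_Lim[of p] by simp
  finally show ?thesis .
qed

end


section \<open>Almost sure bounds for the cascade\<close>

lemma sum_Un_le:
  fixes f :: "'b \<Rightarrow> real"
  assumes "finite A" "finite B" "\<And>x. 0 \<le> f x"
  shows "sum f (A \<union> B) \<le> sum f A + sum f B"
  using sum.union_inter[OF assms(1,2), of f] sum_nonneg[of "A \<inter> B" f] assms(3) by simp

context cascade_system
begin

lemma AE_good:
  "AE x in \<Omega>. \<forall>i\<in>lists letters. 0 < lprod i x \<and> 0 < R.Lim (subtree i x) \<and> 0 < M.Lim (subtree i x)"
  using AE_lprod_pos R.AE_Lim_good M.AE_Lim_good by eventually_elim blast

text \<open>The moments of order \<alpha> add up to 1, so the weighted sum over any level has the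
  same expectation as \<open>G k\<close>; a geometric bound for the latter is enough, whatever the
  block length L.\<close>

lemma AE_summable_levels:
  fixes G :: "nat \<Rightarrow> _ \<Rightarrow> real"
  assumes [measurable]: "\<And>k. G k \<in> borel_measurable \<Omega>" and G0: "\<And>k x. 0 \<le> G k x"
    and G: "\<And>k. (\<integral>\<^sup>+x. ennreal (G k x) \<partial>\<Omega>) \<le> ennreal (C * q ^ k)" and q: "0 \<le> C" "0 \<le> q" "q < 1"
  shows "AE x in \<Omega>. summable (\<lambda>k. \<Sum>w\<in>words letters (L * k). lprod w x powr \<alpha> * G k (subtree w x))"
proof (rule AE_summable)
  fix k
  have ml: "(\<lambda>x. lprod w x powr \<alpha>) \<in> borel_measurable \<Omega>" "(\<lambda>x. G k (subtree w x)) \<in> borel_measurable \<Omega>"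
    if w: "w \<in> words letters (L * k)" for w
  proof -
    have [measurable]: "w \<in> lists letters" using w by (rule wordsD)
    show "(\<lambda>x. lprod w x powr \<alpha>) \<in> borel_measurable \<Omega>" "(\<lambda>x. G k (subtree w x)) \<in> borel_measurable \<Omega>"
      by measurable
  qed
  show "(\<lambda>x. \<Sum>w\<in>words letters (L * k). lprod w x powr \<alpha> * G k (subtree w x)) \<in> borel_measurable \<Omega>"
    using ml by (intro borel_measurable_sum borel_measurable_times)
  show "0 \<le> (\<Sum>w\<in>words letters (L * k). lprod w x powr \<alpha> * G k (subtree w x))" for x
    using G0 by (intro sum_nonneg mult_nonneg_nonneg) auto
next
  have "(\<integral>\<^sup>+x. ennreal (\<Sum>w\<in>words letters (L * k). lprod w x powr \<alpha> * G k (subtree w x)) \<partial>\<Omega>) \<le> ennreal (C * q ^ k)" for k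
  proof -
    have "(\<integral>\<^sup>+x. ennreal (\<Sum>w\<in>words letters (L * k). lprod w x powr \<alpha> * G k (subtree w x)) \<partial>\<Omega>)
      = (\<integral>\<^sup>+x. (\<Sum>w\<in>words letters (L * k). ennreal (lprod w x powr \<alpha>) * (\<lambda>x. ennreal (G k x)) (subtree w x)) \<partial>\<Omega>)"
      using G0 by (intro nn_integral_cong) (simp add: ennreal_mult[symmetric])
    also have "\<dots> = (\<integral>\<^sup>+x. ennreal (G k x) \<partial>\<Omega>)"
      by (subst nn_integral_level) (auto simp: \<alpha>)
    finally show ?thesis using G[of k] by simp
  qed
  then have "(\<Sum>k. \<integral>\<^sup>+x. ennreal (\<Sum>w\<in>words letters (L * k). lprod w x powr \<alpha> * G k (subtree w x)) \<partial>\<Omega>)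
    \<le> (\<Sum>k. ennreal (C * q ^ k))" by (intro suminf_le) auto
  also have "\<dots> < \<infinity>"
  proof -
    have "summable (\<lambda>k. C * q ^ k)" using q by (intro summable_mult summable_geometric) auto
    then show ?thesis using q by (subst suminf_ennreal2) auto
  qed
  finally show "(\<Sum>k. \<integral>\<^sup>+x. ennreal (\<Sum>w\<in>words letters (L * k). lprod w x powr \<alpha> * G k (subtree w x)) \<partial>\<Omega>) < \<infinity>" .
qed

lemma AE_power_sums:
  assumes "\<alpha> < s"
  shows "AE x in \<Omega>. \<exists>C r. 0 < r \<and> r < 1 \<and>
    (\<forall>n. (\<Sum>u\<in>words letters n. (lprod u x * R.Lim (subtree u x)) powr s) \<le> C * (r\<^sup>2) ^ n)"
proof -
  obtain m where m: "0 \<le> m" "(\<Sum>j\<in>letters. mom j s) = ennreal m" "m < 1"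
    using below[OF assms] by (cases "\<Sum>j\<in>letters. mom j s") (auto simp: ennreal_less_one_iff)
  define r where "r = sqrt ((1 + m) / 2)"
  have r: "0 < r" "r < 1" "m < r\<^sup>2" using m by (auto simp: r_def)
  have "AE x in \<Omega>. \<exists>C. \<forall>n. (\<Sum>i\<in>words letters n. lprod i x powr s * \<bar>R.Lim (subtree i x)\<bar> powr s) \<le> C * (r\<^sup>2) ^ n"
    using moment_R_powr[of s] \<alpha> assms r m by (intro AE_level_bound) (auto simp: ennreal_less_iff)
  then show ?thesis
    using AE_good
  proof eventually_elim
    case (elim x)
    have "(\<Sum>u\<in>words letters n. (lprod u x * R.Lim (subtree u x)) powr s)
      = (\<Sum>i\<in>words letters n. lprod i x powr s * \<bar>R.Lim (subtree i x)\<bar> powr s)" for n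
    proof (rule sum.cong[OF refl])
      fix u assume "u \<in> words letters n"
      then have "0 < R.Lim (subtree u x)" using elim(2) wordsD(2) by blast
      then show "(lprod u x * R.Lim (subtree u x)) powr s = lprod u x powr s * \<bar>R.Lim (subtree u x)\<bar> powr s"
        by (simp add: powr_mult)
    qed
    then show ?case using elim(1) r by (metis (no_types, lifting))
  qed
qed

text \<open>The power \<theta> > \<alpha> of a single product is at most the level sum of these
  powers, which decays geometrically because the one-step sum is below 1.\<close>

lemma AE_decay:
  obtains \<eta> where "0 < \<eta>" "\<eta> < 1" "AE x in \<Omega>. \<exists>C. \<forall>i\<in>lists letters. lprod i x \<le> C * \<eta> ^ length i"
proof -
  define \<theta> where "\<theta> = \<alpha> + 1"
  have \<theta>: "\<alpha> < \<theta>" "0 < \<theta>" using \<alpha> by (auto simp: \<theta>_def)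
  obtain m where m: "0 \<le> m" "(\<Sum>j\<in>letters. mom j \<theta>) = ennreal m" "m < 1"
    using below[OF \<theta>(1)] by (cases "\<Sum>j\<in>letters. mom j \<theta>") (auto simp: ennreal_less_one_iff)
  define q where "q = (1 + m) / 2"
  have q: "0 < q" "q < 1" "m < q" using m by (auto simp: q_def)
  define \<eta> where "\<eta> = q powr (1 / \<theta>)"
  have \<eta>: "0 < \<eta>" "\<eta> < 1" using q \<theta> powr_less_mono2[of "1 / \<theta>" q 1] by (auto simp: \<eta>_def)
  have "AE x in \<Omega>. \<exists>C. \<forall>n. (\<Sum>i\<in>words letters n. lprod i x powr \<theta> * 1) \<le> C * q ^ n"
    using q m by (intro AE_level_bound[where G = "\<lambda>_. 1"]) (auto simp: ennreal_less_iff emeasure_space_1)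
  then have "AE x in \<Omega>. \<exists>C. \<forall>i\<in>lists letters. lprod i x \<le> C * \<eta> ^ length i"
  proof eventually_elim
    case (elim x)
    then obtain C where C: "\<And>n. (\<Sum>i\<in>words letters n. lprod i x powr \<theta>) \<le> C * q ^ n" by auto
    have "lprod i x \<le> C powr (1 / \<theta>) * \<eta> ^ length i" if i: "i \<in> lists letters" for i
    proof -
      have "lprod i x powr \<theta> \<le> (\<Sum>i\<in>words letters (length i). lprod i x powr \<theta>)"
        using i lists_words by (intro member_le_sum) auto
      then have le: "lprod i x powr \<theta> \<le> C * q ^ length i" using C order_trans by blast
      then have "0 \<le> C * q ^ length i" by (rule order_trans[rotated]) simp
      moreover have "0 < q ^ length i" using q by simp
      ultimately have C0: "0 \<le> C" using mult_neg_pos by (meson not_less)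
      have "(lprod i x powr \<theta>) powr (1 / \<theta>) \<le> (C * q ^ length i) powr (1 / \<theta>)"
        using le \<theta> by (intro powr_mono2) auto
      also have "\<dots> = C powr (1 / \<theta>) * \<eta> ^ length i"
        using C0 q by (simp add: powr_mult powr_of_power \<eta>_def)
      finally show ?thesis using \<theta> by (simp add: powr_powr)
    qed
    then show ?case by blast
  qed
  then show ?thesis using that \<eta> by blast
qed

section \<open>Edge lengths, masses and the expected discarded mass\<close>

definition len :: "(nat list \<Rightarrow> nat \<Rightarrow> real) \<Rightarrow> nat list \<Rightarrow> real" where
  "len x i = lprod i x * R.Lim (subtree i x)"

definition mass :: "(nat list \<Rightarrow> nat \<Rightarrow> real) \<Rightarrow> nat list \<Rightarrow> real" where
  "mass x i = lprod i x powr \<alpha> * M.Lim (subtree i x)"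

lemma lprod_replicate_moment:
  "(\<Prod>j\<leftarrow>replicate k 2. mom j \<theta>) = mom 2 \<theta> ^ k"
  by (induction k) auto

text \<open>Four kinds of loss, each geometrically small in expectation: \<open>g1\<close> for an
  untypically large M, by its second moment; \<open>g2\<close> for a short end subcell, by negative
  moments; \<open>g3\<close> for the mass of the end subcells, since E w(2)^\<alpha> < 1;
  \<open>g4\<close> for a short block of L letters, whose mass is of order d^(\<alpha> k). The
  choice of d involves negative moments only, so it precedes that of L.\<close>

lemma AE_bad_summable:
  obtains d where "0 < d" "d < 1"
    "\<And>L. AE x in \<Omega>. summable (\<lambda>k. \<Sum>w\<in>words letters (L * k).
       \<Sum>u | bad (len x) (\<lambda>i. lprod i x) (mass x) \<alpha> d L k w u. mass x (w @ u))"
proof -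
  define s where "s = s\<^sub>0 / 2"
  have s: "0 < s" "2 * s \<le> s\<^sub>0" using s0 by (auto simp: s_def)
  have "mom 1 (- s) < \<infinity>" "mom 2 (- s) < \<infinity>"
    using mom_antimono[of "- s\<^sub>0" "- s"] s0 by (auto simp: s_def intro: le_less_trans)
  then obtain \<gamma>1 \<gamma>2 where \<gamma>12: "mom 1 (- s) = ennreal \<gamma>1" "mom 2 (- s) = ennreal \<gamma>2"
    by (cases "mom 1 (- s)"; cases "mom 2 (- s)") auto
  define \<gamma> where "\<gamma> = max 1 (max \<gamma>1 \<gamma>2)"
  have \<gamma>: "1 \<le> \<gamma>" "mom 1 (- s) \<le> ennreal \<gamma>" "mom 2 (- s) \<le> ennreal \<gamma>"
    unfolding \<gamma>12 by (auto simp: \<gamma>_def intro!: ennreal_leI)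
  \<comment> \<open>Makes \<open>d powr s * \<gamma>\<close> equal to 1/2, so that in
    \<open>prob_short\<close> the k letters 2 leave the probability \<open>(1 / 2) ^ k\<close>, up
    to a constant.\<close>
  define d where "d = (1 / (2 * \<gamma>)) powr (1 / s)"
  have d: "0 < d" "d < 1" using \<gamma> s powr_less_mono2[of "1 / s" "1 / (2 * \<gamma>)" 1] by (auto simp: d_def)
  have ds: "d powr s = 1 / (2 * \<gamma>)" using \<gamma> s by (simp add: d_def powr_powr)
  obtain e where e: "0 \<le> e" "(\<integral>\<^sup>+x. ennreal (R.Lim x powr (- s)) \<partial>\<Omega>) = ennreal e"
    using negative_moment_R[OF s] by (cases "\<integral>\<^sup>+x. ennreal (R.Lim x powr (- s)) \<partial>\<Omega>") auto
  obtain M1 where M1: "0 \<le> M1" "(\<integral>\<^sup>+x. ennreal \<bar>M.Lim x\<bar> \<partial>\<Omega>) = ennreal M1"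
  proof -
    have "(\<integral>\<^sup>+x. ennreal \<bar>M.Lim x\<bar> \<partial>\<Omega>) = (\<integral>\<^sup>+x. ennreal (M.Lim x ^ (0 + 1)) \<partial>\<Omega>)"
      using M.AE_Lim_pos by (intro nn_integral_cong_AE) (auto elim: eventually_mono)
    then show ?thesis using M.moment_Lim[of 0] that by (cases "\<integral>\<^sup>+x. ennreal \<bar>M.Lim x\<bar> \<partial>\<Omega>") auto
  qed
  obtain M2 where M2: "0 \<le> M2" "(\<integral>\<^sup>+x. ennreal ((M.Lim x)\<^sup>2) \<partial>\<Omega>) = ennreal M2"
    using M.moment_Lim[of 1] by (cases "\<integral>\<^sup>+x. ennreal ((M.Lim x)\<^sup>2) \<partial>\<Omega>") (auto simp: numeral_2_eq_2)
  have m2: "mom 2 \<alpha> < 1"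
  proof -
    have "mom 2 \<alpha> < mom 2 \<alpha> + mom 1 \<alpha>"
    proof -
      have "mom 2 \<alpha> \<noteq> \<infinity>" using mom_le_1[of \<alpha> 2] \<alpha> by (auto simp: top_unique)
      then have "mom 2 \<alpha> + 0 < mom 2 \<alpha> + mom 1 \<alpha>"
        using mom_pos[OF letter12(1)] by (simp only: ennreal_add_left_cancel_less) simp
      then show ?thesis by simp
    qed
    also have "\<dots> \<le> (mom 2 \<alpha> + mom 1 \<alpha>) + mom 3 \<alpha>" by simp
    also have "\<dots> = 1" using \<alpha>(2) by (simp add: sum_letters add_ac)
    finally show ?thesis .
  qed
  obtain p where p: "0 \<le> p" "mom 2 \<alpha> = ennreal p" "p < 1"
    using m2 by (cases "mom 2 \<alpha>") (auto simp: ennreal_less_one_iff)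
  have m1: "mom 1 \<alpha> \<le> 1" using \<alpha> by (intro mom_le_1) simp
  \<comment> \<open>The end subcells: \<open>V False k\<close> at the end (1, 0) and
    \<open>V True k\<close> at the end (0, 0).\<close>
  define V where "V b k = (if b then [1] else []) @ replicate k (2 :: nat)" for b :: bool and k
  have Vl [measurable]: "V b k \<in> lists letters" for b k
    using letter12 by (auto simp: V_def in_lists_conv_set)
  define g1 where "g1 k x = \<bar>M.Lim x\<bar> * of_bool (1 / d ^ k < \<bar>M.Lim x\<bar>)" for k x
  define g2 where "g2 b k x = of_bool (lprod (V b k) x * R.Lim (subtree (V b k) x) < d ^ k) * \<bar>M.Lim x\<bar>" for b k x
  define g3 where "g3 b k x = lprod (V b k) x powr \<alpha> * \<bar>M.Lim (subtree (V b k) x)\<bar>" for b k x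
  define g4 where "g4 L k x = (\<Sum>u\<in>words letters L. of_bool (lprod u x < d ^ k) * (lprod u x powr \<alpha> * \<bar>M.Lim (subtree u x)\<bar>))" for L k x
  let ?F = "\<lambda>L G x. summable (\<lambda>k. \<Sum>w\<in>words letters (L * k). lprod w x powr \<alpha> * G k (subtree w x))"
  have S1: "AE x in \<Omega>. ?F L g1 x" for L
  proof (rule AE_summable_levels)
    show "g1 k \<in> borel_measurable \<Omega>" for k unfolding g1_def by measurable
    show "(\<integral>\<^sup>+x. ennreal (g1 k x) \<partial>\<Omega>) \<le> ennreal (M2 * d ^ k)" for k
    proof -
      have "g1 k x \<le> (M.Lim x)\<^sup>2 * d ^ k" for x
      proof (cases "1 / d ^ k < \<bar>M.Lim x\<bar>")
        case True
        then have "1 \<le> \<bar>M.Lim x\<bar> * d ^ k" using d by (simp add: divide_less_eq)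
        then have "\<bar>M.Lim x\<bar> * 1 \<le> \<bar>M.Lim x\<bar> * (\<bar>M.Lim x\<bar> * d ^ k)" by (intro mult_left_mono) auto
        then show ?thesis using True by (simp add: g1_def power2_eq_square mult.assoc[symmetric])
      qed (use d in \<open>simp add: g1_def\<close>)
      then have "(\<integral>\<^sup>+x. ennreal (g1 k x) \<partial>\<Omega>) \<le> (\<integral>\<^sup>+x. ennreal ((M.Lim x)\<^sup>2) * ennreal (d ^ k) \<partial>\<Omega>)"
        using d by (intro nn_integral_mono) (simp add: ennreal_mult[symmetric] ennreal_leI)
      also have "\<dots> = ennreal M2 * ennreal (d ^ k)" by (simp add: nn_integral_multc M2)
      finally show ?thesis using M2 d by (simp add: ennreal_mult)
    qed
  qed (use d M2 in \<open>auto simp: g1_def\<close>)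
  have prob_short: "(\<integral>\<^sup>+x. of_bool (lprod (V b k) x * R.Lim (subtree (V b k) x) < d ^ k) \<partial>\<Omega>) \<le> ennreal (\<gamma> * e * (1 / 2) ^ k)" for b k
  proof -
    let ?v = "V b k"
    have "(\<integral>\<^sup>+x. of_bool (lprod ?v x * R.Lim (subtree ?v x) < d ^ k) \<partial>\<Omega>)
      \<le> (\<integral>\<^sup>+x. ennreal ((d ^ k) powr s) * (ennreal (lprod ?v x powr (- s)) * (\<lambda>x. ennreal (R.Lim x powr (- s))) (subtree ?v x)) \<partial>\<Omega>)"
    proof (rule nn_integral_mono_AE)
      show "AE x in \<Omega>. of_bool (lprod ?v x * R.Lim (subtree ?v x) < d ^ k)
        \<le> ennreal ((d ^ k) powr s) * (ennreal (lprod ?v x powr (- s)) * (\<lambda>x. ennreal (R.Lim x powr (- s))) (subtree ?v x))"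
        using AE_good
      proof eventually_elim
        case (elim x)
        define r where "r = lprod ?v x * R.Lim (subtree ?v x)"
        have pos: "0 < lprod ?v x" "0 < R.Lim (subtree ?v x)" using elim Vl by auto
        then have "0 < r" by (simp add: r_def)
        have "1 \<le> (d ^ k) powr s * r powr (- s)" if "r < d ^ k"
        proof -
          have "r powr s \<le> (d ^ k) powr s" using that \<open>0 < r\<close> s by (intro powr_mono2) auto
          then show ?thesis using \<open>0 < r\<close> by (simp add: powr_minus divide_inverse[symmetric] le_divide_eq)
        qed
        moreover have "r powr (- s) = lprod ?v x powr (- s) * R.Lim (subtree ?v x) powr (- s)"
          using pos by (simp add: r_def powr_mult)
        ultimately have "1 \<le> ennreal ((d ^ k) powr s * (lprod ?v x powr (- s) * R.Lim (subtree ?v x) powr (- s)))" if "r < d ^ k"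
          using that by (simp add: ennreal_ge_1)
        then show ?case unfolding r_def[symmetric]
          by (cases "r < d ^ k") (simp_all add: ennreal_mult)
      qed
    qed
    also have "\<dots> = ennreal ((d ^ k) powr s) * ((\<Prod>j\<leftarrow>?v. mom j (- s)) * ennreal e)"
    proof -
      have "(\<integral>\<^sup>+x. ennreal (lprod ?v x powr (- s)) * (\<lambda>x. ennreal (R.Lim x powr (- s))) (subtree ?v x) \<partial>\<Omega>)
        = (\<Prod>j\<leftarrow>?v. mom j (- s)) * ennreal e"
        unfolding e(2)[symmetric] by (rule nn_integral_word[OF Vl]) measurable
      moreover have "(\<integral>\<^sup>+x. ennreal ((d ^ k) powr s) * (ennreal (lprod ?v x powr (- s)) * (\<lambda>x. ennreal (R.Lim x powr (- s))) (subtree ?v x)) \<partial>\<Omega>)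
        = ennreal ((d ^ k) powr s) * (\<integral>\<^sup>+x. ennreal (lprod ?v x powr (- s)) * (\<lambda>x. ennreal (R.Lim x powr (- s))) (subtree ?v x) \<partial>\<Omega>)"
        by (rule nn_integral_cmult) measurable
      ultimately show ?thesis by simp
    qed
    also have "(\<Prod>j\<leftarrow>?v. mom j (- s)) \<le> ennreal (\<gamma> * \<gamma> ^ k)"
    proof -
      have "mom 2 (- s) ^ k \<le> ennreal \<gamma> ^ k" using \<gamma> by (intro power_mono) auto
      then have "1 * mom 2 (- s) ^ k \<le> ennreal \<gamma> * ennreal \<gamma> ^ k" "mom 1 (- s) * mom 2 (- s) ^ k \<le> ennreal \<gamma> * ennreal \<gamma> ^ k"
        using \<gamma> by (intro mult_mono; simp)+
      then have "(\<Prod>j\<leftarrow>?v. mom j (- s)) \<le> ennreal \<gamma> * ennreal \<gamma> ^ k"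
        by (cases b) (simp_all add: V_def lprod_replicate_moment)
      then show ?thesis using \<gamma> by (simp add: ennreal_mult ennreal_power)
    qed
    also have "ennreal ((d ^ k) powr s) * (ennreal (\<gamma> * \<gamma> ^ k) * ennreal e) = ennreal ((d ^ k) powr s * (\<gamma> * \<gamma> ^ k * e))"
      using \<gamma> e by (simp add: ennreal_mult)
    also have "(d ^ k) powr s * (\<gamma> * \<gamma> ^ k * e) = \<gamma> * e * (1 / 2) ^ k"
      using d \<gamma> by (simp add: powr_of_power ds power_divide power_mult_distrib)
    finally show ?thesis by (auto simp: mult_left_mono mult_right_mono)
  qed
  have S2: "AE x in \<Omega>. ?F L (g2 b) x" for L b
  proof (rule AE_summable_levels)
    show "g2 b k \<in> borel_measurable \<Omega>" for k unfolding g2_def by measurable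
    show "(\<integral>\<^sup>+x. ennreal (g2 b k x) \<partial>\<Omega>) \<le> ennreal ((\<gamma> * e + M2) * (3 / 4) ^ k)" for k
    proof -
      let ?B = "\<lambda>x. lprod (V b k) x * R.Lim (subtree (V b k) x) < d ^ k"
      \<comment> \<open>Cutting M at \<open>(3 / 2) ^ k\<close> balances the probability
        \<open>(1 / 2) ^ k\<close> against the second moment: the resulting rates are 3/4 and
        2/3.\<close>
      have "(\<integral>\<^sup>+x. ennreal (g2 b k x) \<partial>\<Omega>)
        \<le> (\<integral>\<^sup>+x. ennreal ((3 / 2) ^ k) * of_bool (?B x) + ennreal ((2 / 3) ^ k) * ennreal ((M.Lim x)\<^sup>2) \<partial>\<Omega>)"
      proof (rule nn_integral_mono)
        fix x
        have "g2 b k x \<le> (3 / 2) ^ k * of_bool (?B x) + (M.Lim x)\<^sup>2 / (3 / 2) ^ k"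
          using mult_of_bool_le[of "(3 / 2) ^ k" "\<bar>M.Lim x\<bar>" "?B x"] by (simp add: g2_def)
        also have "(M.Lim x)\<^sup>2 / (3 / 2) ^ k = (2 / 3) ^ k * (M.Lim x)\<^sup>2" by (simp add: power_divide field_simps)
        finally have "ennreal (g2 b k x) \<le> ennreal ((3 / 2) ^ k * of_bool (?B x) + (2 / 3) ^ k * (M.Lim x)\<^sup>2)"
          by (rule ennreal_leI)
        also have "\<dots> = ennreal ((3 / 2) ^ k * of_bool (?B x)) + ennreal ((2 / 3) ^ k * (M.Lim x)\<^sup>2)"
          by (intro ennreal_plus) auto
        also have "ennreal ((3 / 2) ^ k * of_bool (?B x)) = ennreal ((3 / 2) ^ k) * of_bool (?B x)" by simp
        also have "ennreal ((2 / 3) ^ k * (M.Lim x)\<^sup>2) = ennreal ((2 / 3) ^ k) * ennreal ((M.Lim x)\<^sup>2)"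
          by (intro ennreal_mult) auto
        finally show "ennreal (g2 b k x) \<le> ennreal ((3 / 2) ^ k) * of_bool (?B x) + ennreal ((2 / 3) ^ k) * ennreal ((M.Lim x)\<^sup>2)" .
      qed
      also have "\<dots> = ennreal ((3 / 2) ^ k) * (\<integral>\<^sup>+x. of_bool (?B x) \<partial>\<Omega>) + ennreal ((2 / 3) ^ k) * ennreal M2"
        by (simp add: nn_integral_add nn_integral_cmult M2)
      also have "\<dots> \<le> ennreal ((3 / 2) ^ k) * ennreal (\<gamma> * e * (1 / 2) ^ k) + ennreal ((2 / 3) ^ k) * ennreal M2"
        by (intro add_right_mono mult_left_mono prob_short) auto
      also have "\<dots> = ennreal ((3 / 2) ^ k * (\<gamma> * e * (1 / 2) ^ k) + (2 / 3) ^ k * M2)"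
        using \<gamma> e M2 by (simp add: ennreal_mult ennreal_plus)
      also have "\<dots> \<le> ennreal ((\<gamma> * e + M2) * (3 / 4) ^ k)"
      proof (rule ennreal_leI)
        have "(3 / 2) ^ k * (\<gamma> * e * (1 / 2) ^ k) = \<gamma> * e * (3 / 4 :: real) ^ k"
          by (simp add: power_mult_distrib[symmetric] mult_ac)
        moreover have "M2 * (2 / 3 :: real) ^ k \<le> M2 * (3 / 4) ^ k" using M2 by (intro mult_left_mono power_mono) auto
        ultimately show "(3 / 2) ^ k * (\<gamma> * e * (1 / 2) ^ k) + (2 / 3) ^ k * M2 \<le> (\<gamma> * e + M2) * (3 / 4) ^ k"
          by (simp only: distrib_right mult.commute[of "(2 / 3) ^ k" M2] add_left_mono)
      qed
      finally show ?thesis .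
    qed
  qed (use \<gamma> e M2 in \<open>auto simp: g2_def\<close>)
  have S3: "AE x in \<Omega>. ?F L (g3 b) x" for L b
  proof (rule AE_summable_levels)
    show "g3 b k \<in> borel_measurable \<Omega>" for k unfolding g3_def by measurable
    show "(\<integral>\<^sup>+x. ennreal (g3 b k x) \<partial>\<Omega>) \<le> ennreal (M1 * p ^ k)" for k
    proof -
      have "(\<integral>\<^sup>+x. ennreal (g3 b k x) \<partial>\<Omega>)
        = (\<integral>\<^sup>+x. ennreal (lprod (V b k) x powr \<alpha>) * (\<lambda>x. ennreal \<bar>M.Lim x\<bar>) (subtree (V b k) x) \<partial>\<Omega>)"
        by (intro nn_integral_cong) (simp add: g3_def ennreal_mult)
      also have "\<dots> = (\<Prod>j\<leftarrow>V b k. mom j \<alpha>) * ennreal M1"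
        unfolding M1(2)[symmetric] by (rule nn_integral_word[OF Vl]) measurable
      also have "(\<Prod>j\<leftarrow>V b k. mom j \<alpha>) \<le> ennreal (p ^ k)"
        using p m1 mult_mono[of "mom 1 \<alpha>" 1 "ennreal p ^ k" "ennreal p ^ k"]
        by (cases b) (auto simp: V_def lprod_replicate_moment ennreal_power)
      finally show ?thesis using p M1 by (auto simp: ennreal_mult mult.commute mult_right_mono)
    qed
  qed (use p M1 in \<open>auto simp: g3_def\<close>)
  have S4: "AE x in \<Omega>. ?F L (g4 L) x" for L
  proof (rule AE_summable_levels)
    have ml: "(\<lambda>x. of_bool (lprod u x < d ^ k) * (lprod u x powr \<alpha> * \<bar>M.Lim (subtree u x)\<bar>)) \<in> borel_measurable \<Omega>"
      "(\<lambda>x. \<bar>M.Lim (subtree u x)\<bar>) \<in> borel_measurable \<Omega>"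
      if u: "u \<in> words letters L" for u k
    proof -
      have [measurable]: "u \<in> lists letters" using u by (rule wordsD)
      show "(\<lambda>x. of_bool (lprod u x < d ^ k) * (lprod u x powr \<alpha> * \<bar>M.Lim (subtree u x)\<bar>)) \<in> borel_measurable \<Omega>"
        "(\<lambda>x. \<bar>M.Lim (subtree u x)\<bar>) \<in> borel_measurable \<Omega>" by measurable
    qed
    show "g4 L k \<in> borel_measurable \<Omega>" for k unfolding g4_def[abs_def] using ml by (intro borel_measurable_sum)
    show "(\<integral>\<^sup>+x. ennreal (g4 L k x) \<partial>\<Omega>) \<le> ennreal (real (card (words letters L)) * M1 * (d powr \<alpha>) ^ k)" for k
    proof -
      have "(\<integral>\<^sup>+x. ennreal (g4 L k x) \<partial>\<Omega>) \<le> (\<integral>\<^sup>+x. (\<Sum>u\<in>words letters L. ennreal ((d powr \<alpha>) ^ k) * ennreal \<bar>M.Lim (subtree u x)\<bar>) \<partial>\<Omega>)"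
      proof (rule nn_integral_mono)
        fix x
        have "g4 L k x \<le> (\<Sum>u\<in>words letters L. (d powr \<alpha>) ^ k * \<bar>M.Lim (subtree u x)\<bar>)"
          unfolding g4_def
        proof (rule sum_mono)
          fix u
          have "of_bool (lprod u x < d ^ k) * lprod u x powr \<alpha> \<le> (d ^ k) powr \<alpha>"
            using \<alpha> by (auto intro!: powr_mono2)
          then have "of_bool (lprod u x < d ^ k) * lprod u x powr \<alpha> * \<bar>M.Lim (subtree u x)\<bar> \<le> (d ^ k) powr \<alpha> * \<bar>M.Lim (subtree u x)\<bar>"
            by (intro mult_right_mono) auto
          then show "of_bool (lprod u x < d ^ k) * (lprod u x powr \<alpha> * \<bar>M.Lim (subtree u x)\<bar>) \<le> (d powr \<alpha>) ^ k * \<bar>M.Lim (subtree u x)\<bar>"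
            using d by (simp add: powr_of_power mult.assoc)
        qed
        then show "ennreal (g4 L k x) \<le> (\<Sum>u\<in>words letters L. ennreal ((d powr \<alpha>) ^ k) * ennreal \<bar>M.Lim (subtree u x)\<bar>)"
          by (simp add: ennreal_mult[symmetric] ennreal_leI)
      qed
      also have "\<dots> = (\<Sum>u\<in>words letters L. ennreal ((d powr \<alpha>) ^ k) * (\<integral>\<^sup>+x. ennreal \<bar>M.Lim (subtree u x)\<bar> \<partial>\<Omega>))"
        using ml by (simp add: nn_integral_sum nn_integral_cmult)
      also have "\<dots> = (\<Sum>u\<in>words letters L. ennreal ((d powr \<alpha>) ^ k) * ennreal M1)"
      proof (intro sum.cong refl arg_cong2[of _ _ _ _ "(*)"])
        fix u assume "u \<in> words letters L"
        then have u: "u \<in> lists letters" by (rule wordsD)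
        show "(\<integral>\<^sup>+x. ennreal \<bar>M.Lim (subtree u x)\<bar> \<partial>\<Omega>) = ennreal M1"
          using nn_integral_distr[OF measurable_subtree[OF u], of "\<lambda>x. ennreal \<bar>M.Lim x\<bar>"]
          by (simp add: distr_subtree[OF u] M1)
      qed
      also have "\<dots> = ennreal (real (card (words letters L)) * M1 * (d powr \<alpha>) ^ k)"
        using M1 by (simp add: ennreal_of_nat_eq_real_of_nat ennreal_mult[symmetric] mult_ac)
      finally show ?thesis .
    qed
  qed (use M1 d \<alpha> powr_less_mono2[of \<alpha> d 1] in \<open>auto simp: g4_def intro!: sum_nonneg\<close>)
  have "AE x in \<Omega>. summable (\<lambda>k. \<Sum>w\<in>words letters (L * k).
       \<Sum>u | bad (len x) (\<lambda>i. lprod i x) (mass x) \<alpha> d L k w u. mass x (w @ u))" for L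
    using AE_good S1[of L] S2[of True L] S2[of False L] S3[of True L] S3[of False L] S4[of L]
  proof eventually_elim
    case (elim x)
    let ?bad = "bad (len x) (\<lambda>i. lprod i x) (mass x) \<alpha> d L"
    let ?G = "\<lambda>k y. g1 k y + g2 True k y + g2 False k y + g3 True k y + g3 False k y + g4 L k y"
    have "?F L ?G x"
      using summable_add[OF summable_add[OF summable_add[OF summable_add[OF summable_add[OF elim(2) elim(3)] elim(4)] elim(5)] elim(6)] elim(7)]
      by (simp add: sum.distrib distrib_left)
    then show ?case
    proof (rule summable_comparison_test'[of _ 0])
      fix k
      \<comment> \<open>By self-similarity the mass discarded below w is
        \<open>lprod w x powr \<alpha>\<close> times a quantity of the subtree at w, and each clause
        of \<open>bad\<close> is matched with one of the functions above.\<close>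
      have main: "0 \<le> (\<Sum>u | ?bad k w u. mass x (w @ u)) \<and>
        (\<Sum>u | ?bad k w u. mass x (w @ u)) \<le> lprod w x powr \<alpha> * ?G k (subtree w x)"
        if w: "w \<in> words letters (L * k)" for w
      proof -
        have wl: "w \<in> lists letters" using w by (rule wordsD)
        define y where "y = subtree w x"
        define l where "l = lprod w x"
        have l: "0 < l" using elim(1) wl by (simp add: l_def)
        have My: "0 < M.Lim (subtree u y)" if "u \<in> lists letters" for u
          using elim(1)[rule_format, of "w @ u"] wl that by (simp add: y_def subtree_append)
        define f where "f u = lprod u y powr \<alpha> * \<bar>M.Lim (subtree u y)\<bar>" for u
        have f0: "0 \<le> f u" for u by (simp add: f_def)
        have mass_eq: "mass x (w @ u) = l powr \<alpha> * f u" if "u \<in> lists letters" for u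
          using My[OF that] by (simp add: mass_def lprod_append subtree_append powr_mult l_def y_def f_def)
        have len_eq: "len x (w @ u) = l * (lprod u y * R.Lim (subtree u y))" for u
          by (simp add: len_def lprod_append subtree_append l_def y_def)
        define P where "P \<longleftrightarrow> 1 / d ^ k < \<bar>M.Lim y\<bar> \<or> lprod (V True k) y * R.Lim (subtree (V True k) y) < d ^ k
          \<or> lprod (V False k) y * R.Lim (subtree (V False k) y) < d ^ k"
        let ?S4 = "{u \<in> words letters L. lprod u y < d ^ k}"
        have "{u. ?bad k w u} \<subseteq> (if P then {[]} else {}) \<union> ({V True k} \<union> ({V False k} \<union> ?S4))"
        proof
          fix u assume "u \<in> {u. ?bad k w u}"
          then consider "u = []" "l powr \<alpha> / d ^ k < mass x w \<or> len x (w @ V False k) < l * d ^ k \<or> len x (w @ V True k) < l * d ^ k"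
            | "u = V False k" | "u = V True k" | "u \<in> words letters L" "lprod (w @ u) x < l * d ^ k"
            by (auto simp: bad_def V_def l_def)
          then show "u \<in> (if P then {[]} else {}) \<union> ({V True k} \<union> ({V False k} \<union> ?S4))"
          proof cases
            case 1
            have "l powr \<alpha> / d ^ k < mass x w \<longleftrightarrow> 1 / d ^ k < \<bar>M.Lim y\<bar>"
            proof -
              have "mass x w = l powr \<alpha> * \<bar>M.Lim y\<bar>" using My[of "[]"] by (simp add: mass_def l_def y_def)
              moreover have "l powr \<alpha> / d ^ k = l powr \<alpha> * (1 / d ^ k)" by simp
              ultimately show ?thesis using l by (simp only: mult_less_cancel_left_pos powr_gt_zero)
            qed
            then have P using 1(2) l unfolding len_eq P_def by (auto simp: mult_less_cancel_left_pos)
            then show ?thesis using 1 by simp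
          next
            case 4
            then have "lprod u y < d ^ k" using l by (simp add: lprod_append l_def y_def mult_less_cancel_left_pos)
            then show ?thesis using 4 by simp
          qed auto
        qed
        then have "sum f {u. ?bad k w u} \<le> sum f ((if P then {[]} else {}) \<union> ({V True k} \<union> ({V False k} \<union> ?S4)))"
          using f0 by (intro sum_mono2) auto
        also have "\<dots> \<le> sum f (if P then {[]} else {}) + (sum f {V True k} + (sum f {V False k} + sum f ?S4))"
          using f0 by (intro order_trans[OF sum_Un_le] add_left_mono) auto
        also have "sum f (if P then {[]} else {}) \<le> g1 k y + g2 True k y + g2 False k y"
          by (auto simp: P_def f_def g1_def g2_def)
        also have "sum f ?S4 = g4 L k y"
          unfolding g4_def f_def by (intro sum.mono_neutral_cong_left) auto
        also have "sum f {V True k} = g3 True k y" by (simp add: f_def g3_def)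
        also have "sum f {V False k} = g3 False k y" by (simp add: f_def g3_def)
        finally have "sum f {u. ?bad k w u} \<le> ?G k y" by (simp add: add.assoc)
        moreover have "(\<Sum>u | ?bad k w u. mass x (w @ u)) = l powr \<alpha> * sum f {u. ?bad k w u}"
          unfolding sum_distrib_left using bad_letters by (intro sum.cong refl mass_eq) auto
        ultimately show ?thesis using f0 by (simp add: l_def y_def sum_nonneg mult_left_mono)
      qed
      have "0 \<le> (\<Sum>w\<in>words letters (L * k). \<Sum>u | ?bad k w u. mass x (w @ u))"
        using main by (rule sum_nonneg[OF conjunct1])
      moreover have "(\<Sum>w\<in>words letters (L * k). \<Sum>u | ?bad k w u. mass x (w @ u))
        \<le> (\<Sum>w\<in>words letters (L * k). lprod w x powr \<alpha> * ?G k (subtree w x))"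
        using main by (rule sum_mono[OF conjunct2])
      ultimately show "norm (\<Sum>w\<in>words letters (L * k). \<Sum>u | ?bad k w u. mass x (w @ u))
        \<le> (\<Sum>w\<in>words letters (L * k). lprod w x powr \<alpha> * ?G k (subtree w x))" by simp
    qed
  qed
  then show ?thesis using that d by blast
qed

end


section \<open>The dimension of almost every realisation\<close>

lemma cascade_prod_Cons: "cascade_prod v (j # i) = v [j] * cascade_prod (\<lambda>u. v (j # u)) i"
proof -
  have "cascade_prod v (j # i) = (\<Prod>m = Suc 0..Suc (length i). v (take m (j # i)))"
    by (simp add: cascade_prod_def One_nat_def)
  also have "\<dots> = v [j] * (\<Prod>m = Suc (Suc 0)..Suc (length i). v (take m (j # i)))"
    by (subst prod.atLeast_Suc_atMost) auto
  also have "(\<Prod>m = Suc (Suc 0)..Suc (length i). v (take m (j # i))) = (\<Prod>m = Suc 0..length i. v (take (Suc m) (j # i)))"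
    by (subst prod.atLeast_Suc_atMost_Suc_shift) (simp add: comp_def)
  finally show ?thesis by (simp add: cascade_prod_def One_nat_def)
qed

text \<open>Links weights on words with a configuration of the product space; within these bounds
  \<open>clip\<close> is the identity.\<close>

definition realises :: "(nat list \<Rightarrow> nat \<Rightarrow> real) \<Rightarrow> (nat list \<Rightarrow> real) \<Rightarrow> bool" where
  "realises x v \<longleftrightarrow> (\<forall>i\<in>lists letters. \<forall>j\<in>letters. v (i @ [j]) = x i j \<and> 0 \<le> x i j \<and> x i j \<le> 1)"

lemma cascade_prod_eq: "realises x v \<Longrightarrow> i \<in> lists letters \<Longrightarrow> cascade_prod v i = lprod i x"
proof (induction i arbitrary: x v rule: list.induct)
  case (Cons j i)
  have "v ([] @ [j]) = x [] j \<and> 0 \<le> x [] j \<and> x [] j \<le> 1"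
    using Cons.prems unfolding realises_def by blast
  then have "v [j] = clip (x [] j)" by (simp add: clip_id)
  moreover have "realises (branch j x) (\<lambda>u. v (j # u))"
    using Cons.prems unfolding realises_def branch_def
    by (metis (no_types, lifting) Cons_in_lists_iff append_Cons restrict_apply')
  ultimately show ?case using Cons by (simp add: cascade_prod_Cons)
qed (simp add: cascade_prod_def)

context cascade_system
begin

lemma limit_factor_eq:
  assumes v: "realises x v" and pos: "\<forall>i\<in>lists letters. 0 < lprod i x" and i: "i \<in> lists letters"
  shows "limit_factor v i = R.Lim (subtree i x)"
proof -
  have "(\<Sum>j\<in>words {1, 2} n. cascade_prod v (i @ j) / cascade_prod v i) = R.Y n (subtree i x)" for n
    unfolding R.Y_def
  proof (rule sum.cong[OF refl])
    fix j assume "j \<in> words {1, 2} n"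
    then have "j \<in> lists letters" by (rule R.words_A)
    moreover have "0 < lprod i x" using pos i by blast
    ultimately show "cascade_prod v (i @ j) / cascade_prod v i = lprod j (subtree i x) powr 1"
      using i by (simp add: cascade_prod_eq[OF v] lprod_append)
  qed
  then show ?thesis by (simp add: limit_factor_def R.Lim_def)
qed

text \<open>The exceptional null set is a set of configurations chosen before v, so it can be pulled
  back to the original probability space. Countably many exponents \<alpha> + 1 / (n + 1) and block
  lengths L suffice.\<close>

lemma AE_dimension:
  assumes c: "0 < c" "c < 1 / 2"
  shows "AE x in \<Omega>. \<forall>v. realises x v \<longrightarrow>
    Metric_space (fractal c) (resistance c v) \<and> hausdorff_dim (fractal c) (resistance c v) = ereal \<alpha>"
proof -
  interpret fractal_scale c by unfold_locales (use c in auto)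
  obtain d where d: "0 < d" "d < 1"
    "\<And>L. AE x in \<Omega>. summable (\<lambda>k. \<Sum>w\<in>words letters (L * k).
       \<Sum>u | bad (len x) (\<lambda>i. lprod i x) (mass x) \<alpha> d L k w u. mass x (w @ u))"
    by (rule AE_bad_summable) blast
  obtain \<eta> where \<eta>: "0 < \<eta>" "\<eta> < 1" "AE x in \<Omega>. \<exists>C. \<forall>i\<in>lists letters. lprod i x \<le> C * \<eta> ^ length i"
    by (rule AE_decay) blast
  have bad: "AE x in \<Omega>. \<forall>L. summable (\<lambda>k. \<Sum>w\<in>words letters (L * k).
       \<Sum>u | bad (len x) (\<lambda>i. lprod i x) (mass x) \<alpha> d L k w u. mass x (w @ u))"
    using d(3) by (subst AE_all_countable) blast
  have sums: "AE x in \<Omega>. \<forall>n. \<exists>C r. 0 < r \<and> r < 1 \<and>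
    (\<forall>m. (\<Sum>u\<in>words letters m. len x u powr (\<alpha> + 1 / real (Suc n))) \<le> C * (r\<^sup>2) ^ m)"
    unfolding len_def using AE_power_sums by (subst AE_all_countable) simp
  show ?thesis
    using bad sums \<eta>(3) AE_good R.AE_Lim_good M.AE_Lim_good
  proof eventually_elim
    case (elim x)
    note pos = elim(4)[rule_format]
    show ?case
    proof (intro allI impI)
      fix v assume v: "realises x v"
      have lprod_snoc: "lprod (i @ [j]) x = lprod i x * clip (subtree i x [] j)" for i j
        by (simp add: lprod_append)
      have len_snoc: "len x i = len x (i @ [1]) + len x (i @ [2])" if "i \<in> lists letters" for i
        using elim(5)[rule_format, OF that] by (simp add: len_def lprod_snoc distrib_left mult.assoc)
      have edge: "edge_lengths (len x)"
        unfolding edge_lengths_def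
      proof (intro ballI conjI)
        show "0 < len x i" if "i \<in> lists letters" for i using pos[OF that] by (simp add: len_def)
      qed (rule len_snoc)
      \<comment> \<open>The exponent \<alpha> + 1, the case n = 0, already yields a summable bound
        for the longest edge of each level.\<close>
      obtain C r where Cr: "0 < r" "r < 1" "\<And>m. (\<Sum>u\<in>words letters m. len x u powr (\<alpha> + 1 / real (Suc 0))) \<le> C * (r\<^sup>2) ^ m"
        using elim(2) by blast
      define t where "t = \<alpha> + 1"
      have t: "0 < t" using \<alpha> by (simp add: t_def)
      have C0: "0 \<le> C"
      proof -
        have "0 \<le> (\<Sum>u\<in>words letters 0. len x u powr (\<alpha> + 1 / real (Suc 0)))" by simp
        also have "\<dots> \<le> C" using Cr(3)[of 0] by simp
        finally show ?thesis .
      qed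
      define b where "b n = C powr (1 / t) * ((r\<^sup>2) powr (1 / t)) ^ n" for n
      have "summable b"
      proof -
        have "r\<^sup>2 < 1" using Cr by (simp add: power_less_one_iff)
        then have "(r\<^sup>2) powr (1 / t) < 1" using Cr t powr_less_mono2[of "1 / t" "r\<^sup>2" 1] by simp
        then show ?thesis unfolding b_def[abs_def] by (intro summable_mult summable_geometric) simp
      qed
      moreover have "len x i \<le> b (length i)" if i: "i \<in> lists letters" for i
      proof -
        have "0 < len x i" using pos[OF i] by (simp add: len_def)
        have "len x i powr t \<le> (\<Sum>u\<in>words letters (length i). len x u powr t)"
          using i lists_words by (intro member_le_sum) auto
        also have "\<dots> \<le> C * (r\<^sup>2) ^ length i" using Cr(3)[of "length i"] by (simp add: t_def)
        finally have "(len x i powr t) powr (1 / t) \<le> (C * (r\<^sup>2) ^ length i) powr (1 / t)"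
          using t by (intro powr_mono2) auto
        also have "\<dots> = b (length i)"
          using C0 Cr powr_of_power[of "r\<^sup>2" "length i" "1 / t"] by (simp add: b_def powr_mult)
        finally show ?thesis using t \<open>0 < len x i\<close> by (simp add: powr_powr)
      qed
      moreover have "len x i = cascade_prod v i * limit_factor v i" if "i \<in> lists letters" for i
        using that pos by (simp add: len_def cascade_prod_eq[OF v] limit_factor_eq[OF v])
      ultimately interpret resistance_form c v "len x" b
        using edge by unfold_locales auto
      have "hausdorff_dim T res = ereal \<alpha>"
      proof (rule hausdorff_dim_eqI)
        show "\<exists>s>0. s \<le> \<alpha> + e \<and> hausdorff_measure T res s T = 0" if e: "0 < e" for e
        proof -
          obtain n where n: "inverse (real (Suc n)) < e" using reals_Archimedean[OF e] by blast
          obtain C r where "0 < r" "r < 1" "\<And>m. (\<Sum>u\<in>words letters m. len x u powr (\<alpha> + 1 / real (Suc n))) \<le> C * (r\<^sup>2) ^ m"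
            using elim(2) by blast
          then have "hausdorff_measure T res (\<alpha> + 1 / real (Suc n)) T = 0"
            using \<alpha> by (intro hausdorff_measure_0) (auto intro: add_pos_pos)
          then show ?thesis using n \<alpha> by (intro exI[of _ "\<alpha> + 1 / real (Suc n)"]) (auto simp: inverse_eq_divide intro: add_pos_pos)
        qed
        show "hausdorff_measure T res s T \<noteq> 0" if s: "0 < s" "s < \<alpha>" for s
        proof -
          \<comment> \<open>L depends on s and comes after d: the decay over L letters has to beat a
            deviation that is already fixed.\<close>
          have "(\<lambda>L. (\<eta> powr (\<alpha> - s)) ^ L) \<longlonglongrightarrow> 0"
            using \<eta> s powr_less_mono2[of "\<alpha> - s" \<eta> 1] by (intro LIMSEQ_realpow_zero) auto
          then have "\<forall>\<^sub>F L in sequentially. (\<eta> powr (\<alpha> - s)) ^ L < d powr (2 * \<alpha> + 1)"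
            using d by (intro order_tendstoD) auto
          then have "\<forall>\<^sub>F L in sequentially. (\<eta> powr (\<alpha> - s)) ^ L < d powr (2 * \<alpha> + 1) \<and> 0 < L"
            using eventually_gt_at_top by (rule eventually_conj)
          then obtain L where L: "(\<eta> powr (\<alpha> - s)) ^ L < d powr (2 * \<alpha> + 1)" "0 < L"
            using eventually_happens'[OF sequentially_bot] by blast
          obtain C\<^sub>0 where C\<^sub>0: "\<And>i. i \<in> lists letters \<Longrightarrow> lprod i x \<le> C\<^sub>0 * \<eta> ^ length i" using elim(3) by blast
          show ?thesis
          proof (rule hausdorff_measure_lower[where l = "\<lambda>i. lprod i x" and \<mu> = "mass x" and s = s])
            show "(\<eta> ^ L) powr (\<alpha> - s) \<le> d powr (2 * \<alpha> + 1)" using L \<eta> by (simp add: powr_of_power)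
            show "mass x i = (\<Sum>j\<in>letters. mass x (i @ [j]))" if "i \<in> lists letters" for i
              using elim(6)[rule_format, OF that] by (simp add: mass_def lprod_snoc powr_mult sum_distrib_left mult.assoc)
            show "0 \<le> mass x i" if "i \<in> lists letters" for i using pos[OF that] by (simp add: mass_def)
            show "0 < mass x []" using pos[of "[]"] by (simp add: mass_def)
            show "summable (\<lambda>k. \<Sum>w\<in>words letters (L * k). \<Sum>u | bad (len x) (\<lambda>i. lprod i x) (mass x) \<alpha> d L k w u. mass x (w @ u))"
              using elim(1) by blast
          qed (use pos C\<^sub>0 \<eta> d s L in auto)
        qed
      qed (use \<alpha> in auto)
      then show "Metric_space (fractal c) (resistance c v) \<and> hausdorff_dim (fractal c) (resistance c v) = ereal \<alpha>"
        using res_metric by simp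
    qed
  qed
qed

end

section \<open>The law of the cascade\<close>

text \<open>Iterating the hypothesis on small values with \<open>p = 1 / 2\<close> gives a geometric tail.\<close>

lemma (in prob_space) negative_moment:
  fixes f :: "'a \<Rightarrow> real"
  assumes [measurable]: "f \<in> borel_measurable M"
    and f: "\<And>\<omega>. \<omega> \<in> space M \<Longrightarrow> f \<omega> \<le> 1" "AE \<omega> in M. 0 < f \<omega>"
    and \<epsilon>: "0 < \<epsilon>" "\<And>x. x \<in> {0<..1} \<Longrightarrow> \<P>(\<omega> in M. f \<omega> \<le> x * \<epsilon> \<bar> f \<omega> \<le> x) \<le> 1 / 2"
    and s: "\<epsilon> powr (- s) \<le> 3 / 2"
  shows "\<epsilon> < 1" "(\<integral>\<^sup>+\<omega>. ennreal (f \<omega> powr (- s)) \<partial>M) < \<infinity>"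
proof -
  \<comment> \<open>For x = 1 the conditioning event is the whole space, and a larger \<epsilon>
    would give the conditional probability 1.\<close>
  show \<epsilon>1: "\<epsilon> < 1"
  proof (rule ccontr)
    assume "\<not> \<epsilon> < 1"
    then have "{\<omega> \<in> space M. f \<omega> \<le> 1 * \<epsilon> \<and> f \<omega> \<le> 1} = space M" "{\<omega> \<in> space M. f \<omega> \<le> 1} = space M"
      using f(1) by force+
    then have "\<P>(\<omega> in M. f \<omega> \<le> 1 * \<epsilon> \<bar> f \<omega> \<le> 1) = 1" by (simp add: cond_prob_def prob_space)
    then show False using \<epsilon>(2)[of 1] by simp
  qed
  have pow: "\<P>(\<omega> in M. f \<omega> \<le> \<epsilon> ^ n) \<le> (1 / 2) ^ n" for n
  proof (induction n)
    case (Suc n)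
    have x: "\<epsilon> ^ n \<in> {0<..1}" using \<epsilon> \<epsilon>1 by (auto intro: power_le_one)
    have sub: "f \<omega> \<le> \<epsilon> ^ n * \<epsilon> \<Longrightarrow> f \<omega> \<le> \<epsilon> ^ n" for \<omega>
    proof -
      have "\<epsilon> ^ n * \<epsilon> \<le> \<epsilon> ^ n * 1" using x \<epsilon>1 by (intro mult_left_mono) auto
      then show "f \<omega> \<le> \<epsilon> ^ n * \<epsilon> \<Longrightarrow> f \<omega> \<le> \<epsilon> ^ n" by simp
    qed
    show ?case
    proof (cases "\<P>(\<omega> in M. f \<omega> \<le> \<epsilon> ^ n) = 0")
      \<comment> \<open>The conditional probability is a quotient by 0 here, hence 0, and the
        hypothesis is void; monotonicity suffices.\<close>
      case True
      have "\<P>(\<omega> in M. f \<omega> \<le> \<epsilon> ^ n * \<epsilon>) \<le> \<P>(\<omega> in M. f \<omega> \<le> \<epsilon> ^ n)"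
        using sub by (intro finite_measure_mono) auto
      also have "\<dots> \<le> (1 / 2) ^ Suc n" unfolding True by simp
      finally show ?thesis by (simp add: mult.commute)
    next
      case False
      have "{\<omega> \<in> space M. f \<omega> \<le> \<epsilon> ^ n * \<epsilon> \<and> f \<omega> \<le> \<epsilon> ^ n} = {\<omega> \<in> space M. f \<omega> \<le> \<epsilon> ^ n * \<epsilon>}"
        using sub by auto
      then have "\<P>(\<omega> in M. f \<omega> \<le> \<epsilon> ^ n * \<epsilon>) / \<P>(\<omega> in M. f \<omega> \<le> \<epsilon> ^ n) \<le> 1 / 2"
        using \<epsilon>(2)[OF x] by (simp add: cond_prob_def)
      moreover have "0 < \<P>(\<omega> in M. f \<omega> \<le> \<epsilon> ^ n)" using False by (simp add: zero_less_measure_iff)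
      ultimately have "\<P>(\<omega> in M. f \<omega> \<le> \<epsilon> ^ n * \<epsilon>) \<le> 1 / 2 * \<P>(\<omega> in M. f \<omega> \<le> \<epsilon> ^ n)"
        by (simp add: divide_le_eq)
      also have "\<dots> \<le> 1 / 2 * (1 / 2) ^ n" using Suc by (intro mult_left_mono) auto
      finally show ?thesis by (simp add: mult.commute)
    qed
  qed (simp add: prob_space)
  \<comment> \<open>Where f lies between \<open>\<epsilon> ^ Suc n\<close> and
    \<open>\<epsilon> ^ n\<close>, the integrand is at most \<open>(3 / 2) ^ Suc n\<close>; with the
    tail bound \<open>(1 / 2) ^ n\<close> the series has ratio 3/4.\<close>
  have "(\<integral>\<^sup>+\<omega>. ennreal (f \<omega> powr (- s)) \<partial>M)
    \<le> (\<integral>\<^sup>+\<omega>. (\<Sum>n. ennreal ((3 / 2) ^ Suc n) * of_bool (f \<omega> \<le> \<epsilon> ^ n)) \<partial>M)"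
  proof (rule nn_integral_mono_AE)
    show "AE \<omega> in M. ennreal (f \<omega> powr (- s)) \<le> (\<Sum>n. ennreal ((3 / 2) ^ Suc n) * of_bool (f \<omega> \<le> \<epsilon> ^ n))"
      using f(2) AE_space
    proof eventually_elim
      case (elim \<omega>)
      have "(\<lambda>n. \<epsilon> ^ n) \<longlonglongrightarrow> 0" using \<epsilon> \<epsilon>1 by (intro LIMSEQ_realpow_zero) auto
      then have "\<forall>\<^sub>F n in sequentially. \<epsilon> ^ n < f \<omega>" using elim by (intro order_tendstoD)
      then have ex: "\<exists>n. \<epsilon> ^ n < f \<omega>" using eventually_happens'[OF sequentially_bot] by blast
      define m where "m = (LEAST n. \<epsilon> ^ n < f \<omega>)"
      have m: "\<epsilon> ^ m < f \<omega>" unfolding m_def using ex by (rule LeastI_ex)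
      then have "m \<noteq> 0" using f(1)[of \<omega>] elim by (cases m) auto
      then obtain n where n: "m = Suc n" by (cases m) auto
      then have "f \<omega> \<le> \<epsilon> ^ n" using not_less_Least[of n "\<lambda>n. \<epsilon> ^ n < f \<omega>"] by (simp add: m_def not_less)
      have "f \<omega> powr (- s) \<le> (3 / 2) ^ Suc n"
      proof (cases "0 \<le> s")
        case True
        then have "f \<omega> powr (- s) \<le> (\<epsilon> ^ Suc n) powr (- s)" using m n \<epsilon> by (intro powr_mono2') auto
        also have "\<dots> = (\<epsilon> powr (- s)) ^ Suc n" by (rule powr_of_power[OF \<epsilon>(1)])
        also have "\<dots> \<le> (3 / 2) ^ Suc n" using s by (intro power_mono) auto
        finally show ?thesis .
      next
        case False
        then have "f \<omega> powr (- s) \<le> 1 powr (- s)" using elim f(1)[of \<omega>] by (intro powr_mono2) auto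
        also have "\<dots> \<le> (3 / 2) ^ Suc n" using one_le_power[of "3 / 2 :: real" "Suc n"] by simp
        finally show ?thesis .
      qed
      then have "ennreal (f \<omega> powr (- s)) \<le> ennreal ((3 / 2) ^ Suc n) * of_bool (f \<omega> \<le> \<epsilon> ^ n)"
        using \<open>f \<omega> \<le> \<epsilon> ^ n\<close> by (simp add: ennreal_leI)
      also have "\<dots> \<le> (\<Sum>n. ennreal ((3 / 2) ^ Suc n) * of_bool (f \<omega> \<le> \<epsilon> ^ n))"
        by (rule suminf_term_le)
      finally show ?case .
    qed
  qed
  also have "\<dots> = (\<Sum>n. \<integral>\<^sup>+\<omega>. ennreal ((3 / 2) ^ Suc n) * of_bool (f \<omega> \<le> \<epsilon> ^ n) \<partial>M)"
    by (rule nn_integral_suminf) measurable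
  also have "\<dots> \<le> (\<Sum>n. ennreal (3 / 2 * (3 / 4) ^ n))"
  proof (intro suminf_le)
    fix n
    have "(\<integral>\<^sup>+\<omega>. ennreal ((3 / 2) ^ Suc n) * of_bool (f \<omega> \<le> \<epsilon> ^ n) \<partial>M)
      = ennreal ((3 / 2) ^ Suc n) * (\<integral>\<^sup>+\<omega>. indicator {\<omega> \<in> space M. f \<omega> \<le> \<epsilon> ^ n} \<omega> \<partial>M)"
      by (subst nn_integral_cmult[symmetric]) (auto intro!: nn_integral_cong simp: indicator_def)
    also have "\<dots> = ennreal ((3 / 2) ^ Suc n) * ennreal (\<P>(\<omega> in M. f \<omega> \<le> \<epsilon> ^ n))"
      by (subst nn_integral_indicator) (auto simp: emeasure_eq_measure)
    also have "\<dots> \<le> ennreal ((3 / 2) ^ Suc n) * ennreal ((1 / 2) ^ n)"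
      by (intro mult_left_mono ennreal_leI pow) auto
    also have "\<dots> = ennreal (3 / 2 * (3 / 4) ^ n)"
    proof -
      have "(3 / 2) ^ Suc n * (1 / 2) ^ n = 3 / 2 * (3 / 4 :: real) ^ n"
        by (simp add: power_mult_distrib[symmetric] mult.assoc)
      then show ?thesis by (subst ennreal_mult[symmetric]) (auto simp del: power_Suc)
    qed
    finally show "(\<integral>\<^sup>+\<omega>. ennreal ((3 / 2) ^ Suc n) * of_bool (f \<omega> \<le> \<epsilon> ^ n) \<partial>M) \<le> ennreal (3 / 2 * (3 / 4) ^ n)" .
  qed auto
  also have "\<dots> < \<infinity>" by (subst suminf_ennreal2) (auto intro!: summable_mult)
  finally show "(\<integral>\<^sup>+\<omega>. ennreal (f \<omega> powr (- s)) \<partial>M) < \<infinity>" .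
qed

theorem theorem6:
  fixes M :: "'a measure" and w :: "nat list \<Rightarrow> 'a \<Rightarrow> real" and c :: real
  assumes c: "0 < c" "c < 1 / 2"
    and cascade: "cascade M w"
    and A: "(\<integral>\<omega>. w [1] \<omega> + w [2] \<omega> \<partial>M) = 1"
    and B: "(\<Sum>i\<in>letters. \<P>(\<omega> in M. w [i] \<omega> = 1)) < 1"
    and C1: "prob_space.indep_vars M (\<lambda>_. borel) (\<lambda>i. w [i]) letters"
    and C2: "\<forall>p::real. 0 < p \<and> p < 1 \<longrightarrow>
               (\<exists>\<epsilon>>0. \<forall>x\<in>{0<..1}. \<forall>i\<in>letters.
                  \<P>(\<omega> in M. w [i] \<omega> \<le> x * \<epsilon> \<bar> w [i] \<omega> \<le> x) \<le> p)"
  shows "\<exists>\<alpha>>0. (\<forall>\<theta>>0. (\<integral>\<omega>. (\<Sum>i\<in>letters. w [i] \<omega> powr \<theta>) \<partial>M) = 1 \<longleftrightarrow> \<theta> = \<alpha>) \<and>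
           (AE \<omega> in M. Metric_space (fractal c) (resistance c (\<lambda>i. w i \<omega>)) \<and>
              hausdorff_dim (fractal c) (resistance c (\<lambda>i. w i \<omega>)) = ereal \<alpha>)"
proof -
  interpret prob_space M using cascade by (simp add: cascade_def)
  have w: "w i \<in> borel_measurable M" "\<And>\<omega>. \<omega> \<in> space M \<Longrightarrow> 0 \<le> w i \<omega>" "\<And>\<omega>. \<omega> \<in> space M \<Longrightarrow> w i \<omega> \<le> 1"
    "AE \<omega> in M. 0 < w i \<omega>" if "i \<in> lists letters" "i \<noteq> []" for i
  proof -
    have *: "w i \<in> borel_measurable M" "\<forall>\<omega>\<in>space M. w i \<omega> \<in> {0..1}" "AE \<omega> in M. w i \<omega> \<noteq> 0"
      using cascade that by (auto simp: cascade_def)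
    show "w i \<in> borel_measurable M" by (rule *)
    show "\<And>\<omega>. \<omega> \<in> space M \<Longrightarrow> 0 \<le> w i \<omega>" "\<And>\<omega>. \<omega> \<in> space M \<Longrightarrow> w i \<omega> \<le> 1" using *(2) by auto
    show "AE \<omega> in M. 0 < w i \<omega>"
      using *(3) AE_space
    proof eventually_elim
      case (elim \<omega>)
      then show ?case using *(2) by (auto simp: less_le)
    qed
  qed
  have w1 [measurable]: "w [j] \<in> borel_measurable M" if "j \<in> letters" for j using w(1)[of "[j]"] that by simp
  have w1_bounds: "0 \<le> w [j] \<omega>" "w [j] \<omega> \<le> 1" if "j \<in> letters" "\<omega> \<in> space M" for j \<omega>
    using w(2,3)[of "[j]" \<omega>] that by auto
  have w1_pos: "AE \<omega> in M. 0 < w [j] \<omega>" if "j \<in> letters" for j using w(4)[of "[j]"] that by simp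

  define T where "T = Pi\<^sub>M letters (\<lambda>_. borel :: real measure)"
  define X where "X i \<omega> = (\<lambda>j\<in>letters. w (i @ [j]) \<omega>)" for i \<omega>
  define W where "W \<omega> = (\<lambda>i\<in>lists letters. X i \<omega>)" for \<omega>
  have X: "X i \<in> measurable M T" if "i \<in> lists letters" for i
    unfolding X_def[abs_def] T_def using w(1) that by (intro measurable_restrict) auto
  define N where "N = distr M T (X [])"
  have distr_X: "distr M T (X i) = N" if "i \<in> lists letters" for i
    using cascade that by (auto simp: cascade_def N_def X_def[abs_def] T_def)
  have ind: "indep_vars (\<lambda>_. T) X (lists letters)"
    using cascade by (auto simp: cascade_def X_def[abs_def] T_def)
  have "distr M (Pi\<^sub>M (lists letters) (\<lambda>_. T)) (\<lambda>\<omega>. \<lambda>i\<in>lists letters. X i \<omega>) = Pi\<^sub>M (lists letters) (\<lambda>i. distr M T (X i))"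
    using ind by (subst (asm) indep_vars_iff_distr_eq_PiM') (auto intro: X lists.Nil)
  \<comment> \<open>The cascade has the law of the canonical product space, so almost sure
    statements there pull back along \<open>W\<close>.\<close>
  then have law: "distr M (Pi\<^sub>M (lists letters) (\<lambda>_. T)) W = Pi\<^sub>M (lists letters) (\<lambda>_. N)"
    by (simp add: W_def[abs_def] distr_X cong: PiM_cong)
  have X_Nil: "X [] \<in> measurable M T" by (rule X) simp
  interpret L: cascade_law N
  proof (intro cascade_law.intro cascade_law_axioms.intro)
    show "prob_space N" unfolding N_def by (rule prob_space_distr[OF X_Nil])
    show "sets N = sets (Pi\<^sub>M letters (\<lambda>_. borel))" by (simp add: N_def T_def)
    fix j assume j: "j \<in> letters"
    have [measurable]: "(\<lambda>t. t j) \<in> borel_measurable T" unfolding T_def using j by measurable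
    show "AE t in N. 0 < t j"
      unfolding N_def using w1_pos[OF j] j by (subst AE_distr_iff[OF X_Nil]) (auto simp: X_def)
  qed
  have mom_eq: "L.mom j \<theta> = (\<integral>\<^sup>+\<omega>. ennreal (w [j] \<omega> powr \<theta>) \<partial>M)" if j: "j \<in> letters" for j \<theta>
  proof -
    have "(\<lambda>t. ennreal (clip (t j) powr \<theta>)) \<in> borel_measurable T"
      using L.measurable_letter[OF j] by (simp add: N_def)
    then have "(\<integral>\<^sup>+t. ennreal (clip (t j) powr \<theta>) \<partial>N) = (\<integral>\<^sup>+\<omega>. ennreal (clip (X [] \<omega> j) powr \<theta>) \<partial>M)"
      unfolding N_def by (simp add: nn_integral_distr X_Nil)
    then have "L.mom j \<theta> = (\<integral>\<^sup>+\<omega>. ennreal (clip (X [] \<omega> j) powr \<theta>) \<partial>M)"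
      by (simp only: L.mom_def)
    also have "\<dots> = (\<integral>\<^sup>+\<omega>. ennreal (w [j] \<omega> powr \<theta>) \<partial>M)"
      using j w1_bounds[OF j] by (intro nn_integral_cong) (simp add: X_def clip_id)
    finally show ?thesis .
  qed

  define m where "m j \<theta> = (\<integral>\<omega>. w [j] \<omega> powr \<theta> \<partial>M)" for j \<theta>
  have powr_le_1: "w [j] \<omega> powr \<theta> \<le> 1" if "j \<in> letters" "\<omega> \<in> space M" "0 \<le> \<theta>" for j \<omega> \<theta>
    using powr_mono2[of \<theta> "w [j] \<omega>" 1] w1_bounds that by simp
  have int: "integrable M (\<lambda>\<omega>. w [j] \<omega> powr \<theta>)" if "j \<in> letters" "0 \<le> \<theta>" for j \<theta>
    using powr_le_1[OF that(1) _ that(2)] that(1) by (intro integrable_const_bound[of _ 1] AE_I2) auto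
  have mom_m: "L.mom j \<theta> = ennreal (m j \<theta>)" "0 \<le> m j \<theta>" if "j \<in> letters" "0 \<le> \<theta>" for j \<theta>
    unfolding mom_eq[OF that(1)] m_def using int[OF that] by (auto intro!: nn_integral_eq_integral)
  define S where "S \<theta> = (\<Sum>j\<in>letters. m j \<theta>)" for \<theta>
  have S_mom: "(\<Sum>j\<in>letters. L.mom j \<theta>) = ennreal (S \<theta>)" if "0 \<le> \<theta>" for \<theta>
  proof -
    have "(\<Sum>j\<in>letters. L.mom j \<theta>) = (\<Sum>j\<in>letters. ennreal (m j \<theta>))"
      by (intro sum.cong refl mom_m(1) that)
    also have "\<dots> = ennreal (S \<theta>)" unfolding S_def by (intro sum_ennreal mom_m(2) that)
    finally show ?thesis .
  qed
  have S_int: "(\<integral>\<omega>. (\<Sum>i\<in>letters. w [i] \<omega> powr \<theta>) \<partial>M) = S \<theta>" if "0 \<le> \<theta>" for \<theta>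
    unfolding S_def m_def using int that by (intro Bochner_Integration.integral_sum) auto
  have l12: "1 \<in> letters" "2 \<in> letters" by (auto simp: letters_def)
  have m1: "m j 1 = (\<integral>\<omega>. w [j] \<omega> \<partial>M)" if "j \<in> letters" for j
    unfolding m_def using w1_bounds[OF that] by (intro Bochner_Integration.integral_cong) auto
  have int1: "integrable M (w [j])" if "j \<in> letters" for j
    using w1_bounds[OF that] that by (intro integrable_const_bound[of _ 1] AE_I2) auto
  have m12: "m 1 1 + m 2 1 = 1"
    using A int1 l12 by (simp add: m1)

  have m_mono: "m j \<theta>' \<le> m j \<theta>" if "j \<in> letters" "0 \<le> \<theta>" "\<theta> \<le> \<theta>'" for j \<theta> \<theta>'
    unfolding m_def using that w1_bounds[OF that(1)]
    by (intro integral_mono int powr_antimono) auto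
  have m_strict: "m j \<theta>' < m j \<theta>" if j: "j \<in> letters" and \<theta>: "0 \<le> \<theta>" "\<theta> < \<theta>'" and ne: "\<not> (AE \<omega> in M. w [j] \<omega> = 1)" for j \<theta> \<theta>'
  proof (rule ccontr)
    assume "\<not> m j \<theta>' < m j \<theta>"
    then have eq: "m j \<theta>' = m j \<theta>" using m_mono[OF j \<theta>(1), of \<theta>'] \<theta> by simp
    let ?f = "\<lambda>\<omega>. w [j] \<omega> powr \<theta> - w [j] \<omega> powr \<theta>'"
    have "integrable M ?f" using int j \<theta> by auto
    moreover have "AE \<omega> in M. 0 \<le> ?f \<omega>" using powr_antimono w1_bounds[OF j] \<theta> by (intro AE_I2) auto
    moreover have "(\<integral>\<omega>. ?f \<omega> \<partial>M) = 0" using int j \<theta> eq by (simp add: m_def)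
    ultimately have "AE \<omega> in M. ?f \<omega> = 0" using integral_nonneg_eq_0_iff_AE by blast
    then have "AE \<omega> in M. w [j] \<omega> = 1"
      using w1_pos[OF j] AE_space
    proof eventually_elim
      case (elim \<omega>)
      show ?case
      proof (rule ccontr)
        assume "w [j] \<omega> \<noteq> 1"
        then have "w [j] \<omega> < 1" using w1_bounds[OF j] elim by (auto simp: less_le)
        then have "w [j] \<omega> powr \<theta>' < w [j] \<omega> powr \<theta>" using elim \<theta> by (intro powr_less_mono') auto
        then show False using elim by simp
      qed
    qed
    with ne show False by blast
  qed
  \<comment> \<open>Otherwise both weights would be 1 almost surely and condition (A) would read 2 =
    1. This makes \<open>S\<close> strictly decreasing and gives \<open>square12\<close>.\<close>
  have not_one: "\<exists>j\<in>{1, 2}. \<not> (AE \<omega> in M. w [j] \<omega> = 1)"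
  proof (rule ccontr)
    assume neg: "\<not> ?thesis"
    have "m j 1 = 1" if "j \<in> {1, 2}" for j
    proof -
      have "AE \<omega> in M. w [j] \<omega> = 1" using neg that by blast
      moreover have [measurable]: "j \<in> letters" using l12 that by auto
      ultimately have "m j 1 = (\<integral>\<omega>. 1 \<partial>M)"
        unfolding m_def by (intro integral_cong_AE) (auto elim!: eventually_mono)
      then show ?thesis by (simp add: prob_space)
    qed
    then show False using m12 by simp
  qed
  have S_strict: "S \<theta>' < S \<theta>" if "0 \<le> \<theta>" "\<theta> < \<theta>'" for \<theta> \<theta>'
    unfolding S_def
  proof (rule sum_strict_mono_ex1)
    show "\<forall>j\<in>letters. m j \<theta>' \<le> m j \<theta>" using m_mono that by auto
    obtain j where "j \<in> letters" "\<not> (AE \<omega> in M. w [j] \<omega> = 1)" using not_one l12 by blast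
    then show "\<exists>j\<in>letters. m j \<theta>' < m j \<theta>" using m_strict[OF _ that] by blast
  qed simp
  have square12: "m 1 2 + m 2 2 < 1"
  proof -
    have "m 1 2 \<le> m 1 1" "m 2 2 \<le> m 2 1" using m_mono l12 by auto
    moreover have "m 1 2 < m 1 1 \<or> m 2 2 < m 2 1" using not_one m_strict[of 1 1 2] m_strict[of 2 1 2] l12 by auto
    ultimately show ?thesis using m12 by linarith
  qed

  \<comment> \<open>High moments tend to the atom at 1. By condition (B) the atoms add up to less
    than 1, so \<open>S\<close> falls from at least 1 at the exponent 1 to below 1, and the
    intermediate value theorem supplies \<alpha>.\<close>
  have lim: "(\<lambda>n. m j (real n + 1)) \<longlonglongrightarrow> \<P>(\<omega> in M. w [j] \<omega> = 1)" if j: "j \<in> letters" for j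
  proof -
    note [measurable] = j
    have "(\<lambda>n. \<integral>\<omega>. w [j] \<omega> powr (real n + 1) \<partial>M) \<longlonglongrightarrow> (\<integral>\<omega>. indicator {\<omega> \<in> space M. w [j] \<omega> = 1} \<omega> \<partial>M)"
    proof (rule integral_dominated_convergence[where w = "\<lambda>_. 1"])
      show "AE \<omega> in M. (\<lambda>n. w [j] \<omega> powr (real n + 1)) \<longlonglongrightarrow> indicator {\<omega> \<in> space M. w [j] \<omega> = 1} \<omega>"
        using w1_pos[OF j] AE_space
      proof eventually_elim
        case (elim \<omega>)
        show ?case
        proof (cases "w [j] \<omega> = 1")
          case False
          then have "w [j] \<omega> < 1" using w1_bounds[OF j] elim by (auto simp: less_le)
          then have "(\<lambda>n. w [j] \<omega> ^ Suc n) \<longlonglongrightarrow> 0" using elim by (intro LIMSEQ_Suc LIMSEQ_realpow_zero) auto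
          moreover have "w [j] \<omega> powr (real n + 1) = w [j] \<omega> ^ Suc n" for n
            using elim powr_realpow[of "w [j] \<omega>" "Suc n"] by (simp add: add.commute)
          ultimately show ?thesis using False by simp
        qed (use elim in simp)
      qed
      show "AE \<omega> in M. norm (w [j] \<omega> powr (real n + 1)) \<le> 1" for n
        using powr_le_1[OF j] by (intro AE_I2) simp
    qed (use j in auto)
    then show ?thesis by (simp add: m_def)
  qed
  have "(\<lambda>n. S (real n + 1)) \<longlonglongrightarrow> (\<Sum>i\<in>letters. \<P>(\<omega> in M. w [i] \<omega> = 1))"
    unfolding S_def by (intro tendsto_sum lim)
  then have "\<forall>\<^sub>F n in sequentially. S (real n + 1) < 1" using B by (intro order_tendstoD)
  then obtain n where n: "S (real n + 1) < 1" using eventually_happens'[OF sequentially_bot] by blast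
  have "continuous_on {1..real n + 1} S"
    unfolding S_def
  proof (intro continuous_on_sum continuous_on_sequentiallyI)
    fix j u a assume j: "j \<in> letters" and u: "\<forall>k. u k \<in> {1..real n + 1}" "a \<in> {1..real n + 1}" "u \<longlonglongrightarrow> a"
    note [measurable] = j
    show "(\<lambda>k. m j (u k)) \<longlonglongrightarrow> m j a"
      unfolding m_def
    proof (rule integral_dominated_convergence[where w = "\<lambda>_. 1"])
      show "AE \<omega> in M. (\<lambda>k. w [j] \<omega> powr u k) \<longlonglongrightarrow> w [j] \<omega> powr a"
        using w1_pos[OF j] by eventually_elim (intro tendsto_powr tendsto_const u, simp)
      show "AE \<omega> in M. norm (w [j] \<omega> powr u k) \<le> 1" for k
      proof -
        have "1 \<le> u k" using u(1) by simp
        then show ?thesis using powr_le_1[OF j, of _ "u k"] by (intro AE_I2) simp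
      qed
    qed (use j in auto)
  qed
  moreover have "1 \<le> S 1"
  proof -
    have "0 \<le> m 3 1" using mom_m(2)[of 3 1] by (simp add: letters_def)
    then show ?thesis using m12 by (simp add: S_def sum_letters)
  qed
  ultimately obtain \<alpha> where \<alpha>: "1 \<le> \<alpha>" "S \<alpha> = 1"
    using IVT2'[of S "real n + 1" 1 1] n by auto

  obtain \<epsilon> where \<epsilon>: "0 < \<epsilon>" "\<And>x i. x \<in> {0<..1} \<Longrightarrow> i \<in> letters \<Longrightarrow> \<P>(\<omega> in M. w [i] \<omega> \<le> x * \<epsilon> \<bar> w [i] \<omega> \<le> x) \<le> 1 / 2"
    using C2[rule_format, of "1 / 2"] by auto
  have neg: "\<epsilon> < 1 \<and> (\<integral>\<^sup>+\<omega>. ennreal (w [j] \<omega> powr (- s)) \<partial>M) < \<infinity>" if "j \<in> letters" "\<epsilon> powr (- s) \<le> 3 / 2" for j s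
    using negative_moment[OF w1[OF that(1)] w1_bounds(2)[OF that(1)] w1_pos[OF that(1)] \<epsilon>(1) \<epsilon>(2)[OF _ that(1)] that(2)] by blast
  \<comment> \<open>For the order 0 the bound 3/2 holds trivially.\<close>
  have "\<epsilon> < 1" using neg[OF l12(1), of 0] \<epsilon> by simp
  \<comment> \<open>Chosen such that \<open>\<epsilon> powr (- s)\<close> equals 3/2.\<close>
  define s where "s = - ln (3 / 2) / ln \<epsilon>"
  have s: "0 < s" "\<epsilon> powr (- s) \<le> 3 / 2"
    using \<epsilon>(1) \<open>\<epsilon> < 1\<close> by (auto simp: s_def powr_def zero_less_divide_iff divide_less_0_iff)
  interpret L: cascade_system N \<alpha> s
  proof unfold_locales
    show "L.mom 1 1 + L.mom 2 1 = 1"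
      using mom_m l12 m12 by (simp add: ennreal_plus[symmetric] del: ennreal_plus)
    show "L.mom 1 2 + L.mom 2 2 < 1"
      using mom_m l12 square12 by (simp add: ennreal_plus[symmetric] ennreal_less_one_iff del: ennreal_plus)
    show "0 < \<alpha>" "(\<Sum>j\<in>letters. L.mom j \<alpha>) = 1" using \<alpha> S_mom by auto
    show "(\<Sum>j\<in>letters. L.mom j \<theta>) < 1" if "\<alpha> < \<theta>" for \<theta>
      using S_mom[of \<theta>] S_strict[of \<alpha> \<theta>] \<alpha> that by (simp add: ennreal_less_one_iff)
    show "L.mom 1 (- s) < \<infinity>" "L.mom 2 (- s) < \<infinity>" using neg l12 s(2) mom_eq by auto
  qed (rule s)
  have W_meas: "W \<in> measurable M (Pi\<^sub>M (lists letters) (\<lambda>_. T))"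
    unfolding W_def[abs_def] by (intro measurable_restrict X)
  have "AE \<omega> in M. \<forall>v. realises (W \<omega>) v \<longrightarrow>
    Metric_space (fractal c) (resistance c v) \<and> hausdorff_dim (fractal c) (resistance c v) = ereal \<alpha>"
    using AE_distrD[OF W_meas] L.AE_dimension[OF c] unfolding law L.\<Omega>_def by blast
  then have AE: "AE \<omega> in M. Metric_space (fractal c) (resistance c (\<lambda>i. w i \<omega>)) \<and>
      hausdorff_dim (fractal c) (resistance c (\<lambda>i. w i \<omega>)) = ereal \<alpha>"
    using AE_space
  proof eventually_elim
    case (elim \<omega>)
    have "realises (W \<omega>) (\<lambda>i. w i \<omega>)"
      unfolding realises_def using w(2,3)[of "_ @ [_]" \<omega>] elim(2) by (auto simp: W_def X_def)
    then show ?case using elim(1) by blast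
  qed
  have "\<forall>\<theta>>0. (\<integral>\<omega>. (\<Sum>i\<in>letters. w [i] \<omega> powr \<theta>) \<partial>M) = 1 \<longleftrightarrow> \<theta> = \<alpha>"
  proof (intro allI impI)
    fix \<theta> :: real assume "0 < \<theta>"
    then show "(\<integral>\<omega>. (\<Sum>i\<in>letters. w [i] \<omega> powr \<theta>) \<partial>M) = 1 \<longleftrightarrow> \<theta> = \<alpha>"
      using S_int[of \<theta>] S_strict[of \<theta> \<alpha>] S_strict[of \<alpha> \<theta>] \<alpha> by (cases \<theta> \<alpha> rule: linorder_cases) auto
  qed
  then show ?thesis using AE \<alpha> by (intro exI[of _ \<alpha>]) auto
qed

end
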